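(* Assume that $f$, $h$ and $\alpha$ satisfy (A1)–(A2) and (B1)–(B7) (see context). Let $I$ be a closed interval contained in $[V_\ast,V^\ast]$ and let $V>0$ be an interior point of $I$. Then $C^a$ admits a minimum on $\mathcal{U}_V^I$, and $$\inf_{\mathcal{U}_V^I}C^a=\min_{\mathcal{U}_V^{2,I}}C^a .$$
   Context: Dynamics. $f:\mathbf{R}\times\{0,1\}\to\mathbf{R}$ and $\dot x=f(x,u)$, where $x$ is a real-valued speed and $u$ is a piecewise constant control (finitely many discontinuities) with values in $\{0,1\}$. For a piecewise constant $u$, a solution $x$ is an absolutely continuous function satisfying $\dot x(t)=f(x(t),u(t))$ for almost every $t$. $h:\mathbf{R}\times\{0,1\}\to[0,+\infty)$ is $C^1$ in its first variable and $\alpha>0$ is a real constant. Assumptions. (A1) For each $u\in\{0,1\}$, $x\mapsto f(x,u)$ is continuous. (A2) For every $x_0\in\mathbf{R}$ and each constant $u\in\{0,1\}$, the Cauchy problem $\dot x=f(x,u)$, $x(0)=x_0$, has a unique solution in positive time. (Backward uniqueness is not assumed.) (B1) There is $V^\ast>0$ such that $f(x,1)>0$ if $x<V^\ast$, $f(V^\ast,1)=0$, and $f(x,1)<0$ if $x>V^\ast$. (B2) $f(x,0)<f(x,1)$ for every $x$. (B3) There is $V_\ast\in\mathbf{R}$ (possibly negative) such that $f(x,0)<0$ if $x>V_\ast$, $f(x,0)>0$ if $x<V_\ast$, and $f(V_\ast,0)=0$. (B4) $h(x,1)>h(x,0)=0$ for every $x$. (B5) $x\mapsto h(x,1)$ is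 non-decreasing. (B6) All the following integrals converge and $$\int_{V_\ast}^{V^\ast}\frac{h(V^\ast,1)-h(s,1)}{f(s,1)}ds+\alpha<\frac{h(V^\ast,1)}{V^\ast-V_\ast}\left(\int_{V^\ast}^{V_\ast}\frac{s-V_\ast}{f(s,0)}ds+\int_{V_\ast}^{V^\ast}\frac{s-V^\ast}{f(s,1)}ds\right).$$ (B7) The function $F:x\mapsto \dfrac{h(x,1)f(x,0)}{f(x,1)-f(x,0)}$ is either strictly concave or strictly convex. Admissible controls. For $V>0$ and $T_1>0$, an admissible trajectory with average speed $V$ on $[0,T_1]$ is a pair $(x,u):[0,T_1]\to\mathbf{R}\times\{0,1\}$ with $x$ absolutely continuous, $u$ piecewise constant, $\dot x=f(x,u)$ almost everywhere, $x(0)=x(T_1)=V$, $u(0)=u(T_1)$, and $\frac1{T_1}\int_0^{T_1}x(t)\,dt=V$. A piecewise constant $u:[0,T_1]\to\{0,1\}$ is an admissible control for average speed $V$ if there is $x$ such that $(x,u)$ is such a trajectory. $\mathcal{U}^k_V(T_1)$ is the set of admissible controls for average speed $V$ on $[0,T_1]$ with at most $k$ discontinuities; $\mathcal{U}_V^{k,I}(T_1)$ is the subset of those for which the trajectory $x$ takes values in $I$. Set $\mathcal{U}_V^{k,I}=\bigcup_{T_1>0}\mathcal{U}_V^{k,I}(T_1)$ and $\mathcal{U}_V^{I}=\bigcup_{k\in\mathbf{N}}\mathcal{U}_V^{k,I}$. Cost. For $u$ an admissible control on $[0,T_1]$ with trajectory $x$, $$C^a(u)=\frac1{T_1}\left(\int_0^{T_1}h(x(t),u(t))\,dt+\alpha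 N(u)\right),$$ where $N(u)$ is the number of times $u$ jumps from $0$ to $1$. *)

theory Defs
  imports "HOL-Analysis.Analysis"
begin

(* Control values: False is 0, True is 1.  A control or trajectory on [0,T] is a total function of
   which only the restriction to {0..T} matters. *)

definition strictly_convex_on :: "real set \<Rightarrow> (real \<Rightarrow> real) \<Rightarrow> bool" where
  "strictly_convex_on S F \<longleftrightarrow> convex S \<and>
     (\<forall>x\<in>S. \<forall>y\<in>S. \<forall>s. x \<noteq> y \<and> 0 < s \<and> s < 1 \<longrightarrow>
        F ((1 - s) * x + s * y) < (1 - s) * F x + s * F y)"

definition strictly_concave_on :: "real set \<Rightarrow> (real \<Rightarrow> real) \<Rightarrow> bool" where
  "strictly_concave_on S F \<longleftrightarrow> strictly_convex_on S (\<lambda>x. - F x)"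

definition abs_continuous_on :: "real set \<Rightarrow> (real \<Rightarrow> real) \<Rightarrow> bool" where
  "abs_continuous_on S x \<longleftrightarrow>
     (\<forall>\<epsilon>>0. \<exists>\<delta>>0. \<forall>D :: (real \<times> real) set.
        finite D \<and> (\<forall>(a, b)\<in>D. a \<le> b \<and> {a..b} \<subseteq> S) \<and>
        pairwise (\<lambda>(a, b) (c, d). {a<..<b} \<inter> {c<..<d} = {}) D \<and>
        (\<Sum>(a, b)\<in>D. b - a) < \<delta>
        \<longrightarrow> (\<Sum>(a, b)\<in>D. \<bar>x b - x a\<bar>) < \<epsilon>)"

definition solution :: "(real \<Rightarrow> bool \<Rightarrow> real) \<Rightarrow> real \<Rightarrow> (real \<Rightarrow> real) \<Rightarrow> (real \<Rightarrow> bool) \<Rightarrow> bool" where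
  "solution f T x u \<longleftrightarrow> abs_continuous_on {0..T} x \<and>
     (AE t in lborel. t \<in> {0..T} \<longrightarrow>
        (x has_real_derivative f (x t) (u t)) (at t within {0..T}))"

(* Existence on the whole half-line [0,\<infinity>); uniqueness already on every initial segment [0,T]. *)
definition forward_well_posed :: "(real \<Rightarrow> bool \<Rightarrow> real) \<Rightarrow> bool" where
  "forward_well_posed f \<longleftrightarrow> (\<forall>x0 c.
     (\<exists>x. x 0 = x0 \<and> (\<forall>T>0. solution f T x (\<lambda>_. c))) \<and>
     (\<forall>T>0. \<forall>x y. solution f T x (\<lambda>_. c) \<and> x 0 = x0 \<and> solution f T y (\<lambda>_. c) \<and> y 0 = x0
        \<longrightarrow> (\<forall>t\<in>{0..T}. x t = y t)))"

(* bool carries the discrete topology, so a discontinuity is a point of [0,T] near which the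
   control is not constant (an isolated exceptional value counts as one discontinuity). *)
definition discontinuities :: "real \<Rightarrow> (real \<Rightarrow> bool) \<Rightarrow> real set" where
  "discontinuities T u = {t \<in> {0..T}. \<not> continuous (at t within {0..T}) u}"

definition piecewise_constant :: "real \<Rightarrow> (real \<Rightarrow> bool) \<Rightarrow> bool" where
  "piecewise_constant T u \<longleftrightarrow> finite (discontinuities T u)"

(* Jumps from 0 to 1, either when arriving at t or when leaving t.  The two alternatives are
   mutually exclusive, and for a piecewise constant control the number of such t is the number of
   upward steps of the pointwise function on [0,T], isolated and end-point values included. *)
definition up_jumps :: "real \<Rightarrow> (real \<Rightarrow> bool) \<Rightarrow> real set" where
  "up_jumps T u = {t \<in> {0..T}.
     (0 < t \<and> u t \<and> (\<forall>\<^sub>F s in at_left t. \<not> u s)) \<or>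
     (t < T \<and> \<not> u t \<and> (\<forall>\<^sub>F s in at_right t. u s))}"

definition admissible_trajectory ::
    "(real \<Rightarrow> bool \<Rightarrow> real) \<Rightarrow> real \<Rightarrow> real \<Rightarrow> (real \<Rightarrow> real) \<Rightarrow> (real \<Rightarrow> bool) \<Rightarrow> bool" where
  "admissible_trajectory f V T x u \<longleftrightarrow>
     piecewise_constant T u \<and> solution f T x u \<and>
     x 0 = V \<and> x T = V \<and> u 0 = u T \<and> 1 / T * integral {0..T} x = V"

definition admissible_control ::
    "(real \<Rightarrow> bool \<Rightarrow> real) \<Rightarrow> real \<Rightarrow> real \<Rightarrow> (real \<Rightarrow> bool) \<Rightarrow> bool" where
  "admissible_control f V T u \<longleftrightarrow> (\<exists>x. admissible_trajectory f V T x u)"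

(* Under forward_well_posed the values on [0,T] do not depend on the choice. *)
definition trajectory ::
    "(real \<Rightarrow> bool \<Rightarrow> real) \<Rightarrow> real \<Rightarrow> real \<Rightarrow> (real \<Rightarrow> bool) \<Rightarrow> real \<Rightarrow> real" where
  "trajectory f V T u = (SOME x. admissible_trajectory f V T x u)"

definition controls_at ::
    "(real \<Rightarrow> bool \<Rightarrow> real) \<Rightarrow> real \<Rightarrow> nat \<Rightarrow> real \<Rightarrow> (real \<Rightarrow> bool) set" where
  "controls_at f V k T = {u. admissible_control f V T u \<and> card (discontinuities T u) \<le> k}"

definition controls_at_in ::
    "(real \<Rightarrow> bool \<Rightarrow> real) \<Rightarrow> real \<Rightarrow> nat \<Rightarrow> real set \<Rightarrow> real \<Rightarrow> (real \<Rightarrow> bool) set" where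
  "controls_at_in f V k I T = {u \<in> controls_at f V k T. trajectory f V T u ` {0..T} \<subseteq> I}"

(* A control is paired with the length T of its time interval. *)
definition controls_upto ::
    "(real \<Rightarrow> bool \<Rightarrow> real) \<Rightarrow> real \<Rightarrow> nat \<Rightarrow> real set \<Rightarrow> (real \<times> (real \<Rightarrow> bool)) set" where
  "controls_upto f V k I = (SIGMA T:{0<..}. controls_at_in f V k I T)"

definition controls ::
    "(real \<Rightarrow> bool \<Rightarrow> real) \<Rightarrow> real \<Rightarrow> real set \<Rightarrow> (real \<times> (real \<Rightarrow> bool)) set" where
  "controls f V I = (\<Union>k. controls_upto f V k I)"

definition cost ::
    "(real \<Rightarrow> bool \<Rightarrow> real) \<Rightarrow> (real \<Rightarrow> bool \<Rightarrow> real) \<Rightarrow> real \<Rightarrow> real \<Rightarrow> real \<times> (real \<Rightarrow> bool) \<Rightarrow> real" where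
  "cost f h \<alpha> V = (\<lambda>(T, u).
     1 / T * (integral {0..T} (\<lambda>t. h (trajectory f V T u t) (u t)) + \<alpha> * real (card (up_jumps T u))))"

end

theory Submission
  imports Defs
begin

text \<open>
  Along a coasting or accelerating phase time can be traded for speed, \<open>dt = dx / f(x,u)\<close>. A control
  with \<open>N\<close> upward jumps thus becomes a sum of \<open>N\<close> speed intervals \<open>[p, q]\<close>, each swept once up
  and once down, plus rests at the two equilibria. With \<open>w = 1/f(\<cdot>,1) - 1/f(\<cdot>,0)\<close> and \<open>g = -F\<close> an interval
  contributes the time \<open>\<integral> w\<close>, the distance \<open>\<integral> s w\<close> and the cost \<open>\<alpha> + \<integral> g w\<close>, and \<open>g\<close> also prices
  the rests.

  (B6) says that on the whole range \<open>g\<close> falls below its chord by more than \<open>\<alpha>\<close>; this rules out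
  concavity, so \<open>g\<close> is convex. A Lagrange multiplier for the average speed is a line \<open>l\<close>. One looks for \<open>l\<close>
  with \<open>\<integral> (l - g)\<^sup>+ w = \<alpha>\<close> whose interval \<open>{g \<le> l} = [p, q]\<close> has mean speed \<open>V\<close>, possibly after adding
  rests at an equilibrium; it is found by growing \<open>[p, q]\<close> from \<open>V\<close> and, if the boundary of \<open>I\<close> is hit
  first, lifting the line there. By convexity every interval satisfies \<open>\<alpha> + \<integral> (g - l) w \<ge> 0\<close>, with
  equality for \<open>[p, q]\<close>, so \<open>l(V)\<close> bounds every cost from below and the cycle through \<open>q\<close> and \<open>p\<close>,
  which has two switches, attains it. The lower bound is proved by a storage function, which needs no
  decomposition of the trajectory.
\<close>

section \<open>Absolutely continuous functions\<close>

text \<open>\<open>g s\<close> is the cost rate of holding speed \<open>s\<close> by infinitely fast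
  switching with free switches: the share \<open>- f s False / (f s True - f s False)\<close> of the
  time is then spent accelerating. For convex \<open>g\<close> holding \<open>V\<close> would be
  cheapest; the price \<alpha> of a jump forces real excursions, and the line lies above
  \<open>g\<close> by just the weighted area that pays for one jump.

  The obstacle is that \<open>f\<close> is only continuous. An equilibrium may be approached forever
  or reached in finite time, so \<open>w\<close> may or may not be integrable up to the equilibria
  \<open>A\<close> and \<open>B\<close>, and the end points of \<open>[p, q]\<close> are poor
  parameters. The interval is grown instead by the first moment \<open>m\<close> of \<open>w\<close>
  about \<open>V\<close>, the same on both sides, which makes the mean speed \<open>V\<close>
  automatic. A side that reaches an equilibrium with moment to spare turns the remainder into
  resting time; the line meets \<open>g\<close> there, so resting costs exactly what the line
  charges. An end of \<open>I\<close> that is no equilibrium offers no rest: growth must stop, and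
  the area still missing is the reason for the lift.\<close>

lemma abs_continuous_on_subset:
  assumes "abs_continuous_on S x" and sub: "T \<subseteq> S"
  shows "abs_continuous_on T x"
  unfolding abs_continuous_on_def
proof (intro allI impI)
  fix e :: real assume "e > 0"
  then obtain \<delta> where \<delta>: "\<delta> > 0" "\<forall>D. finite D \<and> (\<forall>(a, b)\<in>D. a \<le> b \<and> {a..b} \<subseteq> S) \<and>
        pairwise (\<lambda>(a, b) (c, d). {a<..<b} \<inter> {c<..<d} = {}) D \<and>
        (\<Sum>(a, b)\<in>D. b - a) < \<delta> \<longrightarrow> (\<Sum>(a, b)\<in>D. \<bar>x b - x a\<bar>) < e"
    using assms(1) unfolding abs_continuous_on_def by meson
  have *: "(\<forall>(a, b)\<in>D. a \<le> b \<and> {a..b} \<subseteq> S)" if "\<forall>(a, b)\<in>D. a \<le> b \<and> {a..b} \<subseteq> T" for D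
    using that sub by blast
  show "\<exists>\<delta>>0. \<forall>D. finite D \<and> (\<forall>(a, b)\<in>D. a \<le> b \<and> {a..b} \<subseteq> T) \<and>
        pairwise (\<lambda>(a, b) (c, d). {a<..<b} \<inter> {c<..<d} = {}) D \<and>
        (\<Sum>(a, b)\<in>D. b - a) < \<delta> \<longrightarrow> (\<Sum>(a, b)\<in>D. \<bar>x b - x a\<bar>) < e"
  proof (intro exI conjI allI impI)
    fix D :: "(real \<times> real) set"
    assume D: "finite D \<and> (\<forall>(a, b)\<in>D. a \<le> b \<and> {a..b} \<subseteq> T) \<and>
        pairwise (\<lambda>(a, b) (c, d). {a<..<b} \<inter> {c<..<d} = {}) D \<and> (\<Sum>(a, b)\<in>D. b - a) < \<delta>"
    show "(\<Sum>(a, b)\<in>D. \<bar>x b - x a\<bar>) < e"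
      by (rule \<delta>(2)[rule_format]) (intro conjI *; use D in simp)
  qed (fact \<delta>(1))
qed

text \<open>The gauge confines the tags in the exceptional null set to an open set of small measure, where
  absolute continuity controls the increments.\<close>

lemma abs_continuous_has_integral:
  fixes x \<phi> :: "real \<Rightarrow> real"
  assumes ab: "a \<le> b" and ac: "abs_continuous_on {a..b} x" and N: "negligible N"
    and der: "\<And>t. t \<in> {a..b} - N \<Longrightarrow> (x has_real_derivative \<phi> t) (at t within {a..b})"
  shows "(\<phi> has_integral x b - x a) {a..b}"
proof -
  \<comment> \<open>On \<open>N\<close> the derivative is replaced by 0, so that a tag in
    \<open>N\<close> contributes only the increment of \<open>x\<close> over its interval.\<close>
  define \<psi> where "\<psi> t = (if t \<in> N then 0 else \<phi> t)" for t
  have "(\<psi> has_integral x b - x a) {a..b}"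
    unfolding has_integral_real
  proof (intro allI impI)
    fix e :: real assume e: "e > 0"
    obtain \<delta> where \<delta>: "\<delta> > 0" and \<delta>1: "\<forall>D. finite D \<and> (\<forall>(l, r)\<in>D. l \<le> r \<and> {l..r} \<subseteq> {a..b}) \<and>
        pairwise (\<lambda>(a, b) (c, d). {a<..<b} \<inter> {c<..<d} = {}) D \<and>
        (\<Sum>(a, b)\<in>D. b - a) < \<delta> \<longrightarrow> (\<Sum>(a, b)\<in>D. \<bar>x b - x a\<bar>) < e/2"
      using ac[unfolded abs_continuous_on_def, rule_format, OF half_gt_zero[OF e]] by (elim exE conjE)
    note \<delta>2 = \<delta>1[rule_format, OF conjI, OF _ conjI, OF _ _ conjI]
    have Ns: "N \<in> sets lebesgue" "emeasure lebesgue N = 0"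
      using N by (auto simp: negligible_iff_null_sets)
    obtain U where U: "open U" "N \<subseteq> U" "U - N \<in> lmeasurable" "emeasure lebesgue (U - N) < ennreal \<delta>"
      using sets_lebesgue_outer_open[OF Ns(1) \<delta>] by blast
    have Um: "U \<in> lmeasurable"
    proof -
      have "U = (U - N) \<union> N" using U(2) by blast
      then show ?thesis using U(3) negligible_imp_measurable[OF N] by (metis fmeasurable.Un)
    qed
    have Uless: "measure lebesgue U < \<delta>"
    proof -
      have "measure lebesgue (U - N) = measure lebesgue U"
        using Um Ns by (simp add: fmeasurableD measure_Diff_null_set null_setsI)
      moreover have "measure lebesgue (U - N) < \<delta>"
        using U(3,4) \<delta> by (simp add: emeasure_eq_measure2 ennreal_less_iff)
      ultimately show ?thesis by simp
    qed
    \<comment> \<open>The linear approximation errors add up to at most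
      \<open>\<eta> * (b - a) \<le> e / 2\<close>; the \<open>+ 1\<close> covers
      \<open>a = b\<close>.\<close>
    define \<eta> where "\<eta> = e / (2 * (b - a + 1))"
    have \<eta>: "\<eta> > 0" using e ab by (simp add: \<eta>_def)
    have "\<exists>d>0. \<forall>y\<in>{a..b}. \<bar>y - t\<bar> < d \<longrightarrow> \<bar>x y - x t - \<phi> t * (y - t)\<bar> \<le> \<eta> * \<bar>y - t\<bar>"
      if "t \<in> {a..b} - N" for t
      using der[OF that] \<eta> unfolding has_field_derivative_def has_derivative_within_alt
      by (simp add: mult.commute)
    then have "\<exists>d. \<forall>t\<in>{a..b} - N. d t > 0 \<and> (\<forall>y\<in>{a..b}. \<bar>y - t\<bar> < d t \<longrightarrow> \<bar>x y - x t - \<phi> t * (y - t)\<bar> \<le> \<eta> * \<bar>y - t\<bar>)"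
      by (intro bchoice) blast
    then obtain d where d: "\<And>t. t \<in> {a..b} - N \<Longrightarrow> d t > 0"
      "\<And>t y. t \<in> {a..b} - N \<Longrightarrow> y \<in> {a..b} \<Longrightarrow> \<bar>y - t\<bar> < d t \<Longrightarrow> \<bar>x y - x t - \<phi> t * (y - t)\<bar> \<le> \<eta> * \<bar>y - t\<bar>"
      by blast
    define \<gamma> where "\<gamma> t = (if t \<in> N then U else if t \<in> {a..b} then ball t (d t) else UNIV)" for t
    have gauge: "gauge \<gamma>" unfolding gauge_def \<gamma>_def using U d(1) by auto
    have main: "norm ((\<Sum>(t,K)\<in>D. measure lborel K *\<^sub>R \<psi> t) - (x b - x a)) < e"
      if D: "D tagged_division_of {a..b}" and fine: "\<gamma> fine D" for D
    proof -
      have K: "\<exists>l r. K = {l..r} \<and> l \<le> t \<and> t \<le> r \<and> a \<le> l \<and> r \<le> b \<and> K \<subseteq> \<gamma> t" if tK: "(t,K) \<in> D" for t K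
      proof -
        obtain l r where "K = {l..r}" using tagged_division_ofD(4)[OF D tK] by auto
        moreover from this have "l \<le> t \<and> t \<le> r" "K \<subseteq> {a..b}" "K \<subseteq> \<gamma> t"
          using tagged_division_ofD(2,3)[OF D tK] fineD[OF fine tK] by auto
        ultimately show ?thesis by auto
      qed
      have Kc: "Inf K \<le> Sup K" "K = {Inf K..Sup K}" "a \<le> Inf K" "Sup K \<le> b" "K \<subseteq> \<gamma> t" if tK: "(t,K) \<in> D" for t K
      proof -
        obtain l r where "K = {l..r}" "l \<le> r" "a \<le> l" "r \<le> b" "K \<subseteq> \<gamma> t" using K[OF tK] by auto
        then show "Inf K \<le> Sup K" "K = {Inf K..Sup K}" "a \<le> Inf K" "Sup K \<le> b" "K \<subseteq> \<gamma> t" by simp_all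
      qed
      have finD: "finite D" using D by auto
      define G where "G = (\<lambda>(t,K). measure lborel K * \<psi> t - (x (Sup K) - x (Inf K)))"
      \<comment> \<open>Degenerate intervals are left out: they contribute nothing, and only
        nonempty interiors make the end-point map \<open>P\<close> injective.\<close>
      define D1 where "D1 = {(t,K)\<in>D. t \<in> N \<and> Inf K < Sup K}"
      have fin1: "finite D1" using finD by (auto simp: D1_def intro: finite_subset)
      have D1D: "D1 \<subseteq> D" by (auto simp: D1_def)
      have "(\<Sum>(t,K)\<in>D. measure lborel K *\<^sub>R \<psi> t) - (x b - x a) = sum G D"
        unfolding G_def additive_tagged_division_1[OF ab D, of x, symmetric]
        by (simp add: case_prod_unfold sum_subtractf)
      also have "\<dots> = sum G (D - D1) + sum G D1" by (rule sum.subset_diff[OF D1D finD])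
      finally have split: "(\<Sum>(t,K)\<in>D. measure lborel K *\<^sub>R \<psi> t) - (x b - x a) = sum G (D - D1) + sum G D1" .
      have "\<bar>sum G (D - D1)\<bar> \<le> (\<Sum>p\<in>D - D1. \<eta> * measure lborel (snd p))"
      proof (rule order_trans[OF sum_abs sum_mono])
        fix p assume p: "p \<in> D - D1"
        obtain t K' where tK: "p = (t, K')" by (cases p)
        with p obtain l r where lr: "K' = {l..r}" "l \<le> t" "t \<le> r" "a \<le> l" "r \<le> b" "K' \<subseteq> \<gamma> t" using K by blast
        show "\<bar>G p\<bar> \<le> \<eta> * measure lborel (snd p)"
        proof (cases "t \<in> N")
          case True
          then have "l = r" using p lr by (auto simp: tK D1_def)
          then show ?thesis by (simp add: G_def tK lr)
        next
          case False
          then have tN: "t \<in> {a..b} - N" using lr by auto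
          have sub: "{l..r} \<subseteq> ball t (d t)" using lr tN False by (simp add: \<gamma>_def)
          have "l \<in> ball t (d t)" "r \<in> ball t (d t)" using sub lr(2,3) by (meson atLeastAtMost_iff order_refl order_trans subsetD)+
          then have "\<bar>l - t\<bar> < d t" "\<bar>r - t\<bar> < d t" by (auto simp: dist_real_def)
          then have "\<bar>x l - x t - \<phi> t * (l - t)\<bar> \<le> \<eta> * \<bar>l - t\<bar>" "\<bar>x r - x t - \<phi> t * (r - t)\<bar> \<le> \<eta> * \<bar>r - t\<bar>"
            using lr by (intro d(2)[OF tN]; simp)+
          moreover have "G p = (x l - x t - \<phi> t * (l - t)) - (x r - x t - \<phi> t * (r - t))"
            using lr False by (simp add: G_def tK \<psi>_def algebra_simps)
          moreover have "\<eta> * \<bar>l - t\<bar> + \<eta> * \<bar>r - t\<bar> = \<eta> * measure lborel (snd p)"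
            using lr by (simp add: tK algebra_simps)
          ultimately show ?thesis by linarith
        qed
      qed
      also have "\<dots> \<le> (\<Sum>p\<in>D. \<eta> * measure lborel (snd p))"
        using finD \<eta> by (intro sum_mono2) auto
      also have "\<dots> = \<eta> * (b - a)"
        using additive_content_tagged_division[of D a b] D ab
        by (simp add: case_prod_unfold flip: sum_distrib_left)
      also have "\<dots> \<le> e / 2"
        using ab e by (simp add: \<eta>_def field_simps)
      finally have s1: "\<bar>sum G (D - D1)\<bar> \<le> e / 2" .
      define P where "P = (\<lambda>(t::real,K::real set). (Inf K, Sup K))"
      have disj: "{Inf K<..<Sup K} \<inter> {Inf K'<..<Sup K'} = {}" if "(t,K) \<in> D1" "(t',K') \<in> D1" "(t,K) \<noteq> (t',K')" for t K t' K'
      proof -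
        have "(t,K) \<in> D" "(t',K') \<in> D" using that by (auto simp: D1_def)
        then have "interior K \<inter> interior K' = {}" and eq: "K = {Inf K..Sup K}" "K' = {Inf K'..Sup K'}"
          using tagged_division_ofD(5)[OF D _ _ that(3)] Kc(2) by blast+
        moreover have "interior K = {Inf K<..<Sup K}" "interior K' = {Inf K'<..<Sup K'}"
          by (subst eq, rule interior_atLeastAtMost_real)+
        ultimately show ?thesis by simp
      qed
      have inj: "inj_on P D1"
      proof (rule inj_onI)
        fix p p' assume p: "p \<in> D1" "p' \<in> D1" "P p = P p'"
        obtain t K t' K' where q: "p = (t,K)" "p' = (t',K')" by (cases p, cases p')
        show "p = p'"
        proof (rule ccontr)
          assume "p \<noteq> p'"
          then have "{Inf K<..<Sup K} = {}" using disj[of t K t' K'] p q by (auto simp: P_def)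
          then show False using p(1) by (auto simp: q D1_def)
        qed
      qed
      have "(\<Sum>(l, r)\<in>P ` D1. \<bar>x r - x l\<bar>) < e/2"
      proof (rule \<delta>2)
        show "finite (P ` D1)" using fin1 by simp
        show "\<forall>(l, r)\<in>P ` D1. l \<le> r \<and> {l..r} \<subseteq> {a..b}"
        proof clarify
          fix l r t K' assume "(l,r) = P (t,K')" "(t,K') \<in> D1"
          then show "l \<le> r \<and> {l..r} \<subseteq> {a..b}" using Kc[of t K'] D1D by (auto simp: P_def)
        qed
        show "pairwise (\<lambda>(a, b) (c, d). {a<..<b} \<inter> {c<..<d} = {}) (P ` D1)"
        proof (rule pairwiseI)
          fix q q' assume "q \<in> P ` D1" "q' \<in> P ` D1" "q \<noteq> q'"
          then obtain t K t' K' where "(t,K) \<in> D1" "(t',K') \<in> D1" "q = P (t,K)" "q' = P (t',K')" by auto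
          then show "(\<lambda>(a, b) (c, d). {a<..<b} \<inter> {c<..<d} = {}) q q'"
            using disj[of t K t' K'] \<open>q \<noteq> q'\<close> by (auto simp: P_def)
        qed
        have "(\<Sum>(l, r)\<in>P ` D1. r - l) = (\<Sum>(t,K)\<in>D1. Sup K - Inf K)"
          by (subst sum.reindex[OF inj]) (simp add: P_def case_prod_unfold)
        also have "\<dots> = (\<Sum>(t,K)\<in>D1. measure lebesgue K)"
        proof (rule sum.cong[OF refl], clarify)
          fix t K' assume "(t,K') \<in> D1"
          then have "(t,K') \<in> D" using D1D by blast
          note * = Kc(1,2)[OF this]
          have "measure lebesgue {Inf K'..Sup K'} = Sup K' - Inf K'" using *(1) by simp
          then show "Sup K' - Inf K' = measure lebesgue K'" using *(2) by simp
        qed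
        also have "\<dots> = (\<Sum>K\<in>snd ` D1. measure lebesgue K)"
          by (subst sum.reindex) (use inj in \<open>auto simp: inj_on_def P_def case_prod_unfold\<close>)
        also have "\<dots> = measure lebesgue (\<Union> (snd ` D1))"
        proof (rule content_division)
          show "snd ` D1 division_of \<Union> (snd ` D1)"
          proof (rule division_of_subset)
            show "snd ` D division_of \<Union> (snd ` D)"
              using division_of_tagged_division[OF D] by (simp only: division_ofD(6)[OF division_of_tagged_division[OF D]])
          qed (use D1D in auto)
        qed
        also have "\<dots> \<le> measure lebesgue U"
        proof (rule measure_mono_fmeasurable[OF _ _ Um])
          show "\<Union> (snd ` D1) \<subseteq> U"
          proof clarify
            fix z t K' assume z: "z \<in> snd (t,K')" "(t,K') \<in> D1"
            then have "(t,K') \<in> D" "t \<in> N" by (auto simp: D1_def)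
            then show "z \<in> U" using Kc(5)[of t K'] z(1) by (auto simp: \<gamma>_def)
          qed
          show "\<Union> (snd ` D1) \<in> sets lebesgue"
          proof (intro sets.finite_Union)
            show "snd ` D1 \<subseteq> sets lebesgue"
            proof clarify
              fix t K' assume "(t,K') \<in> D1"
              then have "(t,K') \<in> D" using D1D by blast
              moreover have "{Inf K'..Sup K'} \<in> sets lebesgue" by simp
              ultimately show "snd (t,K') \<in> sets lebesgue" using Kc(2)[of t K'] by simp
            qed
          qed (use fin1 in simp)
        qed
        finally show "(\<Sum>(l, r)\<in>P ` D1. r - l) < \<delta>" using Uless by simp
      qed
      then have "(\<Sum>(t,K)\<in>D1. \<bar>x (Sup K) - x (Inf K)\<bar>) < e/2"
        by (subst (asm) sum.reindex[OF inj]) (simp add: P_def case_prod_unfold)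
      moreover have "\<bar>sum G D1\<bar> \<le> (\<Sum>(t,K)\<in>D1. \<bar>x (Sup K) - x (Inf K)\<bar>)"
        by (rule order_trans[OF sum_abs sum_mono]) (auto simp: G_def D1_def \<psi>_def)
      ultimately show ?thesis using s1 split by simp
    qed
    show "\<exists>\<gamma>. gauge \<gamma> \<and> (\<forall>D. D tagged_division_of {a..b} \<and> \<gamma> fine D \<longrightarrow>
        norm ((\<Sum>(t,K)\<in>D. measure lborel K *\<^sub>R \<psi> t) - (x b - x a)) < e)"
      by (intro exI[of _ \<gamma>] conjI allI impI gauge main) simp_all
  qed
  then show ?thesis by (rule has_integral_spike[OF N, rotated]) (auto simp: \<psi>_def)
qed

section \<open>Solutions of the controlled equation\<close>

lemma integrable_dominated:
  fixes \<phi> w :: "real \<Rightarrow> real"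
  assumes "continuous_on {p<..<q} \<phi>" "w integrable_on {p..q}" "\<And>s. s \<in> {p<..<q} \<Longrightarrow> \<bar>\<phi> s\<bar> \<le> w s"
  shows "\<phi> integrable_on {p..q}"
proof -
  have "\<phi> integrable_on {p<..<q}"
  proof (rule measurable_bounded_by_integrable_imp_integrable)
    show "\<phi> \<in> borel_measurable (lebesgue_on {p<..<q})"
      using assms(1) by (intro continuous_imp_measurable_on_sets_lebesgue) auto
  qed (use assms in \<open>auto simp: integrable_on_open_interval_real\<close>)
  then show ?thesis by (simp add: integrable_on_open_interval_real)
qed

text \<open>Inside the interval \<open>g\<close> keeps its sign, so integrability of
  \<open>1 / g\<close> is automatically absolute, and a multiple of its modulus dominates
  \<open>\<rho> / g\<close>. The end points, where \<open>g\<close> may vanish, are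
  negligible.\<close>

lemma integrable_reciprocal_times:
  fixes g \<rho> :: "real \<Rightarrow> real"
  assumes g: "continuous_on {p..q} g" "\<And>s. s \<in> {p<..<q} \<Longrightarrow> g s \<noteq> 0"
    and int: "(\<lambda>s. 1 / g s) integrable_on {p..q}" and \<rho>: "continuous_on {p..q} \<rho>"
  shows "(\<lambda>s. \<rho> s / g s) integrable_on {p..q}"
proof -
  have sgn: "(\<forall>s\<in>{p<..<q}. g s > 0) \<or> (\<forall>s\<in>{p<..<q}. g s < 0)"
  proof (rule ccontr)
    assume "\<not> ?thesis"
    then obtain s1 s2 where s: "s1 \<in> {p<..<q}" "s2 \<in> {p<..<q}" "g s1 < 0" "g s2 > 0"
      using g(2) by (metis linorder_neqE_linordered_idom)
    have "connected (g ` {p<..<q})"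
      using g(1) by (intro connected_continuous_image) (auto intro: continuous_on_subset)
    then have "0 \<in> g ` {p<..<q}"
      using s by (meson connected_contains_Icc atLeastAtMost_iff imageI less_imp_le subsetD)
    then show False using g(2) by force
  qed
  have abs_int: "(\<lambda>s. \<bar>1 / g s\<bar>) integrable_on {p..q}"
    using sgn
  proof
    assume pos: "\<forall>s\<in>{p<..<q}. g s > 0"
    show ?thesis by (rule integrable_spike_finite[OF _ _ int, of "{p,q}"]) (use pos in \<open>auto simp: less_le\<close>)
  next
    assume neg: "\<forall>s\<in>{p<..<q}. g s < 0"
    show ?thesis by (rule integrable_spike_finite[OF _ _ integrable_neg[OF int], of "{p,q}"]) (use neg in \<open>auto simp: less_le abs_if\<close>)
  qed
  obtain C where C: "\<And>s. s \<in> {p..q} \<Longrightarrow> \<bar>\<rho> s\<bar> \<le> C"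
    using compact_imp_bounded[OF compact_continuous_image[OF \<rho> compact_Icc]] unfolding bounded_real by force
  show ?thesis
  proof (rule integrable_dominated)
    show "(\<lambda>s. C * \<bar>1 / g s\<bar>) integrable_on {p..q}" using integrable_on_mult_right[OF abs_int] .
    show "continuous_on {p<..<q} (\<lambda>s. \<rho> s / g s)"
      using g \<rho> by (intro continuous_on_divide) (auto intro: continuous_on_subset)
    show "\<bar>\<rho> s / g s\<bar> \<le> C * \<bar>1 / g s\<bar>" if "s \<in> {p<..<q}" for s
      using C[of s] that by (simp add: abs_divide divide_right_mono)
  qed
qed

section \<open>Phases of constant control\<close>

definition flow_on :: "(real \<Rightarrow> bool \<Rightarrow> real) \<Rightarrow> bool \<Rightarrow> (real \<Rightarrow> real) \<Rightarrow> real \<Rightarrow> real \<Rightarrow> bool" where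
  "flow_on f c x s t \<longleftrightarrow> (\<forall>r\<in>{s..t}. (x has_real_derivative f (x r) c) (at r within {s..t}))"

lemma flow_on_subset: "flow_on f c x s t \<Longrightarrow> s \<le> s' \<Longrightarrow> t' \<le> t \<Longrightarrow> flow_on f c x s' t'"
  unfolding flow_on_def
  by (meson DERIV_subset atLeastAtMost_iff atLeastatMost_subset_iff order_trans)

lemma flow_on_continuous: "flow_on f c x s t \<Longrightarrow> continuous_on {s..t} x"
  unfolding flow_on_def by (meson DERIV_continuous_on)

lemma flow_on_cong:
  "flow_on f c x s t \<Longrightarrow> (\<And>r. r \<in> {s..t} \<Longrightarrow> x r = y r) \<Longrightarrow> flow_on f c y s t"
  unfolding flow_on_def has_field_derivative_def
  by (metis has_derivative_transform)

locale controlled_speed =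
  fixes f :: "real \<Rightarrow> bool \<Rightarrow> real"
  assumes cont: "\<And>c. continuous_on UNIV (\<lambda>x. f x c)"
    and well_posed: "forward_well_posed f"
begin

lemma continuous_on_speed:
  assumes "continuous_on S x"
  shows "continuous_on S (\<lambda>r. f (x r) c)"
  using continuous_on_compose2[OF cont assms] by auto

text \<open>The speeds stay in a compact set, on which both right-hand sides are bounded;
  \<open>x\<close> is then Lipschitz and hence absolutely continuous, whatever values
  \<open>u\<close> takes.\<close>

lemma solutionI:
  assumes T: "0 \<le> T" and S: "finite S" and x: "continuous_on {0..T} x"
    and der: "\<And>r. r \<in> {0..T} - S \<Longrightarrow> (x has_real_derivative f (x r) (u r)) (at r within {0..T})"
  shows "solution f T x u"
proof -
  have "\<exists>B. \<forall>r\<in>{0..T}. \<bar>f (x r) c\<bar> \<le> B" for c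
    using compact_imp_bounded[OF compact_continuous_image[OF continuous_on_speed[OF x] compact_Icc]]
    unfolding bounded_real by fastforce
  then obtain B0 where B0: "\<And>c r. r \<in> {0..T} \<Longrightarrow> \<bar>f (x r) c\<bar> \<le> B0 c" by metis
  define B where "B = max (B0 True) (B0 False)"
  have B: "\<bar>f (x r) c\<bar> \<le> B" if "r \<in> {0..T}" for r c
    using B0[OF that, of c] by (cases c) (auto simp: B_def)
  have B_nonneg: "B \<ge> 0" using B[of 0] T by (meson abs_ge_zero atLeastAtMost_iff order_refl order_trans)
  have lip: "\<bar>x t - x s\<bar> \<le> B * (t - s)" if "0 \<le> s" "s \<le> t" "t \<le> T" for s t
  proof -
    have "((\<lambda>r. f (x r) (u r)) has_integral x t - x s) {s..t}"
    proof (rule fundamental_theorem_of_calculus_interior_strong[OF S \<open>s \<le> t\<close>])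
      show "continuous_on {s..t} x" using x that by (auto intro: continuous_on_subset)
      show "(x has_vector_derivative f (x r) (u r)) (at r)" if "r \<in> {s<..<t} - S" for r
        using der[of r] that \<open>0 \<le> s\<close> \<open>t \<le> T\<close> at_within_Icc_at[of 0 r T]
        by (auto simp: has_real_derivative_iff_has_vector_derivative)
    qed
    from has_integral_bound_real[OF B_nonneg finite.emptyI this] show ?thesis using B that by auto
  qed
  have "abs_continuous_on {0..T} x"
    unfolding abs_continuous_on_def
  proof (intro allI impI)
    fix e :: real assume e: "e > 0"
    show "\<exists>\<delta>>0. \<forall>D. finite D \<and> (\<forall>(a, b)\<in>D. a \<le> b \<and> {a..b} \<subseteq> {0..T}) \<and>
        pairwise (\<lambda>(a, b) (c, d). {a<..<b} \<inter> {c<..<d} = {}) D \<and>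
        (\<Sum>(a, b)\<in>D. b - a) < \<delta> \<longrightarrow> (\<Sum>(a, b)\<in>D. \<bar>x b - x a\<bar>) < e"
    proof (intro exI conjI allI impI)
      show "e / (B + 1) > 0" using e B_nonneg by simp
      fix D :: "(real \<times> real) set"
      assume D: "finite D \<and> (\<forall>(a, b)\<in>D. a \<le> b \<and> {a..b} \<subseteq> {0..T}) \<and>
        pairwise (\<lambda>(a, b) (c, d). {a<..<b} \<inter> {c<..<d} = {}) D \<and> (\<Sum>(a, b)\<in>D. b - a) < e / (B + 1)"
      have "(\<Sum>(a, b)\<in>D. \<bar>x b - x a\<bar>) \<le> (\<Sum>(a, b)\<in>D. B * (b - a))"
      proof (rule sum_mono, clarify)
        fix l r assume "(l, r) \<in> D"
        then have "l \<le> r" "{l..r} \<subseteq> {0..T}" using D by blast+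
        then show "\<bar>x r - x l\<bar> \<le> B * (r - l)" by (intro lip) auto
      qed
      also have "\<dots> = B * (\<Sum>(a, b)\<in>D. b - a)" by (simp add: sum_distrib_left case_prod_unfold)
      also have "\<dots> \<le> B * (e / (B + 1))" using D B_nonneg by (intro mult_left_mono) auto
      also have "\<dots> < e" using e B_nonneg by (simp add: field_simps)
      finally show "(\<Sum>(a, b)\<in>D. \<bar>x b - x a\<bar>) < e" .
    qed
  qed
  moreover have "AE t in lborel. t \<in> {0..T} \<longrightarrow> (x has_real_derivative f (x t) (u t)) (at t within {0..T})"
  proof -
    have "AE t in lborel. t \<notin> S" using S by (intro AE_not_in finite_imp_null_set_lborel)
    then show ?thesis using der by (auto elim!: eventually_mono)
  qed
  ultimately show ?thesis by (simp add: solution_def)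
qed

lemma solution_has_integral:
  assumes sol: "solution f T x u" and st: "0 \<le> s" "s \<le> t" "t \<le> T"
  shows "((\<lambda>r. f (x r) (u r)) has_integral x t - x s) {s..t}"
proof -
  obtain N where N: "N \<in> null_sets lborel" "{t. \<not> (t \<in> {0..T} \<longrightarrow>
        (x has_real_derivative f (x t) (u t)) (at t within {0..T}))} \<subseteq> N"
    using sol unfolding solution_def by (auto elim!: AE_E simp: null_sets_def)
  have "negligible N" using N(1) by (simp add: negligible_iff_null_sets null_sets_completionI)
  moreover have sub: "{s..t} \<subseteq> {0..T}" using st by auto
  ultimately show ?thesis
  proof (rule_tac abs_continuous_has_integral[OF st(2)])
    show "abs_continuous_on {s..t} x"
      using sol sub unfolding solution_def by (blast intro: abs_continuous_on_subset)
    show "(x has_real_derivative f (x r) (u r)) (at r within {s..t})" if "r \<in> {s..t} - N" for r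
      by (rule DERIV_subset[OF _ sub]) (use N(2) that sub in blast)
  qed
qed

lemma solution_continuous:
  assumes sol: "solution f T x u"
  shows "continuous_on {0..T} x"
proof (cases "0 \<le> T")
  case True
  have "continuous_on {0..T} (\<lambda>t. x 0 + integral {0..t} (\<lambda>r. f (x r) (u r)))"
    using solution_has_integral[OF sol, of 0 T] True
    by (intro continuous_intros indefinite_integral_continuous_1) (auto simp: has_integral_iff)
  moreover have "x 0 + integral {0..t} (\<lambda>r. f (x r) (u r)) = x t" if "t \<in> {0..T}" for t
    using solution_has_integral[OF sol, of 0 t] that by (auto simp: has_integral_iff)
  ultimately show ?thesis by (subst continuous_on_cong[OF refl]) auto
qed auto

text \<open>An almost-everywhere solution is an integral of the continuous function
  \<open>f (x r) c\<close>, which makes it differentiable everywhere. The values of \<open>u\<close>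
  at \<open>s\<close> and \<open>t\<close> do not enter, so a phase may include its switching
  times.\<close>

lemma solution_flow_on:
  assumes sol: "solution f T x u" and st: "0 \<le> s" "t \<le> T"
    and u: "\<And>r. r \<in> {s<..<t} \<Longrightarrow> u r = c"
  shows "flow_on f c x s t"
proof -
  have cx: "continuous_on {s..t} (\<lambda>r. f (x r) c)"
    using solution_continuous[OF sol] st by (intro continuous_on_speed) (auto intro: continuous_on_subset)
  have eq: "x s + integral {s..r} (\<lambda>r. f (x r) c) = x r" if r: "r \<in> {s..t}" for r
  proof -
    have "((\<lambda>r. f (x r) c) has_integral x r - x s) {s..r}"
      by (rule has_integral_spike_finite[OF _ _ solution_has_integral[OF sol, of s r], of "{s, t}"])
        (use r st u in auto)
    then show ?thesis by (simp add: has_integral_iff)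
  qed
  show ?thesis unfolding flow_on_def
  proof
    fix r assume r: "r \<in> {s..t}"
    have "((\<lambda>r. x s + integral {s..r} (\<lambda>r. f (x r) c)) has_real_derivative f (x r) c) (at r within {s..t})"
      using integral_has_real_derivative[OF cx r] by (auto intro!: derivative_eq_intros)
    then show "(x has_real_derivative f (x r) c) (at r within {s..t})"
      unfolding has_field_derivative_def by (rule has_derivative_transform[rotated 2]) (use eq r in auto)
  qed
qed

lemma flow_on_shift:
  assumes "flow_on f c x s t"
  shows "flow_on f c (\<lambda>r. x (d + r)) (s - d) (t - d)"
  unfolding flow_on_def
proof
  fix r assume r: "r \<in> {s - d..t - d}"
  have "(x has_real_derivative f (x (d + r)) c) (at (d + r) within (+) d ` {s - d..t - d})"
    using assms r unfolding flow_on_def by auto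
  then show "((\<lambda>r. x (d + r)) has_real_derivative f (x (d + r)) c) (at r within {s - d..t - d})"
    using DERIV_at_within_shift by blast
qed

text \<open>Uniqueness is assumed from time 0 only, whence the shift. It runs forward: agreement at
  a later time says nothing about the past.\<close>

lemma flow_on_unique:
  assumes x: "flow_on f c x s t" and y: "flow_on f c y s t" and eq: "x s = y s" and r: "r \<in> {s..t}"
  shows "x r = y r"
proof (cases "s = t")
  case False
  have sol: "solution f (t - s) (\<lambda>r. z (s + r)) (\<lambda>_. c)" if "flow_on f c z s t" for z
    using flow_on_shift[OF that, of s] flow_on_continuous[OF flow_on_shift[OF that, of s]] r
    by (intro solutionI[of _ "{}"]) (auto simp: flow_on_def)
  have "t - s > 0" using False r by auto
  have uniq: "\<forall>T>0. \<forall>z z'. solution f T z (\<lambda>_. c) \<and> z 0 = x s \<and> solution f T z' (\<lambda>_. c) \<and> z' 0 = x s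
        \<longrightarrow> (\<forall>r\<in>{0..T}. z r = z' r)"
    by (rule conjunct2, rule well_posed[unfolded forward_well_posed_def, THEN spec, THEN spec])
  have "x (s + r) = y (s + r)" if "r \<in> {0..t - s}" for r
    by (rule uniq[rule_format, of "t - s" "\<lambda>r. x (s + r)" "\<lambda>r. y (s + r)" r])
      (use \<open>t - s > 0\<close> sol[OF x] sol[OF y] eq that in auto)
  from this[of "r - s"] show ?thesis using r by simp
qed (use eq r in auto)

lemma flow_on_exists:
  obtains x where "x s = y0" "\<And>t. s < t \<Longrightarrow> flow_on f c x s t"
proof -
  obtain z where z: "z 0 = y0" "\<And>T. T > 0 \<Longrightarrow> solution f T z (\<lambda>_. c)"
    using well_posed unfolding forward_well_posed_def by blast
  have "flow_on f c (\<lambda>r. z (-s + r)) s t" if "s < t" for t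
    using flow_on_shift[of c z 0 "t - s" "-s"] solution_flow_on[OF z(2), of "t - s" 0 "t - s" c] that
    by simp
  with z(1) show thesis by (intro that[of "\<lambda>r. z (-s + r)"]) auto
qed

lemma flow_on_equilibrium:
  assumes "flow_on f c x s t" "f (x s) c = 0" "r \<in> {s..t}"
  shows "x r = x s"
  using flow_on_unique[OF assms(1), of "\<lambda>_. x s" r] assms by (auto simp: flow_on_def)

text \<open>By Rolle, a repeated speed would give a zero of \<open>f\<close> strictly in between.
  The final time is exempt because an equilibrium may be reached in finite time.\<close>

lemma flow_on_inj:
  assumes x: "flow_on f c x s t" and nz: "\<And>r. r \<in> {s..<t} \<Longrightarrow> f (x r) c \<noteq> 0"
  shows "inj_on x {s..t}"
proof -
  have False if r: "r1 \<in> {s..t}" "r2 \<in> {s..t}" "r1 < r2" "x r1 = x r2" for r1 r2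
  proof -
    have fl: "flow_on f c x r1 r2" using x r by (auto intro: flow_on_subset)
    have "\<exists>z>r1. z < r2 \<and> (x has_real_derivative 0) (at z)"
    proof (rule Rolle[OF r(3,4) flow_on_continuous[OF fl]])
      fix z assume "r1 < z" "z < r2"
      then show "x differentiable (at z)"
        using fl at_within_Icc_at[of r1 z r2] unfolding flow_on_def real_differentiable_def
        by (metis atLeastAtMost_iff less_imp_le)
    qed
    then obtain z where z: "r1 < z" "z < r2" "(x has_real_derivative 0) (at z)" by blast
    then have "(x has_real_derivative f (x z) c) (at z)"
      using fl at_within_Icc_at[of r1 z r2] unfolding flow_on_def by (metis atLeastAtMost_iff less_imp_le)
    then have "f (x z) c = 0" using z(3) DERIV_unique by blast
    then show False using nz[of z] r z by auto
  qed
  then show ?thesis by (metis inj_onI linorder_neqE_linordered_idom)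
qed

text \<open>The primitive of \<open>k\<close> is known to be differentiable only where
  \<open>k\<close> is continuous. The exceptional speeds are finitely many and, by injectivity, are
  met only finitely often, so the chain rule holds off a finite set of times.\<close>

lemma flow_on_substitution:
  assumes x: "flow_on f c x s t" and st: "s \<le> t" and nz: "\<And>r. r \<in> {s..<t} \<Longrightarrow> f (x r) c \<noteq> 0"
    and im: "x ` {s..t} \<subseteq> {lo..hi}" and k: "k integrable_on {lo..hi}"
    and X: "finite X" "continuous_on ({lo..hi} - X) k"
  shows "((\<lambda>r. k (x r) * f (x r) c) has_integral
      (integral {lo..x t} k - integral {lo..x s} k)) {s..t}"
proof -
  define S where "S = {r\<in>{s..t}. x r \<in> insert lo (insert hi X)}"
  have "finite S"
    unfolding S_def using finite_vimage_IntI[OF _ flow_on_inj[OF x nz], of "insert lo (insert hi X)"] X(1)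
    by (auto simp: vimage_def Int_def conj_commute)
  then show ?thesis
  proof (rule fundamental_theorem_of_calculus_interior_strong[OF _ st])
    show "continuous_on {s..t} (\<lambda>r. integral {lo..x r} k)"
      using continuous_on_compose2[OF indefinite_integral_continuous_1[OF k] flow_on_continuous[OF x] im] .
    fix r assume r: "r \<in> {s<..<t} - S"
    moreover have "x r \<in> {lo..hi}" using im r unfolding image_subset_iff by simp
    ultimately have xr: "x r \<in> {lo<..<hi} - X" by (auto simp: S_def less_le)
    have op: "open ({lo<..<hi} - X)" using X(1) by (simp add: finite_imp_closed open_Diff)
    have "continuous_on ({lo<..<hi} - X) k" using X(2) by (rule continuous_on_subset) auto
    then have "isCont k (x r)" using op xr by (simp add: continuous_on_eq_continuous_at)
    then have "((\<lambda>y. integral {lo..y} k) has_vector_derivative k (x r)) (at (x r) within {lo..hi} - {})"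
      using k xr by (intro integral_has_vector_derivative_continuous_at) (auto intro: continuous_at_imp_continuous_at_within)
    then have 1: "((\<lambda>y. integral {lo..y} k) has_real_derivative k (x r)) (at (x r))"
      using xr at_within_Icc_at[of lo "x r" hi] by (simp add: has_real_derivative_iff_has_vector_derivative)
    have 2: "(x has_real_derivative f (x r) c) (at r)"
      using x r at_within_Icc_at[of s r t] unfolding flow_on_def by (metis Diff_iff atLeastAtMost_iff greaterThanLessThan_iff less_imp_le)
    show "((\<lambda>r. integral {lo..x r} k) has_vector_derivative k (x r) * f (x r) c) (at r)"
      using DERIV_chain2[OF 1 2] by (simp add: has_real_derivative_iff_has_vector_derivative)
  qed
qed

text \<open>A phase is a moving part followed by a rest: the zeros of the right-hand side form a
  closed set of times, and from the first of them on forward uniqueness freezes the speed.\<close>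

lemma flow_on_split:
  assumes x: "flow_on f c x s t" and st: "s \<le> t"
  obtains \<tau> where "\<tau> \<in> {s..t}" "\<And>r. r \<in> {s..<\<tau>} \<Longrightarrow> f (x r) c \<noteq> 0"
    "\<And>r. r \<in> {\<tau>..t} \<Longrightarrow> x r = x \<tau>" "\<tau> = t \<or> f (x \<tau>) c = 0"
proof (cases "\<exists>r\<in>{s..t}. f (x r) c = 0")
  case False
  then show ?thesis using st by (intro that[of t]) auto
next
  case True
  define Z where "Z = {r\<in>{s..t}. f (x r) c = 0}"
  have "closed Z"
    unfolding Z_def using continuous_on_speed[OF flow_on_continuous[OF x]]
    by (intro continuous_closed_preimage_constant) auto
  moreover have "Z \<noteq> {}" "bdd_below Z" using True by (auto simp: Z_def intro: bdd_belowI[of _ s])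
  ultimately have inf: "Inf Z \<in> Z" "\<And>r. r \<in> Z \<Longrightarrow> Inf Z \<le> r"
    by (auto intro: closed_contains_Inf cInf_lower)
  show ?thesis
  proof (rule that[of "Inf Z"])
    show "f (x r) c \<noteq> 0" if "r \<in> {s..<Inf Z}" for r
      using inf(1) inf(2)[of r] that by (force simp: Z_def)
    show "x r = x (Inf Z)" if "r \<in> {Inf Z..t}" for r
      using flow_on_equilibrium[of c x "Inf Z" t r] flow_on_subset[OF x, of "Inf Z" t] inf(1) that
      by (auto simp: Z_def)
  qed (use inf in \<open>auto simp: Z_def\<close>)
qed

text \<open>While the speed moves, substitution turns the pointwise bound into an integrated one.
  While it rests, the left-hand side gains nothing and \<open>rest\<close> keeps the right-hand side
  from falling.\<close>

lemma flow_on_dissipation: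
  assumes x: "flow_on f c x s t" and st: "s \<le> t"
    and im: "x ` {s..t} \<subseteq> {lo..hi}" and k: "k integrable_on {lo..hi}"
    and X: "finite X" "continuous_on ({lo..hi} - X) k"
    and \<rho>: "continuous_on {lo..hi} \<rho>"
    and le: "\<And>y. y \<in> {lo..hi} - X \<Longrightarrow> k y * f y c \<le> \<rho> y"
    and rest: "\<And>y. y \<in> {lo..hi} \<Longrightarrow> f y c = 0 \<Longrightarrow> 0 \<le> \<rho> y"
  shows "integral {lo..x t} k - integral {lo..x s} k \<le> integral {s..t} (\<lambda>r. \<rho> (x r))"
proof -
  obtain \<tau> where \<tau>: "\<tau> \<in> {s..t}" "\<And>r. r \<in> {s..<\<tau>} \<Longrightarrow> f (x r) c \<noteq> 0"
    "\<And>r. r \<in> {\<tau>..t} \<Longrightarrow> x r = x \<tau>" "\<tau> = t \<or> f (x \<tau>) c = 0"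
    using flow_on_split[OF x st] by blast
  have c\<rho>: "continuous_on {s..t} (\<lambda>r. \<rho> (x r))"
    using continuous_on_compose2[OF \<rho> flow_on_continuous[OF x] im] .
  then have i\<rho>: "(\<lambda>r. \<rho> (x r)) integrable_on {s..t}" by (rule integrable_continuous_real)
  have x\<tau>: "flow_on f c x s \<tau>" using flow_on_subset[OF x] \<tau>(1) by auto
  have im\<tau>: "x ` {s..\<tau>} \<subseteq> {lo..hi}" using im \<tau>(1) by force
  define S where "S = {r\<in>{s..\<tau>}. x r \<in> X}"
  have S: "finite S"
    unfolding S_def using finite_vimage_IntI[OF X(1) flow_on_inj[OF x\<tau> \<tau>(2)]]
    by (auto simp: vimage_def Int_def conj_commute)
  define \<kappa> where "\<kappa> r = (if r \<in> S then \<rho> (x r) else k (x r) * f (x r) c)" for r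
  have "(\<kappa> has_integral (integral {lo..x \<tau>} k - integral {lo..x s} k)) {s..\<tau>}"
    by (rule has_integral_spike_finite[OF S _ flow_on_substitution[OF x\<tau> _ \<tau>(2) im\<tau> k X]])
      (use \<tau>(1) in \<open>auto simp: \<kappa>_def\<close>)
  moreover have "((\<lambda>r. \<rho> (x r)) has_integral integral {s..\<tau>} (\<lambda>r. \<rho> (x r))) {s..\<tau>}"
    using integrable_subinterval_real[OF i\<rho>] \<tau>(1) by (intro integrable_integral) auto
  ultimately have "integral {lo..x \<tau>} k - integral {lo..x s} k \<le> integral {s..\<tau>} (\<lambda>r. \<rho> (x r))"
  proof (rule has_integral_le)
    fix r assume r: "r \<in> {s..\<tau>}"
    then have "x r \<in> {lo..hi}" using im\<tau> unfolding image_subset_iff by simp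
    then show "\<kappa> r \<le> \<rho> (x r)" using le[of "x r"] r by (auto simp: \<kappa>_def S_def)
  qed
  moreover have "0 \<le> integral {\<tau>..t} (\<lambda>r. \<rho> (x r))"
  proof -
    have "integral {\<tau>..t} (\<lambda>r. \<rho> (x r)) = integral {\<tau>..t} (\<lambda>r. \<rho> (x \<tau>))"
      by (rule integral_cong) (rule arg_cong[where f=\<rho>], rule \<tau>(3))
    moreover have "x \<tau> \<in> {lo..hi}" using im \<tau>(1) unfolding image_subset_iff by simp
    ultimately show ?thesis using \<tau>(1,4) rest[of "x \<tau>"] by (cases "\<tau> = t") auto
  qed
  moreover have "integral {s..\<tau>} (\<lambda>r. \<rho> (x r)) + integral {\<tau>..t} (\<lambda>r. \<rho> (x r)) = integral {s..t} (\<lambda>r. \<rho> (x r))"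
    using \<tau>(1) by (intro Henstock_Kurzweil_Integration.integral_combine[OF _ _ i\<rho>]) auto
  moreover have "x t = x \<tau>" using \<tau>(1) \<tau>(3)[of t] by simp
  ultimately show ?thesis by simp
qed


end

section \<open>Reaching a prescribed speed in finite time\<close>

context controlled_speed begin

text \<open>The travel time from \<open>y0\<close> to \<open>z\<close> is the integral of
  \<open>1 / f\<close> up to sign; its convergence forces arrival, even at an equilibrium, where the
  extra time \<open>\<tau>\<close> is then spent. The formula is for arbitrary \<open>\<rho>\<close>
  so that it serves mean speed and cost alike.\<close>

lemma leg_exists:
  assumes dir: "(y0 < z \<and> (\<forall>y<z. 0 < f y c)) \<or> (z < y0 \<and> (\<forall>y>z. f y c < 0))"
    and K: "lo = min y0 z" "hi = max y0 z"
    and int: "(\<lambda>y. 1 / f y c) integrable_on {lo..hi}"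
    and \<tau>: "0 \<le> \<tau>" "\<tau> > 0 \<Longrightarrow> f z c = 0"
  obtains x t where "s < t" "flow_on f c x s t" "x s = y0" "x t = z" "x ` {s..t} \<subseteq> {lo..hi}"
    "\<And>\<rho> :: real \<Rightarrow> real. continuous_on {lo..hi} \<rho> \<Longrightarrow> ((\<lambda>r. \<rho> (x r)) has_integral
        ((if y0 < z then integral {lo..hi} (\<lambda>y. \<rho> y / f y c) else - integral {lo..hi} (\<lambda>y. \<rho> y / f y c)) + \<tau> * \<rho> z)) {s..t}"
proof -
  obtain x where x: "x s = y0" "\<And>t. s < t \<Longrightarrow> flow_on f c x s t" using flow_on_exists by metis
  have cx: "continuous_on {s..t} x" if "s < t" for t using flow_on_continuous[OF x(2)[OF that]] .
  have nz: "f y c \<noteq> 0" if "y \<in> {lo..hi}" "y \<noteq> z" for y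
    using dir
  proof
    assume up: "y0 < z \<and> (\<forall>y<z. 0 < f y c)"
    then have "y < z" using that by (simp add: K)
    then show ?thesis using up by fastforce
  next
    assume down: "z < y0 \<and> (\<forall>y>z. f y c < 0)"
    then have "y > z" using that by (simp add: K)
    then show ?thesis using down by fastforce
  qed
  \<comment> \<open>Before \<open>z\<close> is hit the speed cannot cross it, by the intermediate
    value theorem; the sign of \<open>f\<close> then makes the motion monotone, so it does not fall
    back behind \<open>y0\<close> either.\<close>
  have stay: "x ` {s..t} \<subseteq> {lo..hi}" if t: "s < t" and away: "\<And>r. r \<in> {s..<t} \<Longrightarrow> x r \<noteq> z" for t
    using dir
  proof
    assume up: "y0 < z \<and> (\<forall>y<z. 0 < f y c)"
    have le: "x r \<le> z" if r: "r \<in> {s..t}" for r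
    proof (rule ccontr)
      assume gt: "\<not> x r \<le> z"
      have "\<exists>r'\<ge>s. r' \<le> r \<and> x r' = z"
        by (rule IVT') (use up x(1) gt r cx[OF t] in \<open>auto intro: continuous_on_subset\<close>)
      then obtain r' where "s \<le> r'" "r' \<le> r" "x r' = z" by blast
      then show False using away[of r'] gt r by (cases "r' = r") auto
    qed
    have "y0 \<le> x r" if r: "r \<in> {s..t}" for r
    proof (cases "s = r")
      case False
      then have fl: "flow_on f c x s r" using x(2) r by simp
      have "x s \<le> x r"
      proof (rule DERIV_nonneg_imp_increasing_open[OF _ _ flow_on_continuous[OF fl]])
        fix r' assume r': "s < r'" "r' < r"
        then have "(x has_real_derivative f (x r') c) (at r')"
          using fl at_within_Icc_at[of s r' r] unfolding flow_on_def by (metis atLeastAtMost_iff less_imp_le)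
        moreover have "x r' < z" using le[of r'] away[of r'] r r' by fastforce
        ultimately show "\<exists>y. (x has_real_derivative y) (at r') \<and> y \<ge> 0" using up by (meson less_imp_le)
      qed (use r in auto)
      then show ?thesis using x(1) by simp
    qed (use x in auto)
    then show ?thesis using le up by (auto simp: K)
  next
    assume down: "z < y0 \<and> (\<forall>y>z. f y c < 0)"
    have ge: "z \<le> x r" if r: "r \<in> {s..t}" for r
    proof (rule ccontr)
      assume lt: "\<not> z \<le> x r"
      have "\<exists>r'\<ge>s. r' \<le> r \<and> x r' = z"
        by (rule IVT2') (use down x(1) lt r cx[OF t] in \<open>auto intro: continuous_on_subset\<close>)
      then obtain r' where "s \<le> r'" "r' \<le> r" "x r' = z" by blast
      then show False using away[of r'] lt r by (cases "r' = r") auto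
    qed
    have "x r \<le> y0" if r: "r \<in> {s..t}" for r
    proof (cases "s = r")
      case False
      then have fl: "flow_on f c x s r" using x(2) r by simp
      have "x r \<le> x s"
      proof (rule DERIV_nonpos_imp_decreasing_open[OF _ _ flow_on_continuous[OF fl]])
        fix r' assume r': "s < r'" "r' < r"
        then have "(x has_real_derivative f (x r') c) (at r')"
          using fl at_within_Icc_at[of s r' r] unfolding flow_on_def by (metis atLeastAtMost_iff less_imp_le)
        moreover have "z < x r'" using ge[of r'] away[of r'] r r' by fastforce
        ultimately show "\<exists>y. (x has_real_derivative y) (at r') \<and> y \<le> 0" using down by (meson less_imp_le)
      qed (use r in auto)
      then show ?thesis using x(1) by simp
    qed (use x in auto)
    then show ?thesis using ge down by (auto simp: K)
  qed
  have stayD: "x r \<in> {lo..hi}" if "s < t" "\<And>r. r \<in> {s..<t} \<Longrightarrow> x r \<noteq> z" "r \<in> {s..t}" for t r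
    using stay[OF that(1,2)] that(3) by blast
  have subst: "((\<lambda>r. k (x r) * f (x r) c) has_integral (integral {lo..x t} k - integral {lo..y0} k)) {s..t}"
    if t: "s < t" and away: "\<And>r. r \<in> {s..<t} \<Longrightarrow> x r \<noteq> z" and k: "k integrable_on {lo..hi}" "continuous_on ({lo..hi} - {z}) k" for t k
  proof (subst x(1)[symmetric], rule flow_on_substitution[OF x(2)[OF t] _ _ stay[OF t away] k(1) _ k(2)])
    show "f (x r) c \<noteq> 0" if "r \<in> {s..<t}" for r
      using that by (intro nz away stayD[OF t away]) auto
  qed (use t in auto)
  have ck: "continuous_on ({lo..hi} - {z}) (\<lambda>y. \<rho> y / f y c)" if "continuous_on {lo..hi} \<rho>" for \<rho> :: "real \<Rightarrow> real"
    using nz that by (intro continuous_on_divide continuous_on_speed) (auto intro: continuous_on_subset continuous_on_id)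
  \<comment> \<open>If \<open>z\<close> were never reached, the elapsed time would be a difference
    of two values of the primitive \<open>?P\<close> and hence at most
    \<open>2 * \<bar>C\<bar>\<close>; \<open>t\<close> is chosen to exceed this.\<close>
  have "\<exists>r\<ge>s. x r = z"
  proof (rule ccontr)
    assume "\<not> ?thesis"
    then have away: "x r \<noteq> z" if "r \<ge> s" for r using that by auto
    let ?P = "\<lambda>y. integral {lo..y} (\<lambda>y. 1 / f y c)"
    obtain C where C: "\<And>y. y \<in> {lo..hi} \<Longrightarrow> \<bar>?P y\<bar> \<le> C"
      using compact_imp_bounded[OF compact_continuous_image[OF indefinite_integral_continuous_1[OF int] compact_Icc]]
      unfolding bounded_real by force
    define t where "t = s + 2 * \<bar>C\<bar> + 1"
    have t: "s < t" by (simp add: t_def)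
    have "((\<lambda>r. 1 / f (x r) c * f (x r) c) has_integral (?P (x t) - ?P y0)) {s..t}"
      by (rule subst[OF t]) (use away int ck[of "\<lambda>_. 1"] in auto)
    then have "((\<lambda>r. 1) has_integral (?P (x t) - ?P y0)) {s..t}"
    proof (rule has_integral_eq[rotated])
      fix r assume r: "r \<in> {s..t}"
      then have "x r \<in> {lo..hi}" using stayD[OF t away] by auto
      then show "1 / f (x r) c * f (x r) c = 1" using nz[of "x r"] away r by simp
    qed
    moreover have "((\<lambda>r. 1::real) has_integral (t - s)) {s..t}" using has_integral_const_real[of "1::real" s t] t by simp
    ultimately have "?P (x t) - ?P y0 = t - s" by (rule has_integral_unique)
    moreover have "x t \<in> {lo..hi}" using stayD[OF t away] t by auto
    then have "\<bar>?P (x t)\<bar> \<le> C" by (rule C)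
    moreover have "\<bar>?P y0\<bar> \<le> C" by (rule C) (auto simp: K)
    ultimately show False by (simp add: t_def)
  qed
  then obtain r0 where r0: "r0 \<ge> s" "x r0 = z" by blast
  have "y0 \<noteq> z" using dir by auto
  then have sr0: "s < r0" using r0 x(1) by (cases "s = r0") auto
  define Z where "Z = {r\<in>{s..r0}. x r = z}"
  have "closed Z" unfolding Z_def using cx[OF sr0] by (intro continuous_closed_preimage_constant) auto
  moreover have "Z \<noteq> {}" "bdd_below Z" using r0 by (auto simp: Z_def intro: bdd_belowI[of _ s])
  ultimately have inf: "Inf Z \<in> Z" "\<And>r. r \<in> Z \<Longrightarrow> Inf Z \<le> r"
    by (auto intro: closed_contains_Inf cInf_lower)
  define t1 where "t1 = Inf Z"
  have xt1: "x t1 = z" "s \<le> t1" using inf(1) by (auto simp: Z_def t1_def)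
  then have t1: "s < t1" using x(1) \<open>y0 \<noteq> z\<close> by (cases "s = t1") auto
  have away: "x r \<noteq> z" if "r \<in> {s..<t1}" for r
  proof
    assume "x r = z"
    then have "r \<in> Z" using that inf(1) by (auto simp: Z_def t1_def)
    then show False using inf(2)[of r] that by (simp add: t1_def)
  qed
  define t where "t = t1 + \<tau>"
  have st: "s < t" using t1 \<tau> by (simp add: t_def)
  have rest: "x r = z" if "r \<in> {t1..t}" for r
  proof (cases "\<tau> > 0")
    case True
    then show ?thesis
      using flow_on_equilibrium[of c x t1 t r] flow_on_subset[OF x(2)[OF st], of t1 t] t1 \<tau>(2) xt1 that by auto
  qed (use that \<tau>(1) xt1 in \<open>auto simp: t_def\<close>)
  show thesis
  proof (rule that[OF st x(2)[OF st] x(1)])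
    show "x t = z" using rest[of t] \<tau>(1) by (simp add: t_def)
    show im: "x ` {s..t} \<subseteq> {lo..hi}"
    proof (clarify)
      fix r assume "r \<in> {s..t}"
      then show "x r \<in> {lo..hi}"
        using stayD[OF t1 away] rest[of r] by (cases "r \<le> t1") (auto simp: K)
    qed
    fix \<rho> :: "real \<Rightarrow> real" assume \<rho>: "continuous_on {lo..hi} \<rho>"
    let ?k = "\<lambda>y. \<rho> y / f y c"
    have k: "?k integrable_on {lo..hi}"
    proof (rule integrable_reciprocal_times[OF _ _ int \<rho>])
      show "continuous_on {lo..hi} (\<lambda>y. f y c)" by (rule continuous_on_speed) simp
      show "f y c \<noteq> 0" if "y \<in> {lo<..<hi}" for y using that by (intro nz) (auto simp: K)
    qed
    have "((\<lambda>r. ?k (x r) * f (x r) c) has_integral (integral {lo..x t1} ?k - integral {lo..y0} ?k)) {s..t1}"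
      by (rule subst[OF t1 away k ck[OF \<rho>]])
    then have "((\<lambda>r. \<rho> (x r)) has_integral (integral {lo..x t1} ?k - integral {lo..y0} ?k)) {s..t1}"
    proof (rule has_integral_spike_finite[rotated 2])
      show "finite {t1}" by simp
      fix r assume r: "r \<in> {s..t1} - {t1}"
      then have "f (x r) c \<noteq> 0" by (intro nz away stayD[OF t1 away]) auto
      then show "\<rho> (x r) = ?k (x r) * f (x r) c" by simp
    qed
    moreover have "((\<lambda>r. \<rho> (x r)) has_integral \<tau> * \<rho> z) {t1..t}"
    proof (rule has_integral_eq)
      show "((\<lambda>r. \<rho> z) has_integral \<tau> * \<rho> z) {t1..t}"
        using has_integral_const_real[of "\<rho> z" t1 t] \<tau>(1) by (simp add: t_def)
    qed (simp add: rest)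
    ultimately have "((\<lambda>r. \<rho> (x r)) has_integral (integral {lo..x t1} ?k - integral {lo..y0} ?k) + \<tau> * \<rho> z) {s..t}"
      using t1 \<tau>(1) by (intro has_integral_combine[of s t1 t]) (auto simp: t_def)
    moreover have "integral {lo..x t1} ?k - integral {lo..y0} ?k = (if y0 < z then integral {lo..hi} ?k else - integral {lo..hi} ?k)"
      using xt1 \<open>y0 \<noteq> z\<close> by (auto simp: K min_def max_def)
    ultimately show "((\<lambda>r. \<rho> (x r)) has_integral
        ((if y0 < z then integral {lo..hi} ?k else - integral {lo..hi} ?k) + \<tau> * \<rho> z)) {s..t}" by simp
  qed
qed

end

section \<open>Jumps and storage functions\<close>

lemma up_jumps_subset_discontinuities: "up_jumps T u \<subseteq> discontinuities T u"
proof
  fix t assume t: "t \<in> up_jumps T u"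
  then have tT: "t \<in> {0..T}" by (simp add: up_jumps_def)
  have "\<not> continuous (at t within {0..T}) u"
  proof
    assume "continuous (at t within {0..T}) u"
    then have "eventually (\<lambda>s. u s = u t) (at t within {0..T})"
      by (simp add: continuous_within tendsto_discrete)
    then obtain d where d: "d > 0" "\<And>s. s \<in> {0..T} \<Longrightarrow> s \<noteq> t \<Longrightarrow> \<bar>s - t\<bar> < d \<Longrightarrow> u s = u t"
      unfolding eventually_at dist_real_def by blast
    have "(0 < t \<and> u t \<and> (\<forall>\<^sub>F s in at_left t. \<not> u s)) \<or> (t < T \<and> \<not> u t \<and> (\<forall>\<^sub>F s in at_right t. u s))"
      using t by (simp add: up_jumps_def)
    then show False
    proof
      assume l: "0 < t \<and> u t \<and> (\<forall>\<^sub>F s in at_left t. \<not> u s)"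
      then obtain b where b: "b < t" "\<And>y. b < y \<Longrightarrow> y < t \<Longrightarrow> \<not> u y"
        unfolding eventually_at_left_field by blast
      define s where "s = (max (max b 0) (t - d) + t) / 2"
      have "b < s" "s < t" "0 \<le> s" "\<bar>s - t\<bar> < d" using b l d(1) by (auto simp: s_def max_def)
      then show False using b(2)[of s] d(2)[of s] l tT by auto
    next
      assume r: "t < T \<and> \<not> u t \<and> (\<forall>\<^sub>F s in at_right t. u s)"
      then obtain b where b: "b > t" "\<And>y. y > t \<Longrightarrow> y < b \<Longrightarrow> u y"
        unfolding eventually_at_right_field by blast
      define s where "s = (min (min b T) (t + d) + t) / 2"
      have "s < b" "t < s" "s \<le> T" "\<bar>s - t\<bar> < d" using b r d(1) by (auto simp: s_def min_def)
      then show False using b(2)[of s] d(2)[of s] r tT by auto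
    qed
  qed
  then show "t \<in> discontinuities T u" using tT by (simp add: discontinuities_def)
qed

text \<open>A continuous map into a discrete space is constant on an interval, and
  \<open>\<epsilon>\<close> keeps the other discontinuities away. The value at \<open>t\<close>
  itself is left free from both sides.\<close>

lemma piecewise_constant_locally:
  assumes "piecewise_constant T u"
  obtains \<epsilon> where "\<epsilon> > 0"
    "\<And>s r. 0 \<le> s \<Longrightarrow> s \<le> r \<Longrightarrow> r < t \<Longrightarrow> r \<le> T \<Longrightarrow> t - \<epsilon> < s \<Longrightarrow> u s = u r"
    "\<And>s r. 0 \<le> s \<Longrightarrow> t < s \<Longrightarrow> s \<le> r \<Longrightarrow> r \<le> T \<Longrightarrow> r < t + \<epsilon> \<Longrightarrow> u s = u r"
proof -
  obtain \<epsilon> where \<epsilon>: "\<epsilon> > 0" "\<And>d. d \<in> discontinuities T u \<Longrightarrow> d \<noteq> t \<Longrightarrow> \<epsilon> \<le> dist t d"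
    using finite_set_avoid assms unfolding piecewise_constant_def by metis
  have const: "u s = u r" if "0 \<le> s" "s \<le> r" "r \<le> T" "{s..r} \<inter> discontinuities T u = {}" for s r
  proof -
    have "continuous_on {s..r} u"
      unfolding continuous_on_eq_continuous_within
    proof
      fix z assume z: "z \<in> {s..r}"
      then have "z \<in> {0..T}" "z \<notin> discontinuities T u" using that by auto
      then have "continuous (at z within {0..T}) u" by (simp add: discontinuities_def)
      then show "continuous (at z within {s..r}) u" by (rule continuous_within_subset) (use that in auto)
    qed
    then show ?thesis
      using connectedD_const[of "{s..r}" u] that by fastforce
  qed
  show thesis
  proof (rule that[OF \<epsilon>(1)])
    fix s r assume a: "0 \<le> s" "s \<le> r" "r < t" "r \<le> T" "t - \<epsilon> < s"
    show "u s = u r" by (rule const) (use a \<epsilon>(2) in \<open>force simp: dist_real_def\<close>)+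
  next
    fix s r assume a: "0 \<le> s" "t < s" "s \<le> r" "r \<le> T" "r < t + \<epsilon>"
    show "u s = u r" by (rule const) (use a \<epsilon>(2) in \<open>force simp: dist_real_def\<close>)+
  qed
qed

section \<open>Storage along a periodic trajectory\<close>

context controlled_speed begin

text \<open>\<open>W (u t) (x t)\<close> can rise within a phase by at most the integral of
  \<open>\<rho>\<close>, at an upward jump by at most \<alpha>, at a downward jump not at all. It
  returns to its initial value after a period, so the sum of these allowances cannot be
  negative.\<close>

lemma storage_inequality:
  fixes \<rho> k :: "bool \<Rightarrow> real \<Rightarrow> real"
  assumes sol: "solution f T x u" and T: "0 < T" and pc: "piecewise_constant T u"
    and per: "x 0 = x T" "u 0 = u T" and im: "x ` {0..T} \<subseteq> {lo..hi}" and \<alpha>: "0 < \<alpha>"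
    and k: "\<And>c. k c integrable_on {lo..hi}" and X: "finite X" "\<And>c. continuous_on ({lo..hi} - X) (k c)"
    and \<rho>: "\<And>c. continuous_on {lo..hi} (\<rho> c)"
    and le: "\<And>y c. y \<in> {lo..hi} - X \<Longrightarrow> k c y * f y c \<le> \<rho> c y"
    and rest: "\<And>y c. y \<in> {lo..hi} \<Longrightarrow> f y c = 0 \<Longrightarrow> 0 \<le> \<rho> c y"
    and W: "\<And>c y. W c y = e c + integral {lo..y} (k c)"
    and jump: "\<And>y. y \<in> {lo..hi} \<Longrightarrow> W False y \<le> W True y" "\<And>y. y \<in> {lo..hi} \<Longrightarrow> W True y \<le> W False y + \<alpha>"
  shows "(\<lambda>r. \<rho> (u r) (x r)) integrable_on {0..T}"
    and "0 \<le> \<alpha> * card (up_jumps T u) + integral {0..T} (\<lambda>r. \<rho> (u r) (x r))"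
proof -
  define R where "R r = \<rho> (u r) (x r)" for r
  have fin: "finite (up_jumps T u)"
    using up_jumps_subset_discontinuities pc unfolding piecewise_constant_def by (rule finite_subset)
  \<comment> \<open>A jump made on arriving at \<open>r\<close> is counted at \<open>r\<close>
    already, one made on leaving \<open>r\<close> only after it. This matches
    \<open>W (u t) (x t)\<close>, which uses the pointwise value of \<open>u\<close> at the
    jump.\<close>
  define N1 where "N1 t = {r\<in>up_jumps T u. u r \<and> r \<le> t}" for t
  define N2 where "N2 t = {r\<in>up_jumps T u. \<not> u r \<and> r < t}" for t
  have finN: "finite (N1 t)" "finite (N2 t)" for t using fin by (auto simp: N1_def N2_def)
  define N where "N t = real (card (N1 t) + card (N2 t))" for t
  have N_sub: "N1 s \<subseteq> N1 t" "N2 s \<subseteq> N2 t" if "s \<le> t" for s t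
    using that by (auto simp: N1_def N2_def)
  have mono: "card (N1 s) \<le> card (N1 t)" "card (N2 s) \<le> card (N2 t)" if "s \<le> t" for s t
    using that finN by (auto intro!: card_mono simp: N1_def N2_def)
  have Nmono: "N s \<le> N t" if "s \<le> t" for s t using mono[OF that] by (simp add: N_def)
  have xin: "x r \<in> {lo..hi}" if "r \<in> {0..T}" for r using im that unfolding image_subset_iff by simp
  have piece: "R integrable_on {s..t} \<and> W c (x t) - W c (x s) \<le> integral {s..t} R"
    if st: "0 \<le> s" "s < t" "t \<le> T" and c: "\<And>r. r \<in> {s<..<t} \<Longrightarrow> u r = c" for s t c
  proof -
    have fl: "flow_on f c x s t" using solution_flow_on[OF sol] st c by auto
    have im': "x ` {s..t} \<subseteq> {lo..hi}" using xin st by auto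
    have "(\<lambda>r. \<rho> c (x r)) integrable_on {s..t}"
      using continuous_on_compose2[OF \<rho> flow_on_continuous[OF fl] im'] by (rule integrable_continuous_real)
    then have "((\<lambda>r. \<rho> c (x r)) has_integral integral {s..t} (\<lambda>r. \<rho> c (x r))) {s..t}"
      by (rule integrable_integral)
    then have "(R has_integral integral {s..t} (\<lambda>r. \<rho> c (x r))) {s..t}"
      by (rule has_integral_spike_finite[rotated 2, of _ _ _ "{s,t}"]) (use c in \<open>auto simp: R_def\<close>)
    moreover have "integral {lo..x t} (k c) - integral {lo..x s} (k c) \<le> integral {s..t} (\<lambda>r. \<rho> c (x r))"
      by (rule flow_on_dissipation[OF fl less_imp_le[OF st(2)] im' k X \<rho> le rest])
    then have "W c (x t) - W c (x s) \<le> integral {s..t} (\<lambda>r. \<rho> c (x r))" by (simp add: W)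
    ultimately show ?thesis by (simp add: has_integral_iff)
  qed
  \<comment> \<open>\<open>P\<close> composes over adjacent intervals and holds on every short
    interval around a given time, so bisection extends it to \<open>{0..T}\<close> without
    enumerating the discontinuities. Integrability is carried along because the composition needs
    it.\<close>
  define P where "P s t \<longleftrightarrow> (0 \<le> s \<and> s \<le> t \<and> t \<le> T \<longrightarrow> R integrable_on {s..t} \<and>
      W (u t) (x t) - W (u s) (x s) \<le> integral {s..t} R + \<alpha> * (N t - N s))" for s t
  have P_trans: "P s t" if "P s r" "P r t" "s \<le> r" "r \<le> t" for s r t
    unfolding P_def
  proof
    assume st: "0 \<le> s \<and> s \<le> t \<and> t \<le> T"
    have 1: "R integrable_on {s..r}" "W (u r) (x r) - W (u s) (x s) \<le> integral {s..r} R + \<alpha> * (N r - N s)"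
      and 2: "R integrable_on {r..t}" "W (u t) (x t) - W (u r) (x r) \<le> integral {r..t} R + \<alpha> * (N t - N r)"
      using that st by (auto simp: P_def)
    have i: "R integrable_on {s..t}"
      using that(3,4) 1(1) 2(1) by (rule Henstock_Kurzweil_Integration.integrable_combine)
    have "integral {s..r} R + integral {r..t} R = integral {s..t} R"
      using that(3,4) i by (rule Henstock_Kurzweil_Integration.integral_combine)
    then show "R integrable_on {s..t} \<and> W (u t) (x t) - W (u s) (x s) \<le> integral {s..t} R + \<alpha> * (N t - N s)"
      using i 1(2) 2(2) by (auto simp: algebra_simps)
  qed
  have P_refl: "P t t" for t using integrable_on_refl[of R t] by (simp add: P_def)
  have "P 0 T"
  proof (rule Bolzano)
    fix t assume t: "0 \<le> t" "t \<le> T"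
    obtain \<epsilon> where \<epsilon>: "\<epsilon> > 0"
      "\<And>s r. 0 \<le> s \<Longrightarrow> s \<le> r \<Longrightarrow> r < t \<Longrightarrow> r \<le> T \<Longrightarrow> t - \<epsilon> < s \<Longrightarrow> u s = u r"
      "\<And>s r. 0 \<le> s \<Longrightarrow> t < s \<Longrightarrow> s \<le> r \<Longrightarrow> r \<le> T \<Longrightarrow> r < t + \<epsilon> \<Longrightarrow> u s = u r"
      using piecewise_constant_locally[OF pc, of t] by metis
    have left: "P s t" if s: "s < t" "t - s < \<epsilon>" for s
      unfolding P_def
    proof
      assume "0 \<le> s \<and> s \<le> t \<and> t \<le> T"
      then have s0: "0 \<le> s" by simp
      have us: "u r = u s" if "r \<in> {s..<t}" for r
        using \<epsilon>(2)[of s r] that s s0 t by auto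
      have p: "R integrable_on {s..t} \<and> W (u s) (x t) - W (u s) (x s) \<le> integral {s..t} R"
        by (rule piece[OF s0 s(1) t(2)], rule us) simp
      have xt: "x t \<in> {lo..hi}" using t by (intro xin) auto
      have "W (u t) (x t) - W (u s) (x t) \<le> \<alpha> * (N t - N s)"
      proof (cases "\<not> u s \<and> u t")
        case True
        have "\<forall>\<^sub>F r in at_left t. \<not> u r"
          unfolding eventually_at_left_field
        proof (intro exI[of _ s] conjI allI impI)
          fix r assume "s < r" "r < t"
          then show "\<not> u r" using us[of r] True by simp
        qed (fact s(1))
        then have "t \<in> N1 t - N1 s" using True s s0 t by (auto simp: N1_def up_jumps_def)
        then have "card (N1 s) < card (N1 t)"
          using N_sub[OF less_imp_le[OF s(1)]] by (intro psubset_card_mono finN) auto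
        then have "1 \<le> N t - N s" using mono(2)[of s t] s by (simp add: N_def)
        then have "\<alpha> \<le> \<alpha> * (N t - N s)" using \<alpha> by simp
        then show ?thesis using jump(2)[OF xt] True by simp
      next
        case False
        then have "W (u t) (x t) \<le> W (u s) (x t)" using jump(1)[OF xt] by (cases "u s"; cases "u t") auto
        moreover have "0 \<le> \<alpha> * (N t - N s)" using \<alpha> Nmono[of s t] s by simp
        ultimately show ?thesis by simp
      qed
      then show "R integrable_on {s..t} \<and> W (u t) (x t) - W (u s) (x s) \<le> integral {s..t} R + \<alpha> * (N t - N s)"
        using p by auto
    qed
    have right: "P t s" if s: "t < s" "s - t < \<epsilon>" for s
      unfolding P_def
    proof
      assume "0 \<le> t \<and> t \<le> s \<and> s \<le> T"
      then have s0: "s \<le> T" by simp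
      have us: "u r = u s" if "r \<in> {t<..s}" for r
        using \<epsilon>(3)[of r s] that s s0 t by auto
      have p: "R integrable_on {t..s} \<and> W (u s) (x s) - W (u s) (x t) \<le> integral {t..s} R"
        by (rule piece[OF t(1) s(1) s0], rule us) simp
      have xt: "x t \<in> {lo..hi}" using t by (intro xin) auto
      have "W (u s) (x t) - W (u t) (x t) \<le> \<alpha> * (N s - N t)"
      proof (cases "\<not> u t \<and> u s")
        case True
        have "\<forall>\<^sub>F r in at_right t. u r"
          unfolding eventually_at_right_field
        proof (intro exI[of _ s] conjI allI impI)
          fix r assume "t < r" "r < s"
          then show "u r" using us[of r] True by simp
        qed (fact s(1))
        then have "t \<in> N2 s - N2 t" using True s s0 t by (auto simp: N2_def up_jumps_def)
        then have "card (N2 t) < card (N2 s)"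
          using N_sub[OF less_imp_le[OF s(1)]] by (intro psubset_card_mono finN) auto
        then have "1 \<le> N s - N t" using mono(1)[of t s] s by (simp add: N_def)
        then have "\<alpha> \<le> \<alpha> * (N s - N t)" using \<alpha> by simp
        then show ?thesis using jump(2)[OF xt] True by simp
      next
        case False
        then have "W (u s) (x t) \<le> W (u t) (x t)" using jump(1)[OF xt] by (cases "u s"; cases "u t") auto
        moreover have "0 \<le> \<alpha> * (N s - N t)" using \<alpha> Nmono[of t s] s by simp
        ultimately show ?thesis by simp
      qed
      then show "R integrable_on {t..s} \<and> W (u s) (x s) - W (u t) (x t) \<le> integral {t..s} R + \<alpha> * (N s - N t)"
        using p by auto
    qed
    show "\<exists>d>0. \<forall>a b. a \<le> t \<and> t \<le> b \<and> b - a < d \<longrightarrow> P a b"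
    proof (intro exI[of _ \<epsilon>] conjI allI impI \<epsilon>(1))
      fix a b assume ab: "a \<le> t \<and> t \<le> b \<and> b - a < \<epsilon>"
      have "P a t" using left[of a] P_refl ab by (cases "a = t") auto
      moreover have "P t b" using right[of b] P_refl ab by (cases "b = t") auto
      ultimately show "P a b" using P_trans ab by blast
    qed
  qed (use T P_trans in auto)
  then have R: "R integrable_on {0..T}" "0 \<le> integral {0..T} R + \<alpha> * (N T - N 0)"
    using T per by (auto simp: P_def)
  have "N T \<le> card (up_jumps T u)"
  proof -
    have "card (N1 T) + card (N2 T) = card (N1 T \<union> N2 T)"
      using finN by (intro card_Un_disjoint[symmetric]) (auto simp: N1_def N2_def)
    also have "\<dots> \<le> card (up_jumps T u)" using fin by (intro card_mono) (auto simp: N1_def N2_def)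
    finally show ?thesis by (simp add: N_def)
  qed
  moreover have "N 0 \<ge> 0" by (simp add: N_def)
  ultimately have "\<alpha> * (N T - N 0) \<le> \<alpha> * card (up_jumps T u)" using \<alpha> by (intro mult_left_mono) auto
  then show "(\<lambda>r. \<rho> (u r) (x r)) integrable_on {0..T}"
    "0 \<le> \<alpha> * card (up_jumps T u) + integral {0..T} (\<lambda>r. \<rho> (u r) (x r))"
    using R by (simp_all add: R_def[abs_def])
qed

end

section \<open>The multiplier line\<close>

lemma integral_pos_open:
  fixes \<phi> :: "real \<Rightarrow> real"
  assumes "r < s" "continuous_on {r<..<s} \<phi>" "\<And>y. y \<in> {r<..<s} \<Longrightarrow> 0 < \<phi> y" "\<phi> integrable_on {r..s}"
  shows "0 < integral {r..s} \<phi>"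
proof -
  define r1 s1 where "r1 = r + (s - r) / 3" and "s1 = r + 2 * (s - r) / 3"
  have rs: "r < r1" "r1 < s1" "s1 < s" using assms(1) by (auto simp: r1_def s1_def field_simps)
  have "continuous_on {r1..s1} \<phi>" using assms(2) rs by (auto intro: continuous_on_subset)
  then obtain y0 where y0: "y0 \<in> {r1..s1}" "\<And>y. y \<in> {r1..s1} \<Longrightarrow> \<phi> y0 \<le> \<phi> y"
    using continuous_attains_inf[of "{r1..s1}" \<phi>] rs by auto
  have pos: "\<phi> y0 > 0" using assms(3) y0(1) rs by auto
  have i1: "\<phi> integrable_on {r1..s1}"
    using integrable_subinterval_real[OF assms(4)] rs by auto
  have "0 < \<phi> y0 * (s1 - r1)" using pos rs by simp
  also have "\<dots> = integral {r1..s1} (\<lambda>_. \<phi> y0)" using rs by simp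
  also have "\<dots> \<le> integral {r1..s1} \<phi>" using i1 y0(2) by (intro integral_le) auto
  also have "\<dots> \<le> integral {r<..<s} \<phi>"
    using assms(3,4) i1 rs by (intro integral_subset_le) (auto simp: integrable_on_open_interval_real less_imp_le)
  finally show ?thesis by (simp add: integral_open_interval_real)
qed

text \<open>Monotone convergence along cut-off points \<open>e n\<close> increasing to
  \<open>b\<close>: for a nonnegative function, bounded partial integrals exclude a nonintegrable
  singularity.\<close>

lemma integrable_on_bounded_integrals:
  fixes \<phi> :: "real \<Rightarrow> real"
  assumes Vb: "V < b" and cont: "continuous_on {V..<b} \<phi>" and nonneg: "\<And>s. s \<in> {V..<b} \<Longrightarrow> 0 \<le> \<phi> s"
    and bound: "\<And>s. s \<in> {V..<b} \<Longrightarrow> integral {V..s} \<phi> \<le> C"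
  shows "\<phi> integrable_on {V..b}"
proof -
  define e where "e n = b - (b - V) / real (Suc n)" for n
  have e: "V \<le> e n" "e n < b" "e n \<le> e (Suc n)" for n
    using Vb mult_right_mono[of V b "real n"] by (auto simp: e_def field_simps)
  define F where "F n s = (if s \<in> {V..e n} then \<phi> s else 0)" for n s
  have \<phi>e: "\<phi> integrable_on {V..e n}" for n
  proof (intro integrable_continuous_real continuous_on_subset[OF cont])
    show "{V..e n} \<subseteq> {V..<b}" using e(2)[of n] by auto
  qed
  have int: "(F n has_integral integral {V..e n} \<phi>) {V..b}" for n
    unfolding F_def[abs_def]
    using has_integral_restrict[of "{V..e n}" "{V..b}" \<phi>] integrable_integral[OF \<phi>e[of n]] e(2)[of n] by auto
  have "(\<lambda>s. if s < b then \<phi> s else 0) integrable_on {V..b}"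
  proof (rule conjunct1[OF monotone_convergence_increasing])
    show "F n integrable_on {V..b}" for n using int by blast
    show "F n s \<le> F (Suc n) s" if "s \<in> {V..b}" for n s
      using e(1,2)[of "Suc n"] e(3)[of n] nonneg[of s] that by (auto simp: F_def)
    show "(\<lambda>n. F n s) \<longlonglongrightarrow> (if s < b then \<phi> s else 0)" if s: "s \<in> {V..b}" for s
    proof (cases "s < b")
      case True
      have "e \<longlonglongrightarrow> b - (b - V) * 0"
        unfolding e_def divide_inverse by (intro tendsto_intros LIMSEQ_inverse_real_of_nat)
      then have "eventually (\<lambda>n. s < e n) sequentially" using True by (intro order_tendstoD(1)) auto
      then have "eventually (\<lambda>n. F n s = \<phi> s) sequentially"
        by eventually_elim (use s in \<open>auto simp: F_def\<close>)
      then show ?thesis using True by (simp add: tendsto_eventually)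
    next
      case False
      then have "F n s = 0" for n using e(2)[of n] by (auto simp: F_def)
      then show ?thesis using False by simp
    qed
    show "bounded (range (\<lambda>n. integral {V..b} (F n)))"
    proof -
      have "integral {V..b} (F n) = integral {V..e n} \<phi>" for n using int by (rule integral_unique)
      moreover have "0 \<le> integral {V..e n} \<phi>" for n
        using nonneg e[of n] by (intro integral_nonneg \<phi>e) auto
      moreover have "integral {V..e n} \<phi> \<le> C" for n using bound e[of n] by auto
      ultimately show ?thesis unfolding bounded_real by (intro exI[of _ C]) auto
    qed
  qed
  then show ?thesis
    by (rule integrable_spike_finite[rotated 2, of _ _ "{b}"]) auto
qed

lemma integrable_times_weight:
  fixes \<phi> w :: "real \<Rightarrow> real"
  assumes "continuous_on {p..q} \<phi>" "continuous_on {p<..<q} w" "\<And>s. s \<in> {p<..<q} \<Longrightarrow> 0 \<le> w s" "w integrable_on {p..q}"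
  shows "(\<lambda>s. \<phi> s * w s) integrable_on {p..q}"
proof -
  obtain C where C: "\<And>s. s \<in> {p..q} \<Longrightarrow> \<bar>\<phi> s\<bar> \<le> C"
    using compact_imp_bounded[OF compact_continuous_image[OF assms(1) compact_Icc]] unfolding bounded_real by force
  show ?thesis
  proof (rule integrable_dominated)
    show "(\<lambda>s. C * w s) integrable_on {p..q}" using integrable_on_mult_right[OF assms(4)] .
    show "continuous_on {p<..<q} (\<lambda>s. \<phi> s * w s)"
      using assms(1,2) by (intro continuous_intros) (auto intro: continuous_on_subset)
    show "\<bar>\<phi> s * w s\<bar> \<le> C * w s" if "s \<in> {p<..<q}" for s
      using C[of s] assms(3)[OF that] that by (simp add: abs_mult mult_right_mono)
  qed
qed

text \<open>The path spends its parameter on the first moment of the weight; if the weight is integrable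
  up to the end point, the path stops there.\<close>

lemma clipped_path:
  fixes w :: "real \<Rightarrow> real"
  assumes Vb: "V < b" "b \<le> B" and w: "continuous_on {V..<B} w" "\<And>s. s \<in> {V..<B} \<Longrightarrow> 0 < w s"
  obtains q where "\<And>m. 0 \<le> m \<Longrightarrow> q m \<in> {V..b}" "\<And>m. 0 < m \<Longrightarrow> V < q m" "q 0 = V"
    "\<And>m. 0 \<le> m \<Longrightarrow> w integrable_on {V..q m}"
    "\<And>m. 0 \<le> m \<Longrightarrow> integral {V..q m} (\<lambda>s. (s - V) * w s) \<le> m"
    "\<And>m. 0 \<le> m \<Longrightarrow> integral {V..q m} (\<lambda>s. (s - V) * w s) < m \<Longrightarrow> q m = b"
    "\<And>m m'. 0 \<le> m' \<Longrightarrow> m' \<le> m \<Longrightarrow> integral {V..q m} (\<lambda>s. (s - V) * w s) = m \<Longrightarrow>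
      integral {V..q m'} (\<lambda>s. (s - V) * w s) = m'"
    "b < B \<Longrightarrow> \<exists>m>0. q m = b \<and> integral {V..q m} (\<lambda>s. (s - V) * w s) = m"
    "\<And>y. y \<in> {V..<b} \<Longrightarrow> \<exists>m0\<ge>0. \<forall>m\<ge>m0. y \<le> q m"
    "continuous_on {0..} q"
    "\<And>\<phi>. continuous_on {V..b} \<phi> \<Longrightarrow> continuous_on {0..} (\<lambda>m. integral {V..q m} (\<lambda>s. \<phi> s * w s))"
proof -
  \<comment> \<open>\<open>J\<close> contains all of \<open>{V..<b}\<close>; whether
    \<open>b\<close> belongs to it decides between arriving at \<open>b\<close> and only approaching
    it.\<close>
  define J where "J = {s\<in>{V..b}. w integrable_on {V..s}}"
  define M where "M s = integral {V..s} (\<lambda>s. (s - V) * w s)" for s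
  have J1: "s \<in> J" if "V \<le> s" "s < b" for s
    using that Vb w(1) by (auto simp: J_def intro!: integrable_continuous_real intro: continuous_on_subset)
  have J2: "r \<in> J" if "s \<in> J" "V \<le> r" "r \<le> s" for r s
    using that integrable_subinterval_real[of w V s V r] by (auto simp: J_def)
  have VJ: "V \<in> J" using J1 Vb by auto
  have JV: "V \<le> s" "s \<le> b" if "s \<in> J" for s using that by (auto simp: J_def)
  have w0: "0 \<le> w s" if "s \<in> {V<..<b}" for s using w(2)[of s] that Vb by auto
  have \<phi>int: "(\<lambda>s. \<phi> s * w s) integrable_on {V..s}" if "continuous_on {V..b} \<phi>" "s \<in> J" for \<phi> s
    using that w(1) w0 Vb
    by (intro integrable_times_weight) (auto simp: J_def intro: continuous_on_subset)
  have c1: "continuous_on {V..b} (\<lambda>s. s - V)" by (intro continuous_intros)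
  have \<phi>cont: "continuous_on J (\<lambda>s. integral {V..s} (\<lambda>s. \<phi> s * w s))" if \<phi>: "continuous_on {V..b} \<phi>" for \<phi>
    unfolding continuous_on_eq_continuous_within
  proof
    fix s assume s: "s \<in> J"
    \<comment> \<open>\<open>J\<close> need not be compact; near \<open>s\<close> it coincides with
      a compact interval inside \<open>J\<close>, on which the primitive is continuous.\<close>
    have "\<exists>s1\<in>J. \<exists>S. open S \<and> s \<in> S \<and> s \<le> s1 \<and> J \<inter> S - {s} = {V..s1} \<inter> S - {s}"
    proof (cases "\<exists>s1\<in>J. s < s1")
      case True
      then obtain s1 where s1: "s1 \<in> J" "s < s1" by blast
      have "J \<inter> {..<s1} - {s} = {V..s1} \<inter> {..<s1} - {s}" using J2[OF s1(1)] JV by auto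
      then show ?thesis using s1 by (intro bexI[of _ s1] exI[of _ "{..<s1}"]) auto
    next
      case False
      then have "J \<inter> UNIV - {s} = {V..s} \<inter> UNIV - {s}" using J2[OF s] JV by force
      then show ?thesis using s by (intro bexI[of _ s] exI[of _ UNIV]) auto
    qed
    then obtain s1 S where s1: "s1 \<in> J" "s \<le> s1" and S: "open S" "s \<in> S" "J \<inter> S - {s} = {V..s1} \<inter> S - {s}" by blast
    have "continuous_on {V..s1} (\<lambda>s. integral {V..s} (\<lambda>s. \<phi> s * w s))"
      using \<phi>int[OF \<phi> s1(1)] by (rule indefinite_integral_continuous_1)
    then have "continuous (at s within {V..s1}) (\<lambda>s. integral {V..s} (\<lambda>s. \<phi> s * w s))"
      using s1 s JV by (simp add: continuous_on_eq_continuous_within)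
    moreover have "at s within J = at s within {V..s1}" using S(2,1,3) by (rule at_within_nhd)
    ultimately show "continuous (at s within J) (\<lambda>s. integral {V..s} (\<lambda>s. \<phi> s * w s))" by simp
  qed
  have Mcont: "continuous_on J M" unfolding M_def[abs_def] by (rule \<phi>cont[OF c1])
  have Mless: "M r < M s" if "s \<in> J" "V \<le> r" "r < s" for r s
  proof -
    have i: "(\<lambda>s. (s - V) * w s) integrable_on {V..s}" using \<phi>int[OF c1 that(1)] .
    have "0 < integral {r..s} (\<lambda>s. (s - V) * w s)"
    proof (rule integral_pos_open[OF that(3)])
      show "continuous_on {r<..<s} (\<lambda>s. (s - V) * w s)"
        using w(1) that JV[OF that(1)] Vb by (intro continuous_intros) (auto intro: continuous_on_subset)
      show "0 < (y - V) * w y" if "y \<in> {r<..<s}" for y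
        using that \<open>V \<le> r\<close> JV[OF \<open>s \<in> J\<close>] Vb w(2)[of y] by auto
      show "(\<lambda>s. (s - V) * w s) integrable_on {r..s}"
        using integrable_subinterval_real[OF i] that by auto
    qed
    moreover have "M r + integral {r..s} (\<lambda>s. (s - V) * w s) = M s"
      unfolding M_def using that i by (intro Henstock_Kurzweil_Integration.integral_combine) auto
    ultimately show ?thesis by simp
  qed
  have Mle: "M r \<le> M s" if "s \<in> J" "V \<le> r" "r \<le> s" for r s
    using Mless[of s r] that by (cases "r = s") auto
  have MV: "M V = 0" by (simp add: M_def)
  define D where "D m = {s\<in>J. M s \<le> m}" for m
  \<comment> \<open>\<open>M\<close> is strictly increasing, so \<open>q\<close> inverts it as long
    as \<open>m\<close> is a value of \<open>M\<close> and stays at \<open>b\<close>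
    afterwards.\<close>
  define q where "q m = Sup (D m)" for m
  have DV: "V \<in> D m" if "0 \<le> m" for m using VJ MV that by (simp add: D_def)
  have Dbdd: "bdd_above (D m)" for m using JV by (auto simp: D_def intro!: bdd_aboveI[of _ b])
  have Dq: "s \<le> q m" if "s \<in> D m" for s m unfolding q_def using that Dbdd by (rule cSup_upper)
  have cover: "\<exists>s1\<in>J. D m \<subseteq> {V..s1}" for m
  proof (cases "b \<in> J")
    case True
    then show ?thesis using JV by (intro bexI[of _ b]) (auto simp: D_def)
  next
    case False
    \<comment> \<open>If \<open>M\<close> stayed below \<open>m\<close>, the first moment would be
      integrable up to \<open>b\<close>. On \<open>{v..b}\<close>, away from \<open>V\<close>, the
      factor \<open>s - V\<close> is bounded below, so \<open>w\<close> itself would be integrable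
      up to \<open>b\<close>, contradicting \<open>b \<notin> J\<close>.\<close>
    have "\<exists>s1\<in>J. m < M s1"
    proof (rule ccontr)
      assume "\<not> ?thesis"
      then have le: "M s \<le> m" if "V \<le> s" "s < b" for s using J1[OF that] by force
      define v where "v = (V + b) / 2"
      have v: "V < v" "v < b" using Vb by (auto simp: v_def)
      have "(\<lambda>s. (s - V) * w s) integrable_on {V..b}"
        by (rule integrable_on_bounded_integrals[where C = m, OF Vb(1)])
          (use le w Vb in \<open>auto simp: M_def less_imp_le intro!: continuous_intros mult_nonneg_nonneg intro: continuous_on_subset\<close>)
      then have i1: "(\<lambda>s. (s - V) * w s) integrable_on {v..b}"
        using v by (auto intro: integrable_subinterval_real)
      have "w integrable_on {v..b}"
      proof (rule integrable_dominated)
        show "(\<lambda>s. 1 / (v - V) * ((s - V) * w s)) integrable_on {v..b}" using integrable_on_mult_right[OF i1] .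
        show "continuous_on {v<..<b} w" using w(1) v Vb by (auto intro: continuous_on_subset)
        fix s assume s: "s \<in> {v<..<b}"
        then have ws: "w s > 0" using w(2)[of s] v Vb by auto
        have "1 \<le> (s - V) / (v - V)" using s v by simp
        then have "1 * w s \<le> (s - V) / (v - V) * w s" using ws by (intro mult_right_mono) auto
        then show "\<bar>w s\<bar> \<le> 1 / (v - V) * ((s - V) * w s)" using ws by simp
      qed
      moreover have "w integrable_on {V..v}" using J1[of v] v by (simp add: J_def)
      ultimately have "w integrable_on {V..b}"
        using v by (intro Henstock_Kurzweil_Integration.integrable_combine[of V v b]) auto
      then show False using False Vb by (simp add: J_def)
    qed
    then obtain s1 where s1: "s1 \<in> J" "m < M s1" by blast
    have "s \<le> s1" if "s \<in> D m" for s
      using Mle[of s s1] that s1 JV[OF s1(1)] by (force simp: D_def)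
    then show ?thesis using s1 JV by (intro bexI[of _ s1]) (auto simp: D_def)
  qed
  have qD: "q m \<in> D m" if m: "0 \<le> m" for m
  proof -
    obtain s1 where s1: "s1 \<in> J" "D m \<subseteq> {V..s1}" using cover by blast
    have sub: "{V..s1} \<subseteq> J" using J2[OF s1(1)] by auto
    have "closed {s\<in>{V..s1}. M s \<in> {..m}}"
      using continuous_on_subset[OF Mcont sub] by (intro continuous_closed_preimage[unfolded vimage_def Int_def, simplified]) auto
    moreover have "{s\<in>{V..s1}. M s \<in> {..m}} = D m" using s1 sub by (auto simp: D_def)
    ultimately show ?thesis unfolding q_def using DV[OF m] Dbdd by (intro closed_contains_Sup) auto
  qed
  have qJ: "q m \<in> J" and Mq: "M (q m) \<le> m" if "0 \<le> m" for m using qD[OF that] by (auto simp: D_def)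
  have qV: "V \<le> q m" "q m \<le> b" if "0 \<le> m" for m using JV[OF qJ[OF that]] .
  have clip: "q m = b" if m: "0 \<le> m" "M (q m) < m" for m
  proof (rule ccontr)
    assume "q m \<noteq> b"
    then have qb: "q m < b" using qV[OF m(1)] by simp
    define s where "s = (q m + b) / 2"
    have s: "q m < s" "s < b" using qb by (auto simp: s_def)
    then have sJ: "s \<in> J" using J1[of s] qV[OF m(1)] by simp
    show False
    proof (cases "M s \<le> m")
      case True
      then show False using Dq[of s m] sJ s by (simp add: D_def)
    next
      case False
      have sub: "{q m..s} \<subseteq> J" using J2[OF sJ] qV[OF m(1)] by auto
      have "\<exists>s'\<ge>q m. s' \<le> s \<and> M s' = m"
        by (rule IVT') (use m False s continuous_on_subset[OF Mcont sub] in auto)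
      then obtain s' where s': "q m \<le> s'" "s' \<le> s" "M s' = m" by blast
      then have "s' \<le> q m" using Dq[of s' m] sub by (auto simp: D_def)
      then show False using s' m by auto
    qed
  qed
  have qmono: "q m \<le> q m'" if "0 \<le> m" "m \<le> m'" for m m'
    using qD[OF that(1)] that(2) by (intro Dq) (auto simp: D_def)
  have qM: "q (M s) = s" if s: "s \<in> J" for s
  proof (rule antisym)
    have M0: "0 \<le> M s" using Mle[OF s, of V] JV[OF s] MV by simp
    show "s \<le> q (M s)" using s by (intro Dq) (simp add: D_def)
    show "q (M s) \<le> s"
    proof (rule ccontr)
      assume "\<not> ?thesis"
      then have "M s < M (q (M s))" using JV[OF s] by (intro Mless qJ M0) auto
      then show False using Mq[OF M0] by simp
    qed
  qed
  have M0: "0 \<le> M s" if "s \<in> J" for s using Mle[OF that, of V] JV[OF that] MV by simp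
  \<comment> \<open>A monotone function that takes every value in \<open>J\<close> cannot
    jump.\<close>
  have qcont: "continuous_on {0..} q"
    unfolding continuous_on_iff
  proof (intro ballI allI impI)
    fix m e :: real assume m: "m \<in> {0..}" and e: "0 < e"
    define s0 where "s0 = q m"
    have m0: "0 \<le> m" using m by simp
    have "\<exists>d>0. \<forall>m'\<ge>0. m' < m + d \<longrightarrow> q m' < s0 + e"
    proof (cases "s0 < b")
      case True
      define s1 where "s1 = (s0 + min b (s0 + e)) / 2"
      have s1: "s0 < s1" "s1 < b" "s1 < s0 + e" using True e by (auto simp: s1_def min_def)
      have s1J: "s1 \<in> J" using J1[of s1] s1 qV[OF m0] by (simp add: s0_def)
      have "\<not> M s1 \<le> m" using Dq[of s1 m] s1 s1J by (auto simp: D_def s0_def)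
      moreover have "q m' \<le> s1" if "0 \<le> m'" "m' < M s1" for m'
        using qmono[of m' "M s1"] qM[OF s1J] that by simp
      ultimately show ?thesis using s1 by (intro exI[of _ "M s1 - m"]) force
    next
      case False
      then show ?thesis using qV(2) e by (intro exI[of _ 1]) force
    qed
    then obtain d1 where d1: "d1 > 0" "\<And>m'. 0 \<le> m' \<Longrightarrow> m' < m + d1 \<Longrightarrow> q m' < s0 + e" by blast
    have "\<exists>d>0. \<forall>m'\<ge>0. m - d < m' \<longrightarrow> s0 - e < q m'"
    proof (cases "V < s0")
      case True
      define s1 where "s1 = (s0 + max V (s0 - e)) / 2"
      have s1: "V < s1" "s1 < s0" "s0 - e < s1" using True e by (auto simp: s1_def max_def)
      have s1J: "s1 \<in> J" using J2[OF qJ[OF m0], of s1] s1 by (simp add: s0_def)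
      have "M s1 < m" using Mless[OF qJ[OF m0], of s1] s1 Mq[OF m0] by (simp add: s0_def)
      moreover have "s0 - e < q m'" if "M s1 < m'" for m'
        using qmono[OF M0[OF s1J] less_imp_le[OF that]] qM[OF s1J] s1 by simp
      ultimately show ?thesis by (intro exI[of _ "m - M s1"]) simp
    next
      case False
      then show ?thesis using qV(1) e by (intro exI[of _ 1]) force
    qed
    then obtain d2 where d2: "d2 > 0" "\<And>m'. 0 \<le> m' \<Longrightarrow> m - d2 < m' \<Longrightarrow> s0 - e < q m'" by blast
    show "\<exists>d>0. \<forall>m'\<in>{0..}. dist m' m < d \<longrightarrow> dist (q m') (q m) < e"
    proof (intro exI[of _ "min d1 d2"] conjI ballI impI)
      fix m' assume "m' \<in> {0..}" "dist m' m < min d1 d2"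
      then have "q m' < s0 + e" "s0 - e < q m'" using d1(2)[of m'] d2(2)[of m'] by (auto simp: dist_real_def)
      then show "dist (q m') (q m) < e" by (simp add: dist_real_def s0_def abs_less_iff)
    qed (use d1 d2 in auto)
  qed
  show thesis
  proof (rule that)
    show "q m \<in> {V..b}" if "0 \<le> m" for m using qV[OF that] by simp
    show "V < q m" if m: "0 < m" for m
      using clip[of m] MV qV(1)[of m] Vb m by (cases "q m = V") auto
    show "q 0 = V" using qM[OF VJ] MV by simp
    show "w integrable_on {V..q m}" if "0 \<le> m" for m using qJ[OF that] by (simp add: J_def)
    show "integral {V..q m} (\<lambda>s. (s - V) * w s) \<le> m" if "0 \<le> m" for m using Mq[OF that] by (simp add: M_def)
    show "q m = b" if "0 \<le> m" "integral {V..q m} (\<lambda>s. (s - V) * w s) < m" for m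
      using clip[OF that(1)] that(2) by (simp add: M_def)
    show "integral {V..q m'} (\<lambda>s. (s - V) * w s) = m'"
      if m: "0 \<le> m'" "m' \<le> m" "integral {V..q m} (\<lambda>s. (s - V) * w s) = m" for m m'
    proof (rule ccontr)
      assume "\<not> ?thesis"
      then have lt: "M (q m') < m'" using Mq[OF m(1)] by (simp add: M_def)
      have "q m \<le> q m'" using clip[OF m(1) lt] qV(2)[of m] m by simp
      then have "M (q m) \<le> M (q m')" using m qV by (intro Mle qJ) auto
      then show False using lt m by (simp add: M_def)
    qed
    show "\<exists>m>0. q m = b \<and> integral {V..q m} (\<lambda>s. (s - V) * w s) = m" if "b < B"
    proof -
      have bJ: "b \<in> J"
        using that Vb w(1) by (auto simp: J_def intro!: integrable_continuous_real intro: continuous_on_subset)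
      have "0 < M b" using Mless[OF bJ, of V] Vb MV by simp
      then show ?thesis using qM[OF bJ] by (intro exI[of _ "M b"]) (simp add: M_def)
    qed
    show "\<exists>m0\<ge>0. \<forall>m\<ge>m0. y \<le> q m" if "y \<in> {V..<b}" for y
    proof -
      have yJ: "y \<in> J" using J1[of y] that by auto
      then show ?thesis using qmono[OF M0[OF yJ]] qM[OF yJ] M0[OF yJ] by (intro exI[of _ "M y"]) auto
    qed
    show "continuous_on {0..} q" by (rule qcont)
    show "continuous_on {0..} (\<lambda>m. integral {V..q m} (\<lambda>s. \<phi> s * w s))" if "continuous_on {V..b} \<phi>" for \<phi>
      using continuous_on_compose2[OF \<phi>cont[OF that] qcont] qJ by auto
  qed
qed

section \<open>Chords of a convex function\<close>

definition chord :: "(real \<Rightarrow> real) \<Rightarrow> real \<Rightarrow> real \<Rightarrow> real \<Rightarrow> real" where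
  "chord g p q s = g p + (g q - g p) / (q - p) * (s - p)"

lemma chord_weighted: "p < q \<Longrightarrow> (q - p) * chord g p q s = (q - s) * g p + (s - p) * g q"
  by (simp add: chord_def field_simps)

lemma continuous_on_chord: "continuous_on S (chord g p q)"
  unfolding chord_def
  by (intro continuous_on_add continuous_on_mult continuous_on_diff continuous_on_const continuous_on_id)

lemma convex_on_three_points:
  fixes g :: "real \<Rightarrow> real"
  assumes "convex_on S g" "x \<in> S" "z \<in> S" "x \<le> y" "y \<le> z"
  shows "(z - x) * g y \<le> (z - y) * g x + (y - x) * g z"
proof (cases "x = z")
  case False
  then have xz: "x < z" using assms by simp
  define t where "t = (y - x) / (z - x)"
  have t: "0 \<le> t" "t \<le> 1" using assms xz by (auto simp: t_def)
  have tz: "t * (z - x) = y - x" using xz by (simp add: t_def)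
  have y: "(1 - t) *\<^sub>R x + t *\<^sub>R z = y" using tz by (simp add: algebra_simps)
  have "g y \<le> (1 - t) * g x + t * g z"
    using convex_onD[OF assms(1) t assms(2,3)] unfolding y .
  then have "(z - x) * g y \<le> (z - x) * ((1 - t) * g x + t * g z)" using xz by (intro mult_left_mono) auto
  also have "\<dots> = ((z - x) - t * (z - x)) * g x + t * (z - x) * g z" by (simp add: algebra_simps)
  also have "\<dots> = (z - y) * g x + (y - x) * g z" unfolding tz by simp
  finally show ?thesis .
qed (use assms in auto)

lemma chord_above:
  assumes "convex_on S g" "p \<in> S" "q \<in> S" "p < q" "s \<in> {p..q}"
  shows "g s \<le> chord g p q s"
proof -
  have "(q - p) * g s \<le> (q - p) * chord g p q s"
    using convex_on_three_points[OF assms(1-3), of s] assms(4,5) by (simp add: chord_weighted)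
  then show ?thesis using assms(4) by simp
qed

lemma chord_below:
  assumes g: "convex_on S g" and "p \<in> S" "q \<in> S" "s \<in> S" "p < q" "s < p \<or> q < s"
  shows "chord g p q s \<le> g s"
proof -
  have "(q - s) * g p + (s - p) * g q \<le> (q - p) * g s"
    using assms(6)
  proof
    assume "s < p"
    then show ?thesis
      using convex_on_three_points[OF g assms(4,3), of p] assms(5) by (simp add: algebra_simps)
  next
    assume "q < s"
    then show ?thesis
      using convex_on_three_points[OF g assms(2,4), of q] assms(5) by (simp add: algebra_simps)
  qed
  then have "(q - p) * chord g p q s \<le> (q - p) * g s" using assms(5) by (simp add: chord_weighted)
  then show ?thesis using assms(5) by simp
qed

text \<open>With equal moments on both sides of \<open>V\<close> the balance equation holds for
  every \<open>m\<close>, and one scalar condition remains: the weighted area between line and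
  \<open>g\<close> must be \<alpha>. For small \<open>m\<close> the chord area
  \<open>\<psi> m\<close> is too small; either it reaches \<alpha> later, or an end of
  \<open>{a..b}\<close> blocks the growth and the line must rise above the chord.\<close>

lemma optimal_line:
  fixes g w :: "real \<Rightarrow> real"
  assumes ord: "A \<le> a" "a < V" "V < b" "b \<le> B"
    and w: "continuous_on {A<..<B} w" "\<And>s. s \<in> {A<..<B} \<Longrightarrow> 0 < w s"
    and g: "continuous_on {A..B} g" "convex_on {A..B} g" and \<alpha>: "0 < \<alpha>"
    and excess: "a = A \<Longrightarrow> b = B \<Longrightarrow> \<exists>p0 q0. A < p0 \<and> p0 < q0 \<and> q0 < B \<and>
      \<alpha> < integral {p0..q0} (\<lambda>s. (chord g A B s - g s) * w s)"
  obtains p q c lam \<tau>0 \<tau>1 where "a \<le> p" "p < V" "V < q" "q \<le> b" "w integrable_on {p..q}"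
    "0 \<le> \<tau>0" "0 \<le> \<tau>1" "\<tau>0 > 0 \<Longrightarrow> p = A" "\<tau>1 > 0 \<Longrightarrow> q = B"
    "\<And>s. s \<in> {a..b} \<Longrightarrow> s < p \<or> q < s \<Longrightarrow> c + lam * (s - V) \<le> g s"
    "\<And>s. s \<in> {p..q} \<Longrightarrow> g s \<le> c + lam * (s - V)"
    "a = A \<Longrightarrow> c + lam * (A - V) \<le> g A" "b = B \<Longrightarrow> c + lam * (B - V) \<le> g B"
    "integral {p..q} (\<lambda>s. (c + lam * (s - V) - g s) * w s) = \<alpha>"
    "integral {p..q} (\<lambda>s. (s - V) * w s) + \<tau>1 * (B - V) - \<tau>0 * (V - A) = 0"
proof -
  note conclude = that
  have ABV: "A < V" "V < B" using ord by auto
  have g': "continuous_on {a..b} g" using g(1) ord by (auto intro: continuous_on_subset)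
  have wR: "continuous_on {V..<B} w" "\<And>s. s \<in> {V..<B} \<Longrightarrow> 0 < w s"
    using w ord by (auto intro: continuous_on_subset)
  \<comment> \<open>The left half is obtained from the right one by the reflection of speeds in 0:
    \<open>clipped_path\<close> is applied to \<open>w (- s)\<close>, and \<open>p\<close> is minus
    the resulting path \<open>r\<close>.\<close>
  have wL: "continuous_on {- V..<- A} (\<lambda>s. w (- s))" "\<And>s. s \<in> {- V..<- A} \<Longrightarrow> 0 < w (- s)"
    using ord by (auto intro!: w(2) continuous_on_compose2[OF w(1)] continuous_intros)
  obtain q where q: "\<And>m. 0 \<le> m \<Longrightarrow> q m \<in> {V..b}" "\<And>m. 0 < m \<Longrightarrow> V < q m" "q 0 = V"
    "\<And>m. 0 \<le> m \<Longrightarrow> w integrable_on {V..q m}"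
    "\<And>m. 0 \<le> m \<Longrightarrow> integral {V..q m} (\<lambda>s. (s - V) * w s) \<le> m"
    "\<And>m. 0 \<le> m \<Longrightarrow> integral {V..q m} (\<lambda>s. (s - V) * w s) < m \<Longrightarrow> q m = b"
    "\<And>m m'. 0 \<le> m' \<Longrightarrow> m' \<le> m \<Longrightarrow> integral {V..q m} (\<lambda>s. (s - V) * w s) = m \<Longrightarrow>
      integral {V..q m'} (\<lambda>s. (s - V) * w s) = m'"
    "b < B \<Longrightarrow> \<exists>m>0. q m = b \<and> integral {V..q m} (\<lambda>s. (s - V) * w s) = m"
    "\<And>y. y \<in> {V..<b} \<Longrightarrow> \<exists>m0\<ge>0. \<forall>m\<ge>m0. y \<le> q m"
    "continuous_on {0..} q"
    "\<And>\<phi>. continuous_on {V..b} \<phi> \<Longrightarrow> continuous_on {0..} (\<lambda>m. integral {V..q m} (\<lambda>s. \<phi> s * w s))"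
    using clipped_path[OF ord(3,4) wR] by blast
  have "- V < - a" "- a \<le> - A" using ord by auto
  then obtain r where r: "\<And>m. 0 \<le> m \<Longrightarrow> r m \<in> {- V..- a}" "\<And>m. 0 < m \<Longrightarrow> - V < r m" "r 0 = - V"
    "\<And>m. 0 \<le> m \<Longrightarrow> (\<lambda>s. w (- s)) integrable_on {- V..r m}"
    "\<And>m. 0 \<le> m \<Longrightarrow> integral {- V..r m} (\<lambda>s. (s - - V) * w (- s)) \<le> m"
    "\<And>m. 0 \<le> m \<Longrightarrow> integral {- V..r m} (\<lambda>s. (s - - V) * w (- s)) < m \<Longrightarrow> r m = - a"
    "\<And>m m'. 0 \<le> m' \<Longrightarrow> m' \<le> m \<Longrightarrow> integral {- V..r m} (\<lambda>s. (s - - V) * w (- s)) = m \<Longrightarrow>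
      integral {- V..r m'} (\<lambda>s. (s - - V) * w (- s)) = m'"
    "- a < - A \<Longrightarrow> \<exists>m>0. r m = - a \<and> integral {- V..r m} (\<lambda>s. (s - - V) * w (- s)) = m"
    "\<And>y. y \<in> {- V..<- a} \<Longrightarrow> \<exists>m0\<ge>0. \<forall>m\<ge>m0. y \<le> r m"
    "continuous_on {0..} r"
    "\<And>\<phi>. continuous_on {- V..- a} \<phi> \<Longrightarrow> continuous_on {0..} (\<lambda>m. integral {- V..r m} (\<lambda>s. \<phi> s * w (- s)))"
    using clipped_path[OF _ _ wL] by blast
  define p where "p m = - r m" for m
  have r_eq: "r m = - p m" for m by (simp add: p_def)
  have reflect: "integral {- V..r m} (\<lambda>s. \<phi> (- s) * w (- s)) = integral {p m..V} (\<lambda>s. \<phi> s * w s)" for \<phi> m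
    unfolding r_eq using Henstock_Kurzweil_Integration.integral_reflect_real[of V "p m" "\<lambda>s. \<phi> s * w s"] by simp
  have reflect1: "integral {- V..r m} (\<lambda>s. (s - - V) * w (- s)) = integral {p m..V} (\<lambda>s. (V - s) * w s)" for m
    using reflect[of m "\<lambda>s. V - s"] by (simp add: add.commute)
  have p: "\<And>m. 0 \<le> m \<Longrightarrow> p m \<in> {a..V}" "\<And>m. 0 < m \<Longrightarrow> p m < V" "p 0 = V"
    "\<And>m. 0 \<le> m \<Longrightarrow> w integrable_on {p m..V}"
    "\<And>m. 0 \<le> m \<Longrightarrow> integral {p m..V} (\<lambda>s. (V - s) * w s) \<le> m"
    "\<And>m. 0 \<le> m \<Longrightarrow> integral {p m..V} (\<lambda>s. (V - s) * w s) < m \<Longrightarrow> p m = a"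
    "\<And>m m'. 0 \<le> m' \<Longrightarrow> m' \<le> m \<Longrightarrow> integral {p m..V} (\<lambda>s. (V - s) * w s) = m \<Longrightarrow>
      integral {p m'..V} (\<lambda>s. (V - s) * w s) = m'"
    "A < a \<Longrightarrow> \<exists>m>0. p m = a \<and> integral {p m..V} (\<lambda>s. (V - s) * w s) = m"
    "continuous_on {0..} p"
  proof -
    note r' = r(5-8)[unfolded reflect1]
    show "p m \<in> {a..V}" if "0 \<le> m" for m using r(1)[OF that] by (auto simp: p_def)
    show "p m < V" if "0 < m" for m using r(2)[OF that] by (simp add: p_def)
    show "p 0 = V" using r(3) by (simp add: p_def)
    show "w integrable_on {p m..V}" if "0 \<le> m" for m
      using r(4)[OF that] unfolding r_eq Henstock_Kurzweil_Integration.integrable_reflect_real .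
    show "integral {p m..V} (\<lambda>s. (V - s) * w s) \<le> m" if "0 \<le> m" for m using r'(1)[OF that] .
    show "p m = a" if "0 \<le> m" "integral {p m..V} (\<lambda>s. (V - s) * w s) < m" for m
      using r'(2)[OF that] by (simp add: p_def)
    show "integral {p m'..V} (\<lambda>s. (V - s) * w s) = m'"
      if "0 \<le> m'" "m' \<le> m" "integral {p m..V} (\<lambda>s. (V - s) * w s) = m" for m m'
      using r'(3)[OF that] .
    show "\<exists>m>0. p m = a \<and> integral {p m..V} (\<lambda>s. (V - s) * w s) = m" if Aa: "A < a"
    proof -
      have "- a < - A" using Aa by simp
      then obtain m where "m > 0" "r m = - a" "integral {p m..V} (\<lambda>s. (V - s) * w s) = m" using r'(4) by blast
      then show ?thesis by (intro exI[of _ m]) (simp add: p_def)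
    qed
    show "continuous_on {0..} p" unfolding p_def using r(10) by (rule continuous_on_minus)
  qed
  have p_tail: "\<exists>m0\<ge>0. \<forall>m\<ge>m0. p m \<le> y" if "y \<in> {a<..V}" for y
    using r(9)[of "- y"] that by (auto simp: r_eq)
  have p_int: "continuous_on {0..} (\<lambda>m. integral {p m..V} (\<lambda>s. \<phi> s * w s))" if "continuous_on {a..V} \<phi>" for \<phi>
  proof -
    have "continuous_on {- V..- a} (\<lambda>s. \<phi> (- s))"
      by (rule continuous_on_compose2[OF that]) (auto intro: continuous_intros)
    from r(11)[OF this] show ?thesis unfolding reflect .
  qed
  have wsub: "continuous_on {l<..<u} w" "\<And>s. s \<in> {l<..<u} \<Longrightarrow> 0 \<le> w s" "\<And>s. s \<in> {l<..<u} \<Longrightarrow> 0 < w s"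
    if "A \<le> l" "u \<le> B" for l u
    using w that by (auto intro: continuous_on_subset less_imp_le)
  have w_int: "w integrable_on {p m..q m}" if "0 \<le> m" for m
    using p(1,4)[OF that] q(1,4)[OF that] by (intro Henstock_Kurzweil_Integration.integrable_combine[of "p m" V "q m"]) auto
  have pq: "A \<le> p m" "p m < V" "V < q m" "q m \<le> B" "p m < q m" "a \<le> p m" "q m \<le> b"
    "p m \<in> {A..B}" "q m \<in> {A..B}" if "0 < m" for m
    using p(1)[of m] p(2)[of m] q(1)[of m] q(2)[of m] ord that by auto
  have \<phi>w_int: "(\<lambda>s. \<phi> s * w s) integrable_on {p m..q m}" if "continuous_on {a..b} \<phi>" "0 \<le> m" for \<phi> m
    using that(1) wsub[of "p m" "q m"] p(1)[OF that(2)] q(1)[OF that(2)] ord w_int[OF that(2)]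
    by (intro integrable_times_weight) (auto intro: continuous_on_subset)
  have split: "integral {p m..q m} (\<lambda>s. \<phi> s * w s) = integral {p m..V} (\<lambda>s. \<phi> s * w s) + integral {V..q m} (\<lambda>s. \<phi> s * w s)"
    if "continuous_on {a..b} \<phi>" "0 \<le> m" for \<phi> m
    using p(1)[OF that(2)] q(1)[OF that(2)]
    by (intro Henstock_Kurzweil_Integration.integral_combine[symmetric] \<phi>w_int that) auto
  have Icont: "continuous_on {0..} (\<lambda>m. integral {p m..q m} (\<lambda>s. \<phi> s * w s))" if \<phi>: "continuous_on {a..b} \<phi>" for \<phi>
  proof -
    have "continuous_on {0..} (\<lambda>m. integral {p m..V} (\<lambda>s. \<phi> s * w s) + integral {V..q m} (\<lambda>s. \<phi> s * w s))"
      using \<phi> ord by (intro continuous_intros p_int q(11)) (auto intro: continuous_on_subset)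
    then show ?thesis by (subst continuous_on_cong[OF refl split[OF \<phi>]]) auto
  qed
  define \<psi> where "\<psi> m = integral {p m..q m} (\<lambda>s. (chord g (p m) (q m) s - g s) * w s)" for m
  have \<psi>_int: "(\<lambda>s. (chord g (p m) (q m) s - g s) * w s) integrable_on {p m..q m}" if "0 < m" for m
    using that g' by (intro \<phi>w_int continuous_on_diff continuous_on_chord) auto
  have \<psi>_nonneg: "0 \<le> (chord g (p m) (q m) s - g s) * w s" if "0 < m" "s \<in> {p m<..<q m}" for m s
    using chord_above[OF g(2) pq(8,9)[OF that(1)] pq(5)[OF that(1)], of s] that wsub(2)[OF pq(1,4)[OF that(1)] that(2)]
    by simp
  define \<sigma> where "\<sigma> m = (g (q m) - g (p m)) / (q m - p m)" for m
  \<comment> \<open>The chord in the integrand moves with \<open>m\<close>. Expanding it leaves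
    integrals with integrands independent of \<open>m\<close>, whose continuity is
    \<open>Icont\<close>.\<close>
  have \<psi>_eq: "\<psi> m = (g (p m) - \<sigma> m * p m) * integral {p m..q m} (\<lambda>s. 1 * w s)
      + \<sigma> m * integral {p m..q m} (\<lambda>s. s * w s) - integral {p m..q m} (\<lambda>s. g s * w s)" if "0 < m" for m
  proof -
    have "\<psi> m = integral {p m..q m} (\<lambda>s. (g (p m) - \<sigma> m * p m) * (1 * w s) + \<sigma> m * (s * w s) - g s * w s)"
      unfolding \<psi>_def chord_def \<sigma>_def[symmetric] by (rule integral_cong) (simp add: algebra_simps)
    also have "\<dots> = (g (p m) - \<sigma> m * p m) * integral {p m..q m} (\<lambda>s. 1 * w s)
        + \<sigma> m * integral {p m..q m} (\<lambda>s. s * w s) - integral {p m..q m} (\<lambda>s. g s * w s)"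
      using \<phi>w_int[of "\<lambda>_. 1" m] \<phi>w_int[of "\<lambda>s. s" m] \<phi>w_int[OF g', of m] that
      by (simp add: integral_diff integral_add integrable_add integrable_on_mult_right)
    finally show ?thesis .
  qed
  have \<psi>_cont: "continuous_on {0<..} \<psi>"
  proof -
    have pc: "continuous_on {0<..} p" "continuous_on {0<..} q"
      using p(9) q(10) by (auto intro: continuous_on_subset)
    have gp: "continuous_on {0<..} (\<lambda>m. g (p m))" "continuous_on {0<..} (\<lambda>m. g (q m))"
      using pq by (auto intro!: continuous_on_compose2[OF g(1)] pc)
    have Ic: "continuous_on {0<..} (\<lambda>m. integral {p m..q m} (\<lambda>s. \<phi> s * w s))" if "continuous_on {a..b} \<phi>" for \<phi>
      using Icont[OF that] by (rule continuous_on_subset) auto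
    have nz: "\<forall>m\<in>{0<..}. q m - p m \<noteq> 0" using pq(5) by force
    have "continuous_on {0<..} (\<lambda>m. (g (p m) - \<sigma> m * p m) * integral {p m..q m} (\<lambda>s. 1 * w s)
      + \<sigma> m * integral {p m..q m} (\<lambda>s. s * w s) - integral {p m..q m} (\<lambda>s. g s * w s))"
      unfolding \<sigma>_def by (intro continuous_intros Ic pc gp nz g')
    then show ?thesis by (subst continuous_on_cong[OF refl \<psi>_eq]) auto
  qed
  \<comment> \<open>At an end of \<open>{a..b}\<close> that is not an equilibrium no rest can make
    up for missing moment, so the full \<open>m\<close> must be spent there; at \<open>A\<close> and
    \<open>B\<close> a deficit is allowed.\<close>
  define good where "good m \<longleftrightarrow> (A < a \<longrightarrow> integral {p m..V} (\<lambda>s. (V - s) * w s) = m) \<and>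
      (b < B \<longrightarrow> integral {V..q m} (\<lambda>s. (s - V) * w s) = m)" for m
  have good_down: "good m'" if "good m" "0 \<le> m'" "m' \<le> m" for m m'
    using that p(7)[of m' m] q(7)[of m' m] by (auto simp: good_def)

  \<comment> \<open>The line is the chord plus the affine correction
    \<open>\<kappa>0 + \<kappa>1 * (s - V)\<close>. Its sign, nonnegative on
    \<open>{p m..q m}\<close> and nonpositive elsewhere, preserves the position of the chord
    relative to \<open>g\<close>.\<close>
  have finish: thesis
    if m: "0 < m" "good m"
      and \<kappa>: "\<And>s. s \<in> {p m..q m} \<Longrightarrow> 0 \<le> \<kappa>0 + \<kappa>1 * (s - V)"
        "\<And>s. s \<in> {a..b} \<Longrightarrow> s < p m \<or> q m < s \<Longrightarrow> \<kappa>0 + \<kappa>1 * (s - V) \<le> 0"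
        "p m = A \<Longrightarrow> \<kappa>0 + \<kappa>1 * (A - V) \<le> 0" "q m = B \<Longrightarrow> \<kappa>0 + \<kappa>1 * (B - V) \<le> 0"
        "integral {p m..q m} (\<lambda>s. (\<kappa>0 + \<kappa>1 * (s - V)) * w s) = \<alpha> - \<psi> m" for m \<kappa>0 \<kappa>1
  proof -
    define c where "c = chord g (p m) (q m) V + \<kappa>0"
    define lam where "lam = \<sigma> m + \<kappa>1"
    have line: "c + lam * (s - V) = chord g (p m) (q m) s + (\<kappa>0 + \<kappa>1 * (s - V))" for s
      unfolding c_def lam_def chord_def \<sigma>_def[symmetric] by (simp add: algebra_simps)
    \<comment> \<open>Resting at \<open>A\<close> contributes the moment \<open>V - A\<close> per
      unit of time, so the deficit divided by it is the resting time.\<close>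
    define \<tau>0 where "\<tau>0 = (m - integral {p m..V} (\<lambda>s. (V - s) * w s)) / (V - A)"
    define \<tau>1 where "\<tau>1 = (m - integral {V..q m} (\<lambda>s. (s - V) * w s)) / (B - V)"
    have below: "c + lam * (s - V) \<le> g s" if "s \<in> {a..b}" "s < p m \<or> q m < s" for s
      using chord_below[OF g(2) pq(8,9)[OF m(1)] _ pq(5)[OF m(1)] that(2)] \<kappa>(2)[OF that] that(1) ord
      by (force simp: line)
    show thesis
    proof (rule conclude[of "p m" "q m" \<tau>0 \<tau>1 c lam])
      show "0 \<le> \<tau>0" using p(5)[of m] m(1) ABV by (simp add: \<tau>0_def)
      show "0 \<le> \<tau>1" using q(5)[of m] m(1) ABV by (simp add: \<tau>1_def)
      show "p m = A" if "\<tau>0 > 0"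
      proof -
        have "integral {p m..V} (\<lambda>s. (V - s) * w s) < m" using that ABV by (simp add: \<tau>0_def zero_less_divide_iff)
        then show ?thesis using p(6)[of m] m ord by (auto simp: good_def)
      qed
      show "q m = B" if "\<tau>1 > 0"
      proof -
        have "integral {V..q m} (\<lambda>s. (s - V) * w s) < m" using that ABV by (simp add: \<tau>1_def zero_less_divide_iff)
        then show ?thesis using q(6)[of m] m ord by (auto simp: good_def)
      qed
      show "c + lam * (s - V) \<le> g s" if "s \<in> {a..b}" "s < p m \<or> q m < s" for s using below[OF that] .
      show "g s \<le> c + lam * (s - V)" if "s \<in> {p m..q m}" for s
        using chord_above[OF g(2) pq(8,9)[OF m(1)] pq(5)[OF m(1)] that] \<kappa>(1)[OF that] by (simp add: line)
      show "c + lam * (A - V) \<le> g A" if "a = A"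
      proof (cases "p m = A")
        case True
        then show ?thesis using \<kappa>(3) by (simp add: line chord_def)
      qed (use below[of A] pq(1)[OF m(1)] that ord in auto)
      show "c + lam * (B - V) \<le> g B" if "b = B"
      proof (cases "q m = B")
        case True
        then have "chord g (p m) (q m) B = g B" using pq(5)[OF m(1)] by (simp add: chord_def)
        then show ?thesis using \<kappa>(4) True by (simp add: line)
      qed (use below[of B] pq(4)[OF m(1)] that ord in auto)
      have "integral {p m..q m} (\<lambda>s. (c + lam * (s - V) - g s) * w s)
          = integral {p m..q m} (\<lambda>s. (chord g (p m) (q m) s - g s) * w s + (\<kappa>0 + \<kappa>1 * (s - V)) * w s)"
        unfolding line by (rule integral_cong) (simp add: algebra_simps)
      also have "\<dots> = \<psi> m + integral {p m..q m} (\<lambda>s. (\<kappa>0 + \<kappa>1 * (s - V)) * w s)"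
        unfolding \<psi>_def using m(1)
        by (intro integral_add \<psi>_int \<phi>w_int) (auto intro!: continuous_intros)
      also have "\<dots> = \<psi> m + (\<alpha> - \<psi> m)" by (simp only: \<kappa>(5))
      finally show "integral {p m..q m} (\<lambda>s. (c + lam * (s - V) - g s) * w s) = \<alpha>" by simp
      have "integral {p m..V} (\<lambda>s. (s - V) * w s) = - integral {p m..V} (\<lambda>s. (V - s) * w s)"
        by (subst integral_neg[symmetric]) (simp add: algebra_simps)
      then have "integral {p m..q m} (\<lambda>s. (s - V) * w s) =
          integral {V..q m} (\<lambda>s. (s - V) * w s) - integral {p m..V} (\<lambda>s. (V - s) * w s)"
        using split[of "\<lambda>s. s - V" m] m(1) by (simp add: continuous_intros)
      then show "integral {p m..q m} (\<lambda>s. (s - V) * w s) + \<tau>1 * (B - V) - \<tau>0 * (V - A) = 0"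
        using ABV by (simp add: \<tau>0_def \<tau>1_def)
    qed (use pq[OF m(1)] w_int[of m] m(1) in auto)
  qed

  \<comment> \<open>With \<open>G\<close> a bound for the modulus of \<open>g\<close>, chord minus
    \<open>g\<close> is at most \<open>2 * G\<close>, and the total weight \<open>Y m\<close> tends
    to 0 with \<open>m\<close>.\<close>
  have small: "\<exists>m>0. m < e \<and> \<psi> m < \<alpha>" if e: "0 < e" for e
  proof -
    obtain G where G: "\<And>s. s \<in> {A..B} \<Longrightarrow> \<bar>g s\<bar> \<le> G"
      using compact_imp_bounded[OF compact_continuous_image[OF g(1) compact_Icc]] unfolding bounded_real by force
    have G0: "0 \<le> G" using G[of V] ABV by auto
    define Y where "Y m = integral {p m..q m} (\<lambda>s. 1 * w s)" for m
    have Ycont: "continuous_on {0..} Y" unfolding Y_def[abs_def] by (rule Icont) simp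
    have Y0: "Y 0 = 0" by (simp add: Y_def p(3) q(3))
    have \<eta>: "0 < \<alpha> / (2 * G + 1)" using \<alpha> G0 by simp
    obtain d where d: "d > 0" "\<And>m. 0 \<le> m \<Longrightarrow> dist m 0 < d \<Longrightarrow> dist (Y m) (Y 0) < \<alpha> / (2 * G + 1)"
      using Ycont[unfolded continuous_on_iff] \<eta> by (metis atLeast_iff order_refl)
    define m where "m = min d e / 2"
    have m: "0 < m" "m < e" "dist m 0 < d" using d(1) e by (auto simp: m_def min_def)
    have Ym: "\<bar>Y m\<bar> < \<alpha> / (2 * G + 1)" using d(2)[of m] m Y0 by (simp add: dist_real_def)
    have Gw: "(\<lambda>s. 2 * G * (1 * w s)) integrable_on {p m<..<q m}"
      using \<phi>w_int[of "\<lambda>_. 1" m] m by (simp add: integrable_on_open_interval_real integrable_on_mult_right)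
    have "\<psi> m = integral {p m<..<q m} (\<lambda>s. (chord g (p m) (q m) s - g s) * w s)"
      by (simp add: \<psi>_def integral_open_interval_real)
    also have "\<dots> \<le> integral {p m<..<q m} (\<lambda>s. 2 * G * (1 * w s))"
    proof (rule integral_le[OF _ Gw])
      fix s assume s: "s \<in> {p m<..<q m}"
      have "(q m - p m) * chord g (p m) (q m) s \<le> (q m - s) * G + (s - p m) * G"
        unfolding chord_weighted[OF pq(5)[OF m(1)]]
        using s G[OF pq(8)[OF m(1)]] G[OF pq(9)[OF m(1)]] by (intro add_mono mult_left_mono) auto
      also have "\<dots> = (q m - p m) * G" by (simp add: algebra_simps)
      finally have "chord g (p m) (q m) s \<le> G" using pq(5)[OF m(1)] by simp
      moreover have "- G \<le> g s" using G[of s] s pq(1,4)[OF m(1)] by auto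
      ultimately have "(chord g (p m) (q m) s - g s) * w s \<le> (2 * G) * w s"
        using wsub(2)[OF pq(1,4)[OF m(1)] s] by (intro mult_right_mono) auto
      then show "(chord g (p m) (q m) s - g s) * w s \<le> 2 * G * (1 * w s)" by simp
    qed (use \<psi>_int[OF m(1)] in \<open>simp add: integrable_on_open_interval_real\<close>)
    also have "\<dots> = 2 * G * Y m"
      by (simp add: Y_def flip: integral_open_interval_real)
    also have "\<dots> \<le> 2 * G * (\<alpha> / (2 * G + 1))" using Ym G0 by (intro mult_left_mono) auto
    also have "\<dots> < \<alpha>" using \<alpha> G0 by (simp add: field_simps)
    finally show ?thesis using m by blast
  qed

  have exact: thesis if m2: "0 < m2" "good m2" "\<alpha> \<le> \<psi> m2" for m2
  proof -
    obtain m1 where m1: "0 < m1" "m1 < m2" "\<psi> m1 < \<alpha>" using small[OF m2(1)] by blast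
    have "\<exists>m\<ge>m1. m \<le> m2 \<and> \<psi> m = \<alpha>"
      by (rule IVT') (use m1 m2 in \<open>auto intro: continuous_on_subset[OF \<psi>_cont]\<close>)
    then obtain m where "m1 \<le> m" "m \<le> m2" "\<psi> m = \<alpha>" by blast
    then show thesis using finish[of m 0 0] good_down[OF m2(2), of m] m1 by auto
  qed

  have lift: thesis
    if m: "0 < m" "good m" "\<psi> m < \<alpha>"
      and \<kappa>: "\<And>s. s \<in> {p m<..<q m} \<Longrightarrow> 0 < \<kappa>0 + \<kappa>1 * (s - V)"
        "\<And>s. s \<in> {p m..q m} \<Longrightarrow> 0 \<le> \<kappa>0 + \<kappa>1 * (s - V)"
        "\<And>s. s \<in> {a..b} \<Longrightarrow> s < p m \<or> q m < s \<Longrightarrow> \<kappa>0 + \<kappa>1 * (s - V) \<le> 0"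
        "p m = A \<Longrightarrow> \<kappa>0 + \<kappa>1 * (A - V) \<le> 0" "q m = B \<Longrightarrow> \<kappa>0 + \<kappa>1 * (B - V) \<le> 0" for m \<kappa>0 \<kappa>1
  proof -
    define Y where "Y = integral {p m..q m} (\<lambda>s. (\<kappa>0 + \<kappa>1 * (s - V)) * w s)"
    have Yi: "(\<lambda>s. (\<kappa>0 + \<kappa>1 * (s - V)) * w s) integrable_on {p m..q m}"
      using m(1) by (intro \<phi>w_int) (auto intro!: continuous_intros)
    have Y: "Y > 0" unfolding Y_def
      by (rule integral_pos_open[OF pq(5)[OF m(1)] _ _ Yi])
        (use \<kappa>(1) wsub[OF pq(1,4)[OF m(1)]] in \<open>auto intro!: continuous_intros\<close>)
    \<comment> \<open>The sign conditions survive scaling by a positive factor; this factor makes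
      the correction supply exactly the missing area \<open>\<alpha> - \<psi> m\<close>.\<close>
    define \<mu> where "\<mu> = (\<alpha> - \<psi> m) / Y"
    have \<mu>: "\<mu> > 0" using Y m(3) by (simp add: \<mu>_def)
    have sc: "\<mu> * \<kappa>0 + \<mu> * \<kappa>1 * (s - V) = \<mu> * (\<kappa>0 + \<kappa>1 * (s - V))" for s by (simp add: algebra_simps)
    have "integral {p m..q m} (\<lambda>s. (\<mu> * \<kappa>0 + \<mu> * \<kappa>1 * (s - V)) * w s) = \<mu> * Y"
      unfolding Y_def by (subst integral_mult_right[symmetric]) (simp add: algebra_simps)
    also have "\<dots> = \<alpha> - \<psi> m" using Y by (simp add: \<mu>_def)
    finally show thesis
      by (intro finish[OF m(1,2), of "\<mu> * \<kappa>0" "\<mu> * \<kappa>1"]; unfold sc)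
        (use \<kappa> \<mu> in \<open>auto simp: mult_le_0_iff\<close>)
  qed

  \<comment> \<open>The correction is a multiple of \<open>q m - s\<close>: it turns the line about
    its point over \<open>q m\<close>, so nothing changes there even if \<open>q m = B\<close>, and
    raises it over \<open>a\<close>, to the left of which no speed is allowed.\<close>
  have lift_left: thesis if m: "0 < m" "good m" "\<psi> m < \<alpha>" and "A < a" "p m = a" for m
  proof (rule lift[OF m, of "q m - V" "-1"])
    show "q m - V + - 1 * (s - V) \<le> 0" if "s \<in> {a..b}" "s < p m \<or> q m < s" for s
      using that \<open>p m = a\<close> by auto
  qed (use that pq[OF m(1)] in auto)
  have lift_right: thesis if m: "0 < m" "good m" "\<psi> m < \<alpha>" and "b < B" "q m = b" for m
  proof (rule lift[OF m, of "V - p m" 1])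
    show "V - p m + 1 * (s - V) \<le> 0" if "s \<in> {a..b}" "s < p m \<or> q m < s" for s
      using that \<open>q m = b\<close> by auto
  qed (use that pq[OF m(1)] in auto)

  \<comment> \<open>On the full range both ends are equilibria and growth is never blocked. As
    \<open>m\<close> increases the chord comes close to the one over \<open>{A..B}\<close>, whose
    area exceeds \<alpha> already on an inner interval.\<close>
  have large: "\<exists>m>0. \<alpha> \<le> \<psi> m" if ab: "a = A" "b = B"
  proof -
    obtain p0 q0 where pq0: "A < p0" "p0 < q0" "q0 < B"
      "\<alpha> < integral {p0..q0} (\<lambda>s. (chord g A B s - g s) * w s)" using excess[OF ab] by blast
    have AB: "A < B" using ABV by simp
    define L where "L = chord g A B"
    define I0 where "I0 = integral {p0..q0} (\<lambda>s. (L s - g s) * w s)"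
    define W0 where "W0 = integral {p0..q0} w"
    have w0: "continuous_on {p0..q0} w" "\<And>s. s \<in> {p0..q0} \<Longrightarrow> 0 < w s"
      using w pq0 by (auto intro: continuous_on_subset)
    have g0: "continuous_on {p0..q0} g" using g(1) pq0 by (auto intro: continuous_on_subset)
    have Lc: "continuous_on S L" for S unfolding L_def chord_def by (intro continuous_intros)
    have W0: "0 \<le> W0" unfolding W0_def using w0 by (intro integral_nonneg integrable_continuous_real) (auto intro: less_imp_le)
    \<comment> \<open>Lowering the full chord by \<open>e\<close> over \<open>{p0..q0}\<close> loses
      the area \<open>e * W0\<close>, which must not exceed the surplus
      \<open>I0 - \<alpha>\<close>; the \<open>+ 1\<close> keeps the denominator positive.\<close>
    define e where "e = (I0 - \<alpha>) / (W0 + 1)"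
    have e: "0 < e" using pq0(4) W0 by (simp add: e_def I0_def L_def)
    have eW: "e * W0 \<le> I0 - \<alpha>" using W0 pq0(4) by (simp add: e_def field_simps I0_def L_def)
    have LA: "L A = g A" and LB: "L B = g B" using AB by (simp_all add: L_def chord_def)
    have gL: "continuous_on {A..B} (\<lambda>s. g s - L s)" by (intro continuous_intros g(1) Lc)
    obtain dA where dA: "dA > 0" "\<And>s. s \<in> {A..B} \<Longrightarrow> dist s A < dA \<Longrightarrow> dist (g s - L s) (g A - L A) < e"
      using gL[unfolded continuous_on_iff] e AB by (metis atLeastAtMost_iff order_refl less_imp_le)
    obtain dB where dB: "dB > 0" "\<And>s. s \<in> {A..B} \<Longrightarrow> dist s B < dB \<Longrightarrow> dist (g s - L s) (g B - L B) < e"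
      using gL[unfolded continuous_on_iff] e AB by (metis atLeastAtMost_iff order_refl less_imp_le)
    define yL where "yL = min (min p0 V) (A + dA / 2)"
    define yR where "yR = max (max q0 V) (B - dB / 2)"
    have yL: "yL \<in> {a<..V}" "yL \<le> p0" "yL < A + dA" using pq0 ABV dA(1) ab by (auto simp: yL_def)
    have yR: "yR \<in> {V..<b}" "q0 \<le> yR" "B - dB < yR" using pq0 ABV dB(1) ab by (auto simp: yR_def)
    obtain mL mR where mLR: "mL \<ge> 0" "\<And>m. mL \<le> m \<Longrightarrow> p m \<le> yL" "mR \<ge> 0" "\<And>m. mR \<le> m \<Longrightarrow> yR \<le> q m"
      using p_tail[OF yL(1)] q(9)[OF yR(1)] by blast
    define m where "m = mL + mR + 1"
    have m: "0 < m" "p m \<le> yL" "yR \<le> q m" using mLR by (auto simp: m_def)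
    note pqm = pq[OF m(1)]
    have sub: "p m \<le> p0" "q0 \<le> q m" using m yL yR by auto
    have gp: "- e < g (p m) - L (p m)"
      using dA(2)[of "p m"] pqm m yL LA by (auto simp: dist_real_def)
    have gq: "- e < g (q m) - L (q m)"
      using dB(2)[of "q m"] pqm m yR LB by (auto simp: dist_real_def)
    have chord_ge: "L s - e \<le> chord g (p m) (q m) s" if s: "s \<in> {p m..q m}" for s
    proof -
      define k where "k = (g B - g A) / (B - A)"
      have L_eq: "L y = g A + k * (y - A)" for y by (simp add: L_def chord_def k_def)
      have "(q m - p m) * L s = (q m - s) * L (p m) + (s - p m) * L (q m)"
        unfolding L_eq by (simp add: algebra_simps)
      then have "(q m - p m) * (L s - e) = (q m - s) * (L (p m) - e) + (s - p m) * (L (q m) - e)"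
        by (simp add: algebra_simps)
      also have "\<dots> \<le> (q m - s) * g (p m) + (s - p m) * g (q m)"
        using s gp gq by (intro add_mono mult_left_mono) auto
      also have "\<dots> = (q m - p m) * chord g (p m) (q m) s" by (simp add: chord_weighted pqm)
      finally show ?thesis using pqm by simp
    qed
    have "\<alpha> \<le> I0 - e * W0" using eW by simp
    also have "\<dots> = integral {p0..q0} (\<lambda>s. (L s - g s) * w s - e * w s)"
      unfolding I0_def W0_def using w0(1) g0 Lc
      by (subst integral_diff) (auto intro!: integrable_continuous_real continuous_intros)
    also have "\<dots> \<le> integral {p0..q0} (\<lambda>s. (chord g (p m) (q m) s - g s) * w s)"
    proof (rule integral_le)
      show "(\<lambda>s. (L s - g s) * w s - e * w s) integrable_on {p0..q0}"
        using w0(1) g0 Lc by (intro integrable_continuous_real continuous_intros)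
      show "(\<lambda>s. (chord g (p m) (q m) s - g s) * w s) integrable_on {p0..q0}"
        using w0(1) g0 unfolding chord_def by (intro integrable_continuous_real continuous_intros)
      fix s assume s: "s \<in> {p0..q0}"
      then have "(L s - e - g s) * w s \<le> (chord g (p m) (q m) s - g s) * w s"
        using chord_ge[of s] w0(2)[OF s] sub by (intro mult_right_mono) auto
      then show "(L s - g s) * w s - e * w s \<le> (chord g (p m) (q m) s - g s) * w s" by (simp add: algebra_simps)
    qed
    also have "\<dots> = integral {p0<..<q0} (\<lambda>s. (chord g (p m) (q m) s - g s) * w s)"
      by (rule integral_open_interval_real)
    also have "\<dots> \<le> integral {p m<..<q m} (\<lambda>s. (chord g (p m) (q m) s - g s) * w s)"
      using sub \<psi>_nonneg[OF m(1)] integrable_subinterval_real[OF \<psi>_int[OF m(1)], of p0 q0] \<psi>_int[OF m(1)]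
      by (intro integral_subset_le) (auto simp: integrable_on_open_interval_real)
    also have "\<dots> = \<psi> m" by (simp add: \<psi>_def integral_open_interval_real)
    finally show ?thesis using m(1) by blast
  qed

  show thesis
  proof (cases "\<exists>m>0. good m \<and> \<alpha> \<le> \<psi> m")
    case True
    then show thesis using exact by blast
  next
    case False
    then have less: "\<psi> m < \<alpha>" if "0 < m" "good m" for m using that by force
    have "A < a \<or> b < B"
    proof (rule ccontr)
      assume "\<not> ?thesis"
      then have ab: "a = A" "b = B" using ord by auto
      then obtain m where "m > 0" "\<alpha> \<le> \<psi> m" using large by blast
      then show False using False ab by (auto simp: good_def)
    qed
    moreover have left: thesis
      if "A < a" "0 < m" "p m = a" "integral {p m..V} (\<lambda>s. (V - s) * w s) = m"
        "b < B \<Longrightarrow> integral {V..q m} (\<lambda>s. (s - V) * w s) = m" for m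
      using lift_left[of m] less[of m] that by (auto simp: good_def)
    moreover have right: thesis
      if "b < B" "0 < m" "q m = b" "integral {V..q m} (\<lambda>s. (s - V) * w s) = m"
        "A < a \<Longrightarrow> integral {p m..V} (\<lambda>s. (V - s) * w s) = m" for m
      using lift_right[of m] less[of m] that by (auto simp: good_def)
    ultimately show thesis
    proof (cases "A < a \<and> b < B")
      case True
      then obtain mA mB where mA: "0 < mA" "p mA = a" "integral {p mA..V} (\<lambda>s. (V - s) * w s) = mA"
        and mB: "0 < mB" "q mB = b" "integral {V..q mB} (\<lambda>s. (s - V) * w s) = mB"
        using p(8) q(8) by blast
      show thesis
      \<comment> \<open>The side that meets its end at the smaller moment blocks the growth; up to
        that moment the other side has spent its moment in full.\<close>
      proof (cases "mA \<le> mB")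
        case True
        then show thesis using left[of mA] \<open>A < a \<and> b < B\<close> mA q(7)[of mA mB] mB(3) by auto
      next
        case False
        then show thesis using right[of mB] \<open>A < a \<and> b < B\<close> mB p(7)[of mB mA] mA(3) by auto
      qed
    next
      case False
      then show thesis using \<open>A < a \<or> b < B\<close> p(8) q(8) left right by blast
    qed
  qed
qed

section \<open>The optimal cycle\<close>

lemma continuous_on_switch:
  fixes \<phi>1 \<phi>2 :: "real \<Rightarrow> real"
  assumes "continuous_on (S \<inter> {..<p}) \<phi>1" "continuous_on (S \<inter> {p<..}) \<phi>2"
  shows "continuous_on (S - {p}) (\<lambda>s. if s < p then \<phi>1 s else \<phi>2 s)"
proof -
  have eq: "S - {p} = (S \<inter> {..<p}) \<union> (S \<inter> {p<..})" by auto
  show ?thesis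
    unfolding eq
  proof (rule continuous_on_Un_local_open)
    show "openin (top_of_set ((S \<inter> {..<p}) \<union> (S \<inter> {p<..}))) (S \<inter> {..<p})"
      unfolding openin_open by (intro exI[of _ "{..<p}"]) auto
    show "openin (top_of_set ((S \<inter> {..<p}) \<union> (S \<inter> {p<..}))) (S \<inter> {p<..})"
      unfolding openin_open by (intro exI[of _ "{p<..}"]) auto
    show "continuous_on (S \<inter> {..<p}) (\<lambda>s. if s < p then \<phi>1 s else \<phi>2 s)"
      using assms(1) by (rule continuous_on_eq) auto
    show "continuous_on (S \<inter> {p<..}) (\<lambda>s. if s < p then \<phi>1 s else \<phi>2 s)"
      using assms(2) by (rule continuous_on_eq) auto
  qed
qed

text \<open>The assumptions record the outcome of \<open>optimal_line\<close>. Where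
  \<open>p = A\<close> or \<open>q = B\<close>, \<open>below\<close> is silent about that end;
  \<open>at_ends\<close> closes the gap and, with \<open>above\<close>, makes the line meet
  \<open>g\<close> there.\<close>

locale optimal_switching = controlled_speed f for f +
  fixes h1 :: "real \<Rightarrow> real" and \<alpha> A B a b V p q c lam \<tau>0 \<tau>1 :: real
    and w g line :: "real \<Rightarrow> real"
  assumes h1: "continuous_on UNIV h1" and \<alpha>: "0 < \<alpha>"
    and f1: "\<And>x. x < B \<Longrightarrow> 0 < f x True" "f B True = 0"
    and f0: "\<And>x. A < x \<Longrightarrow> f x False < 0" "f A False = 0"
    and ord: "A \<le> a" "a \<le> p" "p < V" "V < q" "q \<le> b" "b \<le> B"
    and w_def: "w = (\<lambda>s. 1 / f s True - 1 / f s False)"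
    and g_def: "g = (\<lambda>s. - (h1 s * f s False / (f s True - f s False)))"
    and line_def: "line = (\<lambda>s. c + lam * (s - V))"
    and w_int: "w integrable_on {p..q}"
    and \<tau>: "0 \<le> \<tau>0" "0 \<le> \<tau>1" "\<tau>0 > 0 \<Longrightarrow> p = A" "\<tau>1 > 0 \<Longrightarrow> q = B"
    and below: "\<And>s. s \<in> {a..b} \<Longrightarrow> s < p \<or> q < s \<Longrightarrow> line s \<le> g s"
    and above: "\<And>s. s \<in> {p..q} \<Longrightarrow> g s \<le> line s"
    and at_ends: "a = A \<Longrightarrow> line A \<le> g A" "b = B \<Longrightarrow> line B \<le> g B"
    and fixed_cost: "integral {p..q} (\<lambda>s. (line s - g s) * w s) = \<alpha>"
    and balance: "integral {p..q} (\<lambda>s. (s - V) * w s) + \<tau>1 * (B - V) - \<tau>0 * (V - A) = 0"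
begin

lemma AB: "A < V" "V < B" "A < q" "p < B" "A \<le> p" "q \<le> B" using ord by auto

lemma f1_pos: "s < B \<Longrightarrow> 0 < f s True" and f0_neg: "A < s \<Longrightarrow> f s False < 0"
  using f1 f0 by auto

lemma f1_nonzero: "s < B \<Longrightarrow> f s True \<noteq> 0" and f0_nonzero: "A < s \<Longrightarrow> f s False \<noteq> 0"
  using f1_pos f0_neg by force+

lemma f_cont: "continuous_on S (\<lambda>s. f s u)"
  using continuous_on_subset[OF cont] by auto

lemma h1_cont: "continuous_on S h1"
  using continuous_on_subset[OF h1] by auto

lemma line_cont: "continuous_on S line"
  unfolding line_def by (intro continuous_intros)

lemma g_B: "g B = h1 B" and g_A: "g A = 0"
  using f0(1)[of B] f1(2) f0(2) AB by (auto simp: g_def)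

lemma w_cont: "continuous_on {A<..<B} w"
  unfolding w_def using f1_pos f0_neg by (intro continuous_intros f_cont) force+

lemma g_cont: "continuous_on {A..B} g"
proof -
  have "f s True - f s False \<noteq> 0" if "s \<in> {A..B}" for s
    using f1_pos[of s] f0_neg[of s] f1(2) f0(2) AB that by (cases "s = B"; cases "s = A") force+
  then show ?thesis unfolding g_def by (intro continuous_intros f_cont h1_cont) auto
qed

text \<open>At \<open>s = A\<close> this relies on \<open>1 / 0 = 0\<close>, which leaves only the
  positive term \<open>1 / f A True\<close>.\<close>

lemma w_nonneg: "A \<le> s \<Longrightarrow> s < B \<Longrightarrow> 0 \<le> w s"
  using f1_pos[of s] f0_neg[of s] f0(2)
  by (cases "s = A") (auto simp: w_def divide_nonpos_neg intro: order_trans[of _ 0])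

text \<open>Coasting costs nothing, so the cost density of a double sweep is that of its
  accelerating half.\<close>

lemma gw: "A < s \<Longrightarrow> s < B \<Longrightarrow> g s * w s = h1 s / f s True"
proof -
  assume s: "A < s" "s < B"
  define F1 F0 where "F1 = f s True" and "F0 = - f s False"
  have F: "F1 > 0" "F0 > 0" using f1_pos[OF s(2)] f0_neg[OF s(1)] by (auto simp: F1_def F0_def)
  have "g s = h1 s * F0 / (F1 + F0)" by (simp add: g_def F1_def F0_def)
  moreover have "w s = (F1 + F0) / (F1 * F0)"
    using F by (simp add: w_def F1_def F0_def field_simps)
  ultimately have "g s * w s = h1 s / F1" using F by simp
  then show ?thesis by (simp add: F1_def)
qed

text \<open>The two terms that make up \<open>w\<close> are both positive inside, so each is
  dominated by their sum.\<close>

lemma reciprocals_integrable: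
  "(\<lambda>s. 1 / f s True) integrable_on {p..q}" "(\<lambda>s. 1 / f s False) integrable_on {p..q}"
proof -
  have s: "0 < f s True" "f s False < 0" if "s \<in> {p<..<q}" for s
    using that f1_pos[of s] f0_neg[of s] AB by auto
  show "(\<lambda>s. 1 / f s True) integrable_on {p..q}"
    by (rule integrable_dominated[OF _ w_int])
      (use s in \<open>force simp: w_def divide_nonpos_neg less_imp_le intro!: continuous_intros f_cont\<close>)+
  show "(\<lambda>s. 1 / f s False) integrable_on {p..q}"
    by (rule integrable_dominated[OF _ w_int])
      (use s in \<open>force simp: w_def abs_if less_imp_le intro!: continuous_intros f_cont\<close>)+
qed

text \<open>Running cost minus the price that the line charges for the speed. Over an admissible
  trajectory the line integrates to \<open>c * T\<close>, so estimates of \<open>\<rho>\<close> are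
  estimates of the cost.\<close>

definition \<rho> :: "bool \<Rightarrow> real \<Rightarrow> real" where
  "\<rho> u y = (if u then h1 y else 0) - line y"

text \<open>The difference between the coasting and the accelerating rate of the storage function.
  Its total \<alpha> is the price of one upward jump.\<close>

definition excess :: "real \<Rightarrow> real" where
  "excess s = (if s < p then 0 else if s < q then (line s - g s) * w s else 0)"

text \<open>Outside \<open>[p, q]\<close> the inequality \<open>line \<le> g\<close> leaves room in one of the two dissipation inequalities.
  Taking the accelerating one as an equality to the left of \<open>p\<close> and the coasting one to the right
  keeps the rate integrable even where the flow needs infinite time to reach \<open>A\<close> or \<open>B\<close>.\<close>

definition rate :: "bool \<Rightarrow> real \<Rightarrow> real" where
  "rate u s = (if s < p then (h1 s - line s) / f s True else - line s / f s False) - (if u then excess s else 0)"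

lemma \<rho>_cont: "continuous_on S (\<rho> u)"
  unfolding \<rho>_def by (cases u) (auto intro!: continuous_intros h1_cont line_cont)

lemma excess_nonneg: "0 \<le> excess s"
  using above[of s] w_nonneg[of s] AB by (auto simp: excess_def)

lemma excess_has_integral: "(excess has_integral \<alpha>) {a..b}"
proof -
  have lg: "continuous_on {p..q} (\<lambda>s. line s - g s)"
    using g_cont ord by (intro continuous_intros line_cont) (auto intro: continuous_on_subset)
  have "(\<lambda>s. (line s - g s) * w s) integrable_on {p..q}"
    using w_cont w_nonneg AB
    by (intro integrable_times_weight[OF lg _ _ w_int]) (auto intro: continuous_on_subset)
  then have "((\<lambda>s. (line s - g s) * w s) has_integral \<alpha>) {p..q}"
    using fixed_cost by (simp add: has_integral_iff)
  then have "((\<lambda>s. if s \<in> {p..q} then (line s - g s) * w s else 0) has_integral \<alpha>) {a..b}"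
    using ord by (subst has_integral_restrict) auto
  then show ?thesis
    by (rule has_integral_spike_finite[rotated 2, of _ _ _ "{q}"]) (auto simp: excess_def)
qed

lemma rate_integrable: "rate u integrable_on {a..b}"
proof -
  have l: "(\<lambda>s. (h1 s - line s) / f s True) integrable_on {a..p}"
    using AB by (intro integrable_continuous_real continuous_intros h1_cont line_cont f_cont) (auto simp: f1_nonzero)
  have m: "(\<lambda>s. - line s / f s False) integrable_on {p..q}"
    using AB by (intro integrable_reciprocal_times[OF f_cont _ reciprocals_integrable(2)] continuous_intros line_cont)
      (auto simp: f0_nonzero)
  have r: "(\<lambda>s. - line s / f s False) integrable_on {q..b}"
    using AB by (intro integrable_continuous_real continuous_intros line_cont f_cont) (auto simp: f0_nonzero)
  have mr: "(\<lambda>s. - line s / f s False) integrable_on {p..b}"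
    using ord by (intro Henstock_Kurzweil_Integration.integrable_combine[OF _ _ m r]) auto
  have "(\<lambda>s. if s < p then (h1 s - line s) / f s True else - line s / f s False) integrable_on {a..b}"
  proof (rule Henstock_Kurzweil_Integration.integrable_combine[of a p b])
    show "(\<lambda>s. if s < p then (h1 s - line s) / f s True else - line s / f s False) integrable_on {a..p}"
      by (rule integrable_spike_finite[OF _ _ l, of "{p}"]) auto
    show "(\<lambda>s. if s < p then (h1 s - line s) / f s True else - line s / f s False) integrable_on {p..b}"
      by (rule integrable_spike_finite[OF _ _ mr, of "{}"]) auto
  qed (use ord in auto)
  moreover have "(\<lambda>s. if u then excess s else 0) integrable_on {a..b}"
    using excess_has_integral by (cases u) (auto simp: integrable_on_def)
  ultimately show ?thesis unfolding rate_def[abs_def] by (rule integrable_diff)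
qed

lemma rate_cont: "continuous_on ({a..b} - {A, B, p, q}) (rate u)"
proof -
  let ?S = "{a..b} - {A, B, p, q}"
  have S: "A < s" "s < B" if "s \<in> ?S" for s using that ord by auto
  have nz: "f s True \<noteq> 0" "f s False \<noteq> 0" if "s \<in> ?S" for s
    using f1_pos[OF S(2)[OF that]] f0_neg[OF S(1)[OF that]] by auto
  have "continuous_on (?S - {p}) (\<lambda>s. if s < p then (h1 s - line s) / f s True else - line s / f s False)"
    by (rule continuous_on_switch) (use nz in \<open>auto intro!: continuous_intros h1_cont line_cont f_cont\<close>)
  moreover have "continuous_on (?S - {p}) excess"
    unfolding excess_def[abs_def]
  proof (rule continuous_on_switch)
    have 1: "continuous_on ((?S \<inter> {p<..}) \<inter> {..<q}) (\<lambda>s. (line s - g s) * w s)"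
      using S by (intro continuous_intros line_cont continuous_on_subset[OF g_cont] continuous_on_subset[OF w_cont]) force+
    have "continuous_on ((?S \<inter> {p<..}) - {q}) (\<lambda>s. if s < q then (line s - g s) * w s else 0)"
      by (rule continuous_on_switch[OF 1]) simp
    then show "continuous_on (?S \<inter> {p<..}) (\<lambda>s. if s < q then (line s - g s) * w s else 0)"
      by (rule continuous_on_subset) auto
  qed simp
  ultimately have "continuous_on (?S - {p}) (rate u)"
    unfolding rate_def[abs_def] by (cases u) (auto intro: continuous_on_diff)
  then show ?thesis by (rule continuous_on_subset) auto
qed

text \<open>Between \<open>p\<close> and \<open>q\<close> both modes give equality, because
  \<open>excess\<close> is exactly the difference of the two rates. Outside, one mode gives equality
  and the other is \<open>line y \<le> g y\<close> cleared of denominators.\<close>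

lemma rate_dissipates:
  assumes y: "y \<in> {a..b} - {A, B, p, q}"
  shows "rate u y * f y u \<le> \<rho> u y"
proof -
  have Ay: "A < y" "y < B" using y ord by auto
  define F1 where "F1 = f y True"
  define F0 where "F0 = - f y False"
  have F: "F1 > 0" "F0 > 0" using f1_pos[OF Ay(2)] f0_neg[OF Ay(1)] by (auto simp: F1_def F0_def)
  have gy: "g y = h1 y * F0 / (F1 + F0)" by (simp add: g_def F1_def F0_def)
  have ineq: "line y * (F1 + F0) \<le> h1 y * F0" if "line y \<le> g y"
    using that F by (simp add: gy field_simps)
  consider "y < p" | "p < y" "y < q" | "q < y" using y by fastforce
  then show ?thesis
  proof cases
    case 1
    have le: "line y * (F1 + F0) \<le> h1 y * F0" using ineq below[of y] y 1 by auto
    have r: "rate u y = (h1 y - line y) / F1" using 1 by (simp add: rate_def excess_def F1_def)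
    show ?thesis
    proof (cases u)
      case True
      then show ?thesis using F r by (simp add: \<rho>_def flip: F1_def)
    next
      case False
      have "line y * F1 \<le> (h1 y - line y) * F0" using le by (simp add: algebra_simps)
      then have "line y \<le> (h1 y - line y) * F0 / F1" using F by (simp add: field_simps)
      then show ?thesis using False r by (simp add: \<rho>_def F0_def)
    qed
  next
    case 2
    show ?thesis
    proof (cases u)
      case True
      have wy: "w y = 1 / F1 + 1 / F0" by (simp add: w_def F1_def F0_def)
      have "rate u y = line y / F0 - (line y * w y - g y * w y)"
        using 2 True by (simp add: rate_def excess_def F0_def left_diff_distrib)
      also have "\<dots> = (h1 y - line y) / F1"
        unfolding gw[OF Ay] unfolding wy F1_def[symmetric] by (simp add: diff_divide_distrib distrib_left)
      finally show ?thesis using F True by (simp add: \<rho>_def flip: F1_def)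
    next
      case False
      then show ?thesis using 2 F by (simp add: rate_def \<rho>_def F0_def)
    qed
  next
    case 3
    have le: "line y * (F1 + F0) \<le> h1 y * F0" using ineq below[of y] y 3 by auto
    have r: "rate u y = line y / F0" using 3 ord by (simp add: rate_def excess_def F0_def)
    show ?thesis
    proof (cases u)
      case True
      have "line y * F1 \<le> (h1 y - line y) * F0" using le by (simp add: algebra_simps)
      then have "line y / F0 * F1 \<le> h1 y - line y" using F by (simp add: field_simps)
      then show ?thesis using True r by (simp add: \<rho>_def F1_def)
    next
      case False
      then show ?thesis using F r by (simp add: \<rho>_def F0_def)
    qed
  qed
qed

lemma \<rho>_rest:
  assumes "y \<in> {a..b}" "f y u = 0"
  shows "0 \<le> \<rho> u y"
proof (cases u)
  case True
  then have "y = B" using f1_pos[of y] assms ord by force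
  then show ?thesis using True at_ends(2) assms ord g_B by (auto simp: \<rho>_def)
next
  case False
  then have "y = A" using f0_neg[of y] assms ord by force
  then show ?thesis using False at_ends(1) assms ord g_A by (auto simp: \<rho>_def)
qed

text \<open>The average speed is \<open>V\<close>, so the term with \<open>lam\<close> integrates to
  0; this is what makes \<open>lam\<close> a multiplier.\<close>

lemma line_average:
  assumes x: "continuous_on {0..T} x" and T: "0 < T" and avg: "1 / T * integral {0..T} x = V"
  shows "((\<lambda>r. line (x r)) has_integral c * T) {0..T}"
proof -
  have "(x has_integral V * T) {0..T}"
    using integrable_continuous_real[OF x] avg T by (simp add: has_integral_iff field_simps)
  from has_integral_add[OF has_integral_const_real[of "c - lam * V" 0 T] has_integral_mult_right[OF this, of lam]]
  show ?thesis using T by (simp add: line_def algebra_simps)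
qed

lemma cost_lower_bound:
  assumes adm: "admissible_trajectory f V T x u" and T: "0 < T" and im: "x ` {0..T} \<subseteq> {a..b}"
  shows "c \<le> 1 / T * (integral {0..T} (\<lambda>r. if u r then h1 (x r) else 0) + \<alpha> * card (up_jumps T u))"
proof -
  have sol: "solution f T x u" and pc: "piecewise_constant T u" and per: "x 0 = x T" "u 0 = u T"
    and avg: "1 / T * integral {0..T} x = V"
    using adm by (auto simp: admissible_trajectory_def)
  \<comment> \<open>In accelerating mode the storage starts \<alpha> higher and then loses
    \<open>excess\<close>, whose total is \<alpha>. The gap between the modes therefore stays
    between 0 and \<alpha>, which is what the two jump conditions ask for.\<close>
  define W where "W v y = (if v then \<alpha> else 0) + integral {a..y} (rate v)" for v y
  have W_jump: "W True y = W False y + (\<alpha> - integral {a..y} excess)"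
    and ex: "0 \<le> integral {a..y} excess" "integral {a..y} excess \<le> \<alpha>" if y: "y \<in> {a..b}" for y
  proof -
    have e: "excess integrable_on {a..b}" using excess_has_integral by blast
    have ey: "excess integrable_on {a..y}" using integrable_subinterval_real[OF e] y by auto
    have ry: "rate False integrable_on {a..y}"
      using integrable_subinterval_real[OF rate_integrable] y by auto
    have "rate True = (\<lambda>s. rate False s - excess s)" by (auto simp: rate_def)
    then show "W True y = W False y + (\<alpha> - integral {a..y} excess)"
      using integral_diff[OF ry ey] by (simp add: W_def)
    show "0 \<le> integral {a..y} excess" using ey excess_nonneg by (intro integral_nonneg) auto
    have "integral {a..y} excess \<le> integral {a..b} excess"
      using y e ey excess_nonneg by (intro integral_subset_le) auto
    then show "integral {a..y} excess \<le> \<alpha>" using excess_has_integral by (simp add: integral_unique)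
  qed
  have R: "(\<lambda>r. \<rho> (u r) (x r)) integrable_on {0..T}"
    "0 \<le> \<alpha> * card (up_jumps T u) + integral {0..T} (\<lambda>r. \<rho> (u r) (x r))"
    by (rule storage_inequality[where k = rate and X = "{A, B, p, q}" and W = W and e = "\<lambda>v. if v then \<alpha> else 0",
          OF sol T pc per im \<alpha> rate_integrable _ rate_cont \<rho>_cont rate_dissipates \<rho>_rest W_def];
        use W_jump ex in force)+
  have lin: "((\<lambda>r. line (x r)) has_integral c * T) {0..T}"
    by (rule line_average[OF solution_continuous[OF sol] T avg])
  have "((\<lambda>r. \<rho> (u r) (x r) + line (x r)) has_integral integral {0..T} (\<lambda>r. \<rho> (u r) (x r)) + c * T) {0..T}"
    using R(1) lin by (intro has_integral_add) (auto simp: integrable_integral)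
  then have "integral {0..T} (\<lambda>r. if u r then h1 (x r) else 0) = integral {0..T} (\<lambda>r. \<rho> (u r) (x r)) + c * T"
    by (simp add: \<rho>_def integral_unique)
  then show ?thesis using R(2) T by (simp add: field_simps)
qed


text \<open>The cycle is cut at speed \<open>V\<close> on the ascending branch. The control is thus
  1 at both ends of the period, and only the two switches at \<open>q\<close> and at
  \<open>p\<close> remain.\<close>

lemma optimal_cycle:
  obtains T u x where "0 < T" "admissible_trajectory f V T x u" "card (discontinuities T u) \<le> 2"
    "card (up_jumps T u) \<le> 1" "x ` {0..T} \<subseteq> {a..b}"
    "\<And>y. solution f T y u \<Longrightarrow> y 0 = V \<Longrightarrow> (\<forall>r\<in>{0..T}. y r = x r)"
    "integral {0..T} (\<lambda>r. if u r then h1 (x r) else 0) = c * T - \<alpha>"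
proof -
  have sub: "{V..q} \<subseteq> {p..q}" "{p..V} \<subseteq> {p..q}" using ord by auto
  have i1: "(\<lambda>s. 1 / f s True) integrable_on {V..q}" "(\<lambda>s. 1 / f s True) integrable_on {p..V}"
    using integrable_subinterval_real[OF reciprocals_integrable(1)] sub by auto
  obtain x1 t1 where leg1: "0 < t1" "flow_on f True x1 0 t1" "x1 0 = V" "x1 t1 = q" "x1 ` {0..t1} \<subseteq> {V..q}"
    "\<And>\<phi> :: real \<Rightarrow> real. continuous_on {V..q} \<phi> \<Longrightarrow> ((\<lambda>r. \<phi> (x1 r)) has_integral
        (integral {V..q} (\<lambda>y. \<phi> y / f y True) + \<tau>1 * \<phi> q)) {0..t1}"
  proof (rule leg_exists[of V q True V q \<tau>1 0])
    show "V < q \<and> (\<forall>y<q. 0 < f y True) \<or> q < V \<and> (\<forall>y>q. f y True < 0)"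
      using ord f1_pos by auto
  qed (use ord i1 \<tau> f1(2) in \<open>auto simp: less_imp_le\<close>)
  obtain x2 t2 where leg2: "t1 < t2" "flow_on f False x2 t1 t2" "x2 t1 = q" "x2 t2 = p" "x2 ` {t1..t2} \<subseteq> {p..q}"
    "\<And>\<phi> :: real \<Rightarrow> real. continuous_on {p..q} \<phi> \<Longrightarrow> ((\<lambda>r. \<phi> (x2 r)) has_integral
        (- integral {p..q} (\<lambda>y. \<phi> y / f y False) + \<tau>0 * \<phi> p)) {t1..t2}"
  proof (rule leg_exists[of q p False p q \<tau>0 t1])
    show "q < p \<and> (\<forall>y<p. 0 < f y False) \<or> p < q \<and> (\<forall>y>p. f y False < 0)"
      using ord f0_neg by auto
  qed (use ord reciprocals_integrable \<tau> f0(2) in \<open>auto simp: less_imp_le\<close>)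
  obtain x3 T where leg3: "t2 < T" "flow_on f True x3 t2 T" "x3 t2 = p" "x3 T = V" "x3 ` {t2..T} \<subseteq> {p..V}"
    "\<And>\<phi> :: real \<Rightarrow> real. continuous_on {p..V} \<phi> \<Longrightarrow> ((\<lambda>r. \<phi> (x3 r)) has_integral
        (integral {p..V} (\<lambda>y. \<phi> y / f y True) + 0 * \<phi> V)) {t2..T}"
  proof (rule leg_exists[of p V True p V 0 t2])
    show "p < V \<and> (\<forall>y<V. 0 < f y True) \<or> V < p \<and> (\<forall>y>V. f y True < 0)"
      using ord f1_pos by auto
  qed (use ord i1 in \<open>auto simp: less_imp_le\<close>)
  \<comment> \<open>At each switch the later value is taken, so no isolated value arises and the
    only upward jump is the arrival at \<open>t2\<close>.\<close>
  define u where "u r \<longleftrightarrow> r < t1 \<or> t2 \<le> r" for r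
  define x where "x r = (if r \<le> t1 then x1 r else if r \<le> t2 then x2 r else x3 r)" for r
  have t: "0 < t1" "t1 < t2" "t2 < T" using leg1 leg2 leg3 by auto
  have x1: "x r = x1 r" if "r \<in> {0..t1}" for r using that by (simp add: x_def)
  have x2: "x r = x2 r" if "r \<in> {t1..t2}" for r using that leg1 leg2 by (cases "r = t1") (auto simp: x_def)
  have x3: "x r = x3 r" if "r \<in> {t2..T}" for r using that t leg2 leg3 by (cases "r = t2") (auto simp: x_def)
  have fl1: "flow_on f True x 0 t1" using flow_on_cong[OF leg1(2)] x1 by simp
  have fl2: "flow_on f False x t1 t2" using flow_on_cong[OF leg2(2)] x2 by simp
  have fl3: "flow_on f True x t2 T" using flow_on_cong[OF leg3(2)] x3 by simp
  have x0: "x 0 = V" and xT: "x T = V" using x1[of 0] x3[of T] leg1 leg3 t by auto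
  have un: "{0..T} = {0..t1} \<union> ({t1..t2} \<union> {t2..T})" using t by auto
  have xim: "x r \<in> {p..q}" if r: "r \<in> {0..T}" for r
  proof -
    consider "r \<in> {0..t1}" | "r \<in> {t1..t2}" | "r \<in> {t2..T}" using r un by blast
    then show ?thesis
    proof cases
      case 1
      then show ?thesis using x1 leg1(5) sub by fastforce
    next
      case 2
      then show ?thesis using x2 leg2(5) by fastforce
    next
      case 3
      then show ?thesis using x3 leg3(5) sub by fastforce
    qed
  qed
  have xcont: "continuous_on {0..T} x"
    unfolding un by (intro continuous_on_closed_Un flow_on_continuous[OF fl1] flow_on_continuous[OF fl2]
        flow_on_continuous[OF fl3] closed_Un closed_atLeastAtMost)
  have sol: "solution f T x u"
  proof (rule solutionI[OF _ _ xcont])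
    show "finite {t1, t2}" by simp
    fix r assume r: "r \<in> {0..T} - {t1, t2}"
    consider "r < t1" | "t1 < r" "r < t2" | "t2 < r" using r by fastforce
    then show "(x has_real_derivative f (x r) (u r)) (at r within {0..T})"
    proof cases
      case 1
      have "at r within {0..T} = at r within {0..t1}"
        using 1 t by (intro at_within_nhd[of r "{..<t1}"]) auto
      then show ?thesis using fl1 1 r t by (auto simp: flow_on_def u_def)
    next
      case 2
      have "at r within {0..T} = at r within {t1..t2}"
        using 2 t by (intro at_within_nhd[of r "{t1<..<t2}"]) auto
      then show ?thesis using fl2 2 r t by (auto simp: flow_on_def u_def)
    next
      case 3
      have "at r within {0..T} = at r within {t2..T}"
        using 3 t by (intro at_within_nhd[of r "{t2<..}"]) auto
      then show ?thesis using fl3 3 r t by (auto simp: flow_on_def u_def)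
    qed
  qed (use t in auto)
  have unique: "y r = x r" if y: "solution f T y u" "y 0 = V" and r: "r \<in> {0..T}" for y r
  proof -
    have y1: "y r = x r" if "r \<in> {0..t1}" for r
      by (rule flow_on_unique[OF solution_flow_on[OF y(1)] fl1 _ that]) (use t x0 y(2) in \<open>auto simp: u_def\<close>)
    have y2: "y r = x r" if "r \<in> {t1..t2}" for r
      by (rule flow_on_unique[OF solution_flow_on[OF y(1)] fl2 _ that]) (use t y1[of t1] in \<open>auto simp: u_def\<close>)
    have y3: "y r = x r" if "r \<in> {t2..T}" for r
      by (rule flow_on_unique[OF solution_flow_on[OF y(1)] fl3 _ that]) (use t y2[of t2] in \<open>auto simp: u_def\<close>)
    show ?thesis using r un y1 y2 y3 by blast
  qed
  \<comment> \<open>The two accelerating legs together sweep \<open>{p..q}\<close> upward once and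
    the coasting leg sweeps it downward once; every observable thus becomes one speed integral plus
    the two rests.\<close>
  have cycle: "((\<lambda>r. \<phi> (u r) (x r)) has_integral (integral {p..q} (\<lambda>y. \<phi> True y / f y True - \<phi> False y / f y False)
      + \<tau>1 * \<phi> True q + \<tau>0 * \<phi> False p)) {0..T}"
    if \<phi>: "\<And>v. continuous_on {p..q} (\<phi> v)" for \<phi> :: "bool \<Rightarrow> real \<Rightarrow> real"
  proof -
    have 1: "((\<lambda>r. \<phi> (u r) (x r)) has_integral (integral {V..q} (\<lambda>y. \<phi> True y / f y True) + \<tau>1 * \<phi> True q)) {0..t1}"
      by (rule has_integral_spike_finite[OF _ _ leg1(6)[OF continuous_on_subset[OF \<phi> sub(1)]], of "{t1}"])
        (auto simp: x1 u_def)
    have 2: "((\<lambda>r. \<phi> (u r) (x r)) has_integral (- integral {p..q} (\<lambda>y. \<phi> False y / f y False) + \<tau>0 * \<phi> False p)) {t1..t2}"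
      by (rule has_integral_spike_finite[OF _ _ leg2(6)[OF \<phi>], of "{t2}"]) (auto simp: x2 u_def)
    have 3: "((\<lambda>r. \<phi> (u r) (x r)) has_integral (integral {p..V} (\<lambda>y. \<phi> True y / f y True) + 0 * \<phi> True V)) {t2..T}"
      by (rule has_integral_spike_finite[OF _ _ leg3(6)[OF continuous_on_subset[OF \<phi> sub(2)]], of "{}"])
        (auto simp: x3 u_def)
    have nz: "f y True \<noteq> 0" "f y False \<noteq> 0" if "y \<in> {p<..<q}" for y
      using that ord by (auto simp: f1_nonzero f0_nonzero)
    have iT: "(\<lambda>y. \<phi> True y / f y True) integrable_on {p..q}"
      by (rule integrable_reciprocal_times[OF f_cont nz(1) reciprocals_integrable(1) \<phi>])
    have iF: "(\<lambda>y. \<phi> False y / f y False) integrable_on {p..q}"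
      by (rule integrable_reciprocal_times[OF f_cont nz(2) reciprocals_integrable(2) \<phi>])
    have "integral {p..V} (\<lambda>y. \<phi> True y / f y True) + integral {V..q} (\<lambda>y. \<phi> True y / f y True)
        = integral {p..q} (\<lambda>y. \<phi> True y / f y True)"
      using ord by (intro Henstock_Kurzweil_Integration.integral_combine iT) auto
    moreover have "integral {p..q} (\<lambda>y. \<phi> True y / f y True - \<phi> False y / f y False)
        = integral {p..q} (\<lambda>y. \<phi> True y / f y True) - integral {p..q} (\<lambda>y. \<phi> False y / f y False)"
      by (rule integral_diff[OF iT iF])
    ultimately show ?thesis
      by (intro has_integral_eq_rhs[OF has_integral_combine[OF _ _ 1 has_integral_combine[OF _ _ 2 3]]])
        (use t in auto)
  qed
  have mean: "((\<lambda>r. x r - V) has_integral 0) {0..T}"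
  proof -
    have "integral {p..q} (\<lambda>y. (y - V) / f y True - (y - V) / f y False) = integral {p..q} (\<lambda>s. (s - V) * w s)"
      by (rule integral_cong) (simp add: w_def algebra_simps)
    \<comment> \<open>A positive resting time occurs only at an equilibrium, so \<open>q\<close> and
      \<open>p\<close> may be replaced by \<open>B\<close> and \<open>A\<close>.\<close>
    moreover have "\<tau>1 * (q - V) = \<tau>1 * (B - V)" "\<tau>0 * (p - V) = - (\<tau>0 * (V - A))"
      using \<tau> by (cases "\<tau>1 = 0"; cases "\<tau>0 = 0"; force simp: algebra_simps)+
    ultimately show ?thesis
      by (intro has_integral_eq_rhs[OF cycle[of "\<lambda>_ y. y - V"]]) (use balance in \<open>auto intro!: continuous_intros\<close>)
  qed
  have avg: "1 / T * integral {0..T} x = V"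
  proof -
    have "((\<lambda>r. (x r - V) + V) has_integral 0 + T * V) {0..T}"
      using mean has_integral_const_real[of V 0 T] t by (intro has_integral_add) auto
    then have "integral {0..T} x = T * V" by (simp add: integral_unique)
    then show ?thesis using t by simp
  qed
  have excess0: "((\<lambda>r. \<rho> (u r) (x r)) has_integral - \<alpha>) {0..T}"
  proof -
    have "integral {p..q} (\<lambda>y. \<rho> True y / f y True - \<rho> False y / f y False)
        = integral {p..q} (\<lambda>s. - ((line s - g s) * w s))"
    proof (rule integral_spike[of "{p, q}"])
      fix y assume "y \<in> {p..q} - {p, q}"
      then have y: "A < y" "y < B" using ord by auto
      have "- ((line y - g y) * w y) = g y * w y - line y * w y" by (simp add: left_diff_distrib)
      then show "- ((line y - g y) * w y) = \<rho> True y / f y True - \<rho> False y / f y False"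
        unfolding gw[OF y] by (simp add: \<rho>_def w_def algebra_simps diff_divide_distrib)
    qed simp
    also have "\<dots> = - \<alpha>" using fixed_cost by (simp only: integral_neg)
    finally have "integral {p..q} (\<lambda>y. \<rho> True y / f y True - \<rho> False y / f y False) = - \<alpha>" .
    \<comment> \<open>If there is a rest, \<open>above\<close> and \<open>at_ends\<close> make the
      line meet \<open>g\<close> at that equilibrium, so the reduced cost of resting
      vanishes.\<close>
    moreover have "\<tau>1 * \<rho> True q = 0"
    proof (cases "\<tau>1 = 0")
      case False
      then have "q = B" "b = B" using \<tau> ord by auto
      then show ?thesis using above[of q] at_ends(2) g_B ord by (auto simp: \<rho>_def)
    qed simp
    moreover have "\<tau>0 * \<rho> False p = 0"
    proof (cases "\<tau>0 = 0")
      case False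
      then have "p = A" "a = A" using \<tau> ord by auto
      then show ?thesis using above[of p] at_ends(1) g_A ord by (auto simp: \<rho>_def)
    qed simp
    ultimately show ?thesis by (intro has_integral_eq_rhs[OF cycle[of \<rho>]] \<rho>_cont) auto
  qed
  have disc: "discontinuities T u \<subseteq> {t1, t2}"
  proof
    fix r assume r: "r \<in> discontinuities T u"
    show "r \<in> {t1, t2}"
    proof (rule ccontr)
      assume n: "r \<notin> {t1, t2}"
      define S where "S = (if r < t1 then {..<t1} else if r < t2 then {t1<..<t2} else {t2<..})"
      have S: "open S" "r \<in> S" "\<And>s. s \<in> S \<Longrightarrow> u s = u r" using n t
        by (auto simp: S_def u_def split: if_splits)
      have "\<forall>\<^sub>F s in at r within {0..T}. u s = u r"
        unfolding eventually_at_topological using S by blast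
      then have "continuous (at r within {0..T}) u" by (simp add: continuous_within tendsto_discrete)
      then show False using r by (simp add: discontinuities_def)
    qed
  qed
  have up: "up_jumps T u \<subseteq> {t2}"
  proof
    fix r assume "r \<in> up_jumps T u"
    then have "(u r \<and> (\<forall>\<^sub>F s in at_left r. \<not> u s) \<and> 0 < r) \<or> (\<not> u r \<and> (\<forall>\<^sub>F s in at_right r. u s))"
      by (auto simp: up_jumps_def)
    then show "r \<in> {t2}"
    proof
      assume l: "u r \<and> (\<forall>\<^sub>F s in at_left r. \<not> u s) \<and> 0 < r"
      then obtain d where d: "d < r" "\<And>s. d < s \<Longrightarrow> s < r \<Longrightarrow> \<not> u s"
        unfolding eventually_at_left_field by blast
      show ?thesis
      proof (rule ccontr)
        assume "r \<notin> {t2}"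
        then have "r < t1 \<or> t2 < r" using l by (auto simp: u_def)
        define s where "s = (max d (if t2 < r then t2 else d) + r) / 2"
        have "d < s" "s < r" "t2 < r \<Longrightarrow> t2 < s" using d(1) by (auto simp: s_def max_def)
        then show False using d(2)[of s] \<open>r < t1 \<or> t2 < r\<close> by (auto simp: u_def)
      qed
    next
      assume l: "\<not> u r \<and> (\<forall>\<^sub>F s in at_right r. u s)"
      then obtain d where d: "r < d" "\<And>s. r < s \<Longrightarrow> s < d \<Longrightarrow> u s"
        unfolding eventually_at_right_field by blast
      define s where "s = (min d t2 + r) / 2"
      have "r < s" "s < d" "s < t2" "t1 \<le> r" using d(1) l by (auto simp: s_def min_def u_def)
      then show ?thesis using d(2)[of s] by (auto simp: u_def)
    qed
  qed
  show thesis
  proof (rule that[of T x u])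
    show "0 < T" using t by simp
    show "admissible_trajectory f V T x u"
      using sol x0 xT avg t finite_subset[OF disc]
      by (auto simp: admissible_trajectory_def piecewise_constant_def u_def)
    show "card (discontinuities T u) \<le> 2" using card_mono[OF _ disc] t by auto
    show "card (up_jumps T u) \<le> 1" using card_mono[OF _ up] by auto
    show "x ` {0..T} \<subseteq> {a..b}" using xim ord by fastforce
    show "\<forall>r\<in>{0..T}. y r = x r" if "solution f T y u" "y 0 = V" for y using unique[OF that] by blast
    have "((\<lambda>r. \<rho> (u r) (x r) + line (x r)) has_integral - \<alpha> + c * T) {0..T}"
      using excess0 line_average[OF xcont _ avg] t by (intro has_integral_add) auto
    then show "integral {0..T} (\<lambda>r. if u r then h1 (x r) else 0) = c * T - \<alpha>"
      by (simp add: \<rho>_def integral_unique)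
  qed
qed

end

section \<open>From the hypotheses on speed and cost to the convex problem\<close>

lemma strictly_convex_on_imp_convex_on:
  assumes "strictly_convex_on S F" "T \<subseteq> S" "convex T"
  shows "convex_on T F"
proof (rule convex_onI[OF _ assms(3)])
  fix t x y :: real assume t: "0 < t" "t < 1" and "x \<in> T" "y \<in> T"
  then have xy: "x \<in> S" "y \<in> S" using assms(2) by auto
  show "F ((1 - t) *\<^sub>R x + t *\<^sub>R y) \<le> (1 - t) * F x + t * F y"
  proof (cases "x = y")
    case False
    then show ?thesis
      using assms(1)[unfolded strictly_convex_on_def, THEN conjunct2, rule_format, OF xy, of t] t by simp
  qed (simp add: algebra_simps)
qed

text \<open>The primitive is continuous, so both ends can be moved inward a little. This takes the
  comparison interval away from the singularities of the weight at the equilibria.\<close>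

lemma integral_less_inner_interval:
  fixes \<phi> :: "real \<Rightarrow> real"
  assumes int: "\<phi> integrable_on {A..B}" and AB: "A < B" and less: "\<alpha> < integral {A..B} \<phi>"
  obtains p q where "A < p" "p < q" "q < B" "\<alpha> < integral {p..q} \<phi>"
proof -
  define K where "K y = integral {A..y} \<phi>" for y
  have K: "continuous_on {A..B} K"
    unfolding K_def[abs_def] using int by (rule indefinite_integral_continuous_1)
  have "continuous_on {0..(B - A) / 2} (\<lambda>t. K (B - t) - K (A + t))"
    using AB by (intro continuous_intros continuous_on_compose2[OF K]) (auto simp: field_simps)
  moreover have "K (B - 0) - K (A + 0) - \<alpha> > 0" using less by (simp add: K_def)
  moreover have "0 \<in> {0..(B - A) / 2}" using AB by simp
  ultimately obtain d where d: "d > 0" "\<And>t. t \<in> {0..(B - A) / 2} \<Longrightarrow> dist t 0 < d \<Longrightarrow>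
      dist (K (B - t) - K (A + t)) (K (B - 0) - K (A + 0)) < K (B - 0) - K (A + 0) - \<alpha>"
    unfolding continuous_on_iff by blast
  define t where "t = min d ((B - A) / 2) / 2"
  have t: "0 < t" "t < (B - A) / 2" "dist t 0 < d" using d(1) AB by (auto simp: t_def min_def)
  have "\<alpha> < K (B - t) - K (A + t)"
    using d(2)[of t] t by (auto simp: dist_real_def)
  moreover have "K (A + t) + integral {A + t..B - t} \<phi> = K (B - t)"
    unfolding K_def using t
    by (intro Henstock_Kurzweil_Integration.integral_combine integrable_subinterval_real[OF int]) auto
  ultimately show thesis using t by (intro that[of "A + t" "B - t"]) auto
qed

text \<open>The integral of \<open>(chord - g) w\<close> is the first integral of the hypothesis plus its right-hand side,
  whereas the hypothesis has the first integral on the left; being nonnegative, it only helps.\<close>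

lemma full_swing_excess:
  fixes h1 f1 f0 :: "real \<Rightarrow> real"
  defines "g \<equiv> \<lambda>s. - (h1 s * f0 s / (f1 s - f0 s))"
  assumes AB: "A < B" and f1: "\<And>s. s < B \<Longrightarrow> 0 < f1 s" "f1 B = 0"
    and f0: "\<And>s. A < s \<Longrightarrow> f0 s < 0" "f0 A = 0" and h1: "mono h1"
    and int: "interval_lebesgue_integrable lborel (ereal A) (ereal B) (\<lambda>s. (h1 B - h1 s) / f1 s)"
      "interval_lebesgue_integrable lborel (ereal B) (ereal A) (\<lambda>s. (s - A) / f0 s)"
      "interval_lebesgue_integrable lborel (ereal A) (ereal B) (\<lambda>s. (s - B) / f1 s)"
    and less: "(LBINT s=ereal A..ereal B. (h1 B - h1 s) / f1 s) + \<alpha>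
        < h1 B / (B - A) * ((LBINT s=ereal B..ereal A. (s - A) / f0 s) + (LBINT s=ereal A..ereal B. (s - B) / f1 s))"
  shows "(\<lambda>s. (chord g A B s - g s) * (1 / f1 s - 1 / f0 s)) integrable_on {A..B}"
    and "\<alpha> < integral {A..B} (\<lambda>s. (chord g A B s - g s) * (1 / f1 s - 1 / f0 s))"
proof -
  have conv: "\<phi> integrable_on {A..B}" "(LBINT s=ereal A..ereal B. \<phi> s) = integral {A..B} \<phi>"
    if "interval_lebesgue_integrable lborel (ereal A) (ereal B) \<phi>" for \<phi> :: "real \<Rightarrow> real"
  proof -
    have si: "set_integrable lborel {A<..<B} \<phi>"
      using that AB by (simp add: interval_lebesgue_integrable_def)
    show "\<phi> integrable_on {A..B}"
      using set_borel_integral_eq_integral(1)[OF si] by (simp add: integrable_on_open_interval_real)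
    show "(LBINT s=ereal A..ereal B. \<phi> s) = integral {A..B} \<phi>"
      using set_borel_integral_eq_integral(2)[OF si] AB
      by (simp add: interval_lebesgue_integral_def integral_open_interval_real)
  qed
  have int2: "interval_lebesgue_integrable lborel (ereal A) (ereal B) (\<lambda>s. (s - A) / f0 s)"
    using int(2) by (simp add: interval_integrable_endpoints_reverse)
  define I1 I2 I3 where "I1 = integral {A..B} (\<lambda>s. (h1 B - h1 s) / f1 s)"
    and "I2 = integral {A..B} (\<lambda>s. (s - A) / f0 s)" and "I3 = integral {A..B} (\<lambda>s. (s - B) / f1 s)"
  define k where "k = h1 B / (B - A)"
  have "(LBINT s=ereal B..ereal A. (s - A) / f0 s) = - I2"
    using interval_integral_endpoints_reverse[of "ereal B" "ereal A" "\<lambda>s. (s - A) / f0 s"] conv(2)[OF int2]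
    by (simp add: I2_def)
  then have main: "I1 + \<alpha> < k * (- I2 + I3)"
    using less conv(2)[OF int(1)] conv(2)[OF int(3)] by (simp add: I1_def I3_def k_def)
  have I1: "0 \<le> I1"
    unfolding I1_def
  proof (rule integral_nonneg[OF conv(1)[OF int(1)]])
    fix s assume s: "s \<in> {A..B}"
    then have "h1 s \<le> h1 B" using h1 by (auto dest: monoD)
    then show "0 \<le> (h1 B - h1 s) / f1 s" using f1(1)[of s] f1(2) s by (cases "s = B") auto
  qed
  have gA: "g A = 0" and gB: "g B = h1 B" using f0 f1(2) f0(1)[OF AB] by (auto simp: g_def)
  have ch: "chord g A B s = k * (s - A)" for s by (simp add: chord_def gA gB k_def)
  have kB: "k * (B - A) = h1 B" using AB by (simp add: k_def)
  \<comment> \<open>In the term over \<open>f1\<close>, \<open>k * (s - A)\<close> is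
    \<open>h1 B + k * (s - B)\<close>. This yields two quotients whose numerators vanish at
    \<open>B\<close> together with \<open>f1\<close>, and these are the integrals assumed to
    converge.\<close>
  have "((\<lambda>s. (h1 B - h1 s) / f1 s + k * (- ((s - A) / f0 s) + (s - B) / f1 s)) has_integral I1 + k * (- I2 + I3)) {A..B}"
    unfolding I1_def I2_def I3_def
    by (intro has_integral_add has_integral_mult_right has_integral_neg integrable_integral conv(1) int int2)
  then have hi: "((\<lambda>s. (chord g A B s - g s) * (1 / f1 s - 1 / f0 s)) has_integral I1 + k * (- I2 + I3)) {A..B}"
  proof (rule has_integral_spike_finite[rotated 2])
    show "finite {A, B}" by simp
    fix s assume "s \<in> {A..B} - {A, B}"
    then have s: "A < s" "s < B" by auto
    define F1 F0 where "F1 = f1 s" and "F0 = - f0 s"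
    have F: "F1 > 0" "F0 > 0" using f1(1)[OF s(2)] f0(1)[OF s(1)] by (auto simp: F1_def F0_def)
    have "1 / f1 s - 1 / f0 s = (F1 + F0) / (F1 * F0)" using F by (simp add: F1_def F0_def field_simps)
    moreover have "g s = h1 s * F0 / (F1 + F0)" by (simp add: g_def F1_def F0_def)
    ultimately have gw: "g s * (1 / f1 s - 1 / f0 s) = h1 s / f1 s" using F by (simp add: F1_def)
    have "(chord g A B s - g s) * (1 / f1 s - 1 / f0 s)
        = k * (s - A) / f1 s - k * (s - A) / f0 s - h1 s / f1 s"
      by (simp only: left_diff_distrib gw ch) (simp add: right_diff_distrib)
    also have "k * (s - A) / f1 s = h1 B / f1 s + k * (s - B) / f1 s"
      using kB by (simp add: algebra_simps flip: add_divide_distrib diff_divide_distrib)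
    finally show "(chord g A B s - g s) * (1 / f1 s - 1 / f0 s)
        = (h1 B - h1 s) / f1 s + k * (- ((s - A) / f0 s) + (s - B) / f1 s)"
      by (simp add: diff_divide_distrib[of "h1 B" "h1 s"] right_diff_distrib[of k "(s - B) / f1 s"])
  qed
  then show "(\<lambda>s. (chord g A B s - g s) * (1 / f1 s - 1 / f0 s)) integrable_on {A..B}" by blast
  show "\<alpha> < integral {A..B} (\<lambda>s. (chord g A B s - g s) * (1 / f1 s - 1 / f0 s))"
    using integral_unique[OF hi] main I1 by simp
qed

theorem proposition3:
  fixes f h :: "real \<Rightarrow> bool \<Rightarrow> real" and \<alpha> Vmin Vmax V a b :: real and I :: "real set"
  assumes h_nonneg: "\<And>x u. 0 \<le> h x u"
    and h_C1: "\<And>u. (\<lambda>x. h x u) C1_differentiable_on UNIV"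
    and alpha: "0 < \<alpha>"
    and A1: "\<And>u. continuous_on UNIV (\<lambda>x. f x u)"
    and A2: "forward_well_posed f"
    and B1: "0 < Vmax" "\<And>x. x < Vmax \<Longrightarrow> 0 < f x True" "f Vmax True = 0"
      "\<And>x. Vmax < x \<Longrightarrow> f x True < 0"
    and B2: "\<And>x. f x False < f x True"
    and B3: "\<And>x. Vmin < x \<Longrightarrow> f x False < 0" "\<And>x. x < Vmin \<Longrightarrow> 0 < f x False"
      "f Vmin False = 0"
    and B4: "\<And>x. h x False = 0" "\<And>x. h x False < h x True"
    and B5: "mono (\<lambda>x. h x True)"
    and B6: "interval_lebesgue_integrable lborel (ereal Vmin) (ereal Vmax)
        (\<lambda>s. (h Vmax True - h s True) / f s True)"
      "interval_lebesgue_integrable lborel (ereal Vmax) (ereal Vmin)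
        (\<lambda>s. (s - Vmin) / f s False)"
      "interval_lebesgue_integrable lborel (ereal Vmin) (ereal Vmax)
        (\<lambda>s. (s - Vmax) / f s True)"
      "(LBINT s=ereal Vmin..ereal Vmax. (h Vmax True - h s True) / f s True) + \<alpha>
        < h Vmax True / (Vmax - Vmin) *
          ((LBINT s=ereal Vmax..ereal Vmin. (s - Vmin) / f s False)
           + (LBINT s=ereal Vmin..ereal Vmax. (s - Vmax) / f s True))"
    and B7: "strictly_concave_on UNIV (\<lambda>x. h x True * f x False / (f x True - f x False)) \<or>
             strictly_convex_on UNIV (\<lambda>x. h x True * f x False / (f x True - f x False))"
    and I: "I = {a..b}" "I \<subseteq> {Vmin..Vmax}"
    and V: "0 < V" "V \<in> interior I"
  shows "(\<exists>p\<in>controls f V I. \<forall>q\<in>controls f V I. cost f h \<alpha> V p \<le> cost f h \<alpha> V q) \<and>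
         (\<exists>p\<in>controls_upto f V 2 I.
            (\<forall>q\<in>controls_upto f V 2 I. cost f h \<alpha> V p \<le> cost f h \<alpha> V q) \<and>
            (INF q\<in>controls f V I. cost f h \<alpha> V q) = cost f h \<alpha> V p)"
proof -
  define h1 where "h1 x = h x True" for x
  define w where "w = (\<lambda>s. 1 / f s True - 1 / f s False)"
  define g where "g = (\<lambda>s. - (h1 s * f s False / (f s True - f s False)))"
  have h_eq: "h x u = (if u then h1 x else 0)" for x u by (simp add: h1_def B4)
  have h1_cont: "continuous_on UNIV h1"
    unfolding h1_def[abs_def] using C1_differentiable_imp_continuous_on[OF h_C1] .
  \<comment> \<open>By \<open>B2\<close>, \<open>f Vmin True\<close> exceeds
    \<open>f Vmin False = 0\<close>, so \<open>Vmin\<close> lies where acceleration is still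
    possible.\<close>
  have AB: "Vmin < Vmax"
  proof (rule ccontr)
    assume "\<not> ?thesis"
    then have "f Vmin True \<le> 0" using B1(3,4) by (cases "Vmin = Vmax") (auto intro: less_imp_le)
    then show False using B2[of Vmin] B3(3) by simp
  qed
  have ab: "a < V" "V < b" using V(2) unfolding I(1) by (auto simp: interior_atLeastAtMost_real)
  have "a \<in> {Vmin..Vmax}" "b \<in> {Vmin..Vmax}" using I ab by auto
  then have ord: "Vmin \<le> a" "b \<le> Vmax" by auto
  have denom: "f s True - f s False \<noteq> 0" for s using B2[of s] by simp
  have g_cont: "continuous_on {Vmin..Vmax} g"
    unfolding g_def using denom
    by (intro continuous_intros continuous_on_subset[OF A1] continuous_on_subset[OF h1_cont]) auto
  have nz: "f s True \<noteq> 0" "f s False \<noteq> 0" if "s \<in> {Vmin<..<Vmax}" for s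
    using B1(2)[of s] B3(1)[of s] that by auto
  have w_cont: "continuous_on {Vmin<..<Vmax} w"
    unfolding w_def using nz by (intro continuous_intros continuous_on_subset[OF A1]) auto
  have w_pos: "0 < w s" if "s \<in> {Vmin<..<Vmax}" for s
    using B1(2)[of s] B3(1)[of s] that by (auto simp: w_def divide_less_0_iff intro: less_trans[of _ 0])
  have excess: "(\<lambda>s. (chord g Vmin Vmax s - g s) * w s) integrable_on {Vmin..Vmax}"
    "\<alpha> < integral {Vmin..Vmax} (\<lambda>s. (chord g Vmin Vmax s - g s) * w s)"
    using full_swing_excess[where ?f1.0 = "\<lambda>s. f s True" and ?f0.0 = "\<lambda>s. f s False" and ?h1.0 = h1 and \<alpha> = \<alpha>,
        OF AB B1(2,3) B3(1,3)] B5 B6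
    by (simp_all add: h1_def[abs_def] g_def w_def)
  have convex: "convex_on {Vmin..Vmax} g"
    using B7
  proof
    assume "strictly_concave_on UNIV (\<lambda>x. h x True * f x False / (f x True - f x False))"
    then show ?thesis
      unfolding strictly_concave_on_def g_def h1_def by (rule strictly_convex_on_imp_convex_on) auto
  next
    assume "strictly_convex_on UNIV (\<lambda>x. h x True * f x False / (f x True - f x False))"
    then have cc: "convex_on {Vmin..Vmax} (\<lambda>s. - g s)"
      by (auto simp: g_def h1_def intro: strictly_convex_on_imp_convex_on)
    have "integral {Vmin<..<Vmax} (\<lambda>s. (chord g Vmin Vmax s - g s) * w s) \<le> integral {Vmin<..<Vmax} (\<lambda>s. 0)"
    proof (rule integral_le)
      fix s assume s: "s \<in> {Vmin<..<Vmax}"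
      have "- g s \<le> chord (\<lambda>s. - g s) Vmin Vmax s"
        by (rule chord_above[OF cc]) (use s AB in auto)
      also have "\<dots> = - chord g Vmin Vmax s"
        by (simp add: chord_def algebra_simps diff_divide_distrib)
      finally show "(chord g Vmin Vmax s - g s) * w s \<le> 0"
        using w_pos[OF s] by (simp add: mult_le_0_iff)
    qed (use excess(1) in \<open>auto simp: integrable_on_open_interval_real\<close>)
    then have False using excess(2) alpha by (simp add: integral_open_interval_real)
    then show ?thesis ..
  qed
  have swing: "\<exists>p0 q0. Vmin < p0 \<and> p0 < q0 \<and> q0 < Vmax \<and>
      \<alpha> < integral {p0..q0} (\<lambda>s. (chord g Vmin Vmax s - g s) * w s)"
    using integral_less_inner_interval[OF excess(1) AB excess(2)] by metis
  obtain p q c lam \<tau>0 \<tau>1 where pq: "a \<le> p" "p < V" "V < q" "q \<le> b" "w integrable_on {p..q}"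
    "0 \<le> \<tau>0" "0 \<le> \<tau>1" "\<tau>0 > 0 \<Longrightarrow> p = Vmin" "\<tau>1 > 0 \<Longrightarrow> q = Vmax"
    "\<And>s. s \<in> {a..b} \<Longrightarrow> s < p \<or> q < s \<Longrightarrow> c + lam * (s - V) \<le> g s"
    "\<And>s. s \<in> {p..q} \<Longrightarrow> g s \<le> c + lam * (s - V)"
    "a = Vmin \<Longrightarrow> c + lam * (Vmin - V) \<le> g Vmin" "b = Vmax \<Longrightarrow> c + lam * (Vmax - V) \<le> g Vmax"
    "integral {p..q} (\<lambda>s. (c + lam * (s - V) - g s) * w s) = \<alpha>"
    "integral {p..q} (\<lambda>s. (s - V) * w s) + \<tau>1 * (Vmax - V) - \<tau>0 * (V - Vmin) = 0"
    by (rule optimal_line[OF ord(1) ab ord(2) w_cont w_pos g_cont convex alpha swing], assumption, rule that)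
  define line where "line = (\<lambda>s. c + lam * (s - V))"
  interpret optimal_switching f h1 \<alpha> Vmin Vmax a b V p q c lam \<tau>0 \<tau>1 w g line
    by unfold_locales (use A1 A2 h1_cont alpha B1 B3 ord pq w_def g_def line_def in auto)
  have adm: "admissible_trajectory f V T (trajectory f V T u) u" if "admissible_control f V T u" for T u
    using that unfolding admissible_control_def trajectory_def by (rule someI_ex)
  have cost_eq: "cost f h \<alpha> V (T, u) = 1 / T * (integral {0..T} (\<lambda>t. if u t then h1 (trajectory f V T u t) else 0)
      + \<alpha> * card (up_jumps T u))" for T u
    by (simp add: cost_def h_eq)
  have lower: "c \<le> cost f h \<alpha> V r" if "r \<in> controls f V I" for r
  proof -
    obtain T u where r: "r = (T, u)" by (cases r)
    then have "0 < T" "admissible_control f V T u" "trajectory f V T u ` {0..T} \<subseteq> {a..b}"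
      using that by (auto simp: controls_def controls_upto_def controls_at_in_def controls_at_def I(1))
    then show ?thesis unfolding r cost_eq by (intro cost_lower_bound adm)
  qed
  obtain T u x where cyc: "0 < T" "admissible_trajectory f V T x u" "card (discontinuities T u) \<le> 2"
    "card (up_jumps T u) \<le> 1" "x ` {0..T} \<subseteq> {a..b}"
    "\<And>y. solution f T y u \<Longrightarrow> y 0 = V \<Longrightarrow> (\<forall>r\<in>{0..T}. y r = x r)"
    "integral {0..T} (\<lambda>r. if u r then h1 (x r) else 0) = c * T - \<alpha>"
    by (rule optimal_cycle, rule that)
  have ac: "admissible_control f V T u" using cyc(2) by (auto simp: admissible_control_def)
  \<comment> \<open>\<open>trajectory\<close> is an arbitrary choice; the uniqueness clause of
    \<open>optimal_cycle\<close> identifies it with \<open>x\<close> on \<open>{0..T}\<close>, which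
    settles both the range condition and the cost.\<close>
  have tr: "trajectory f V T u r = x r" if "r \<in> {0..T}" for r
    using cyc(6)[of "trajectory f V T u"] adm[OF ac] that by (auto simp: admissible_trajectory_def)
  have "trajectory f V T u ` {0..T} = x ` {0..T}" using tr by (rule image_cong[OF refl])
  then have mem2: "(T, u) \<in> controls_upto f V 2 I"
    using cyc(1,3,5) ac by (simp add: controls_upto_def controls_at_in_def controls_at_def I(1))
  have sub: "controls_upto f V 2 I \<subseteq> controls f V I" by (auto simp: controls_def)
  have "integral {0..T} (\<lambda>t. if u t then h1 (trajectory f V T u t) else 0) = integral {0..T} (\<lambda>r. if u r then h1 (x r) else 0)"
    by (rule integral_cong) (simp add: tr)
  \<comment> \<open>Bounding the number of jumps from above is enough, since \<open>lower\<close>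
    supplies the reverse inequality.\<close>
  moreover have "\<alpha> * card (up_jumps T u) \<le> \<alpha>" using cyc(4) alpha by simp
  ultimately have upper: "cost f h \<alpha> V (T, u) \<le> c"
    using cyc(1,7) unfolding cost_eq by (simp add: field_simps)
  have best: "cost f h \<alpha> V (T, u) \<le> cost f h \<alpha> V r" if "r \<in> controls f V I" for r
    using lower[OF that] upper by simp
  have "(INF r\<in>controls f V I. cost f h \<alpha> V r) = cost f h \<alpha> V (T, u)"
    by (rule cInf_eq_minimum) (use best mem2 sub in auto)
  then show ?thesis using best mem2 sub by blast
qed

end
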